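(* Let $\vec\Phi\in\mathcal E(D^2,\mathbb R^3)$ be a weak conformal immersion, $\lambda=\log|\partial_{x_1}\vec\Phi|=\log|\partial_{x_2}\vec\Phi|$ its conformal factor, $\vec e=(\vec e_1,\vec e_2)=e^{-\lambda}(\partial_{x_1}\vec\Phi,\partial_{x_2}\vec\Phi)$ the associated coordinate orthonormal frame, and $\alpha:=\vec e_2\cdot d\vec e_1$. Then $$(\ast_g d\vec\Phi)\cdot\Big[\vec{\mathbb I}\llcorner_g\alpha+\ast_g\Big(\big[\alpha\otimes\alpha-\tfrac12|\alpha|_g^2\,g\big]\llcorner_g d\vec\Phi\Big)\Big]=0$$ and $$\Big\langle(\ast_g d\vec\Phi)\wedge\Big[\vec{\mathbb I}\llcorner_g\alpha+\ast_g\Big(\big[\alpha\otimes\alpha-\tfrac12|\alpha|_g^2\,g\big]\llcorner_g d\vec\Phi\Big)\Big]\Big\rangle_g=-\langle\ast_g d\lambda,d\vec D\rangle_g,$$ where $\vec D$ is the $\Lambda^2\mathbb R^3$-valued map on $D^2$ (unique up to constants) given by $$d\vec D=-\mathbb I\llcorner_g\ast_g d\vec\Phi\wedge\vec n .$$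
   Context: $D^2$ is the unit disc with coordinates $(x_1,x_2)$. $\mathcal E(D^2,\mathbb R^3)$ is the space of weak immersions: $\vec\Phi\in W^{1,\infty}(D^2,\mathbb R^3)$ with $g=\vec\Phi^*g_{\mathbb R^3}$ equivalent to the flat metric (two-sided bound as quadratic forms) and unit normal $\vec n=\frac{\partial_{x_1}\vec\Phi\times\partial_{x_2}\vec\Phi}{|\partial_{x_1}\vec\Phi\times\partial_{x_2}\vec\Phi|}\in W^{1,2}$. Weak conformal: in addition $|\partial_{x_1}\vec\Phi|=|\partial_{x_2}\vec\Phi|=e^\lambda$, $\partial_{x_1}\vec\Phi\cdot\partial_{x_2}\vec\Phi=0$ a.e., so $g=e^{2\lambda}(dx_1^2+dx_2^2)$. Notation: $\alpha_i=\vec e_2\cdot\partial_{x_i}\vec e_1$, $|\alpha|_g^2=e^{-2\lambda}(\alpha_1^2+\alpha_2^2)$; $\vec{\mathbb I}_{ij}=\pi_{\vec n}(\partial^2_{x_ix_j}\vec\Phi)=\mathbb I_{ij}\,\vec n$ is the second fundamental form, with scalar components $\mathbb I_{ij}$; $\ast_g$ is the Hodge operator on 1-forms, $\ast dx_1=dx_2$, $\ast dx_2=-dx_1$ (so $\ast_gd\vec\Phi=-\partial_{x_2}\vec\Phi\,dx_1+\partial_{x_1}\vec\Phi\,dx_2$). For a symmetric 2-tensor $T$ and a 1-form $\beta$ (possibly vector valued), $(T\llcorner_g\beta)_j=e^{-2\lambda}\sum_iT_{ji}\beta_i$. For $\mathbb R^3$-valued 1-forms $\vec X,\vec Y$: $\vec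 X\cdot\vec Y=e^{-2\lambda}\sum_j\vec X_j\cdot\vec Y_j$ (scalar product in $\mathbb R^3$ and $g$-contraction of the forms) and $\langle\vec X\wedge\vec Y\rangle_g=e^{-2\lambda}\sum_j\vec X_j\wedge\vec Y_j\in\Lambda^2\mathbb R^3$ (wedge in $\mathbb R^3$ and $g$-contraction of the forms). Similarly $\langle\ast_gd\lambda,d\vec D\rangle_g=e^{-2\lambda}(-\partial_{x_2}\lambda\,\partial_{x_1}\vec D+\partial_{x_1}\lambda\,\partial_{x_2}\vec D)$, and $(\mathbb I\llcorner_g\ast_gd\vec\Phi\wedge\vec n)_j=e^{-2\lambda}\sum_i\mathbb I_{ji}(\ast_gd\vec\Phi)_i\wedge\vec n$. Identities hold almost everywhere. *)

theory Defs
  imports "HOL-Analysis.Analysis"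
begin

section \<open>Weak derivatives and Sobolev spaces\<close>

definition partial_deriv :: "'n::finite \<Rightarrow> (real^'n \<Rightarrow> real) \<Rightarrow> real^'n \<Rightarrow> real" where
  "partial_deriv i f x = frechet_derivative f (at x) (axis i 1)"

text \<open>The coinductive (greatest) predicate: all iterated partial derivatives of \<open>f\<close> exist and are
  Frechet differentiable, i.e. \<open>f\<close> is of class \<open>C\<^sup>\<infinity>\<close> on the whole space.\<close>

coinductive smooth :: "(real^'n::finite \<Rightarrow> real) \<Rightarrow> bool" where
  "(\<And>x. f differentiable (at x)) \<Longrightarrow> (\<And>i. smooth (partial_deriv i f)) \<Longrightarrow> smooth f"

definition test_function :: "(real^'n::finite) set \<Rightarrow> (real^'n \<Rightarrow> real) \<Rightarrow> bool" where
  "test_function \<Omega> \<phi> \<longleftrightarrow>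
     smooth \<phi> \<and> (\<exists>K. compact K \<and> K \<subseteq> \<Omega> \<and> (\<forall>x. x \<notin> K \<longrightarrow> \<phi> x = 0))"

definition locally_integrable ::
    "(real^'n::finite) set \<Rightarrow> (real^'n \<Rightarrow> 'b::euclidean_space) \<Rightarrow> bool" where
  "locally_integrable \<Omega> f \<longleftrightarrow>
     (\<forall>K. compact K \<and> K \<subseteq> \<Omega> \<longrightarrow> integrable (lebesgue_on K) f)"

definition has_weak_partial ::
    "(real^'n::finite) set \<Rightarrow> 'n \<Rightarrow> (real^'n \<Rightarrow> 'b::euclidean_space) \<Rightarrow> (real^'n \<Rightarrow> 'b) \<Rightarrow> bool" where
  "has_weak_partial \<Omega> i f g \<longleftrightarrow>
     locally_integrable \<Omega> f \<and> locally_integrable \<Omega> g \<and>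
     (\<forall>\<phi>. test_function \<Omega> \<phi> \<longrightarrow>
        (LINT x|lebesgue_on \<Omega>. partial_deriv i \<phi> x *\<^sub>R f x) =
        - (LINT x|lebesgue_on \<Omega>. \<phi> x *\<^sub>R g x))"

definition weakly_differentiable ::
    "(real^'n::finite) set \<Rightarrow> (real^'n \<Rightarrow> 'b::euclidean_space) \<Rightarrow> bool" where
  "weakly_differentiable \<Omega> f \<longleftrightarrow> (\<forall>i. \<exists>g. has_weak_partial \<Omega> i f g)"

text \<open>A representative of the weak partial derivative, which is unique up to null sets on open
  \<open>\<Omega>\<close>; meaningful only if \<open>f\<close> has one.\<close>

definition weak_partial ::
    "(real^'n::finite) set \<Rightarrow> 'n \<Rightarrow> (real^'n \<Rightarrow> 'b::euclidean_space) \<Rightarrow> real^'n \<Rightarrow> 'b" where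
  "weak_partial \<Omega> i f = (SOME g. has_weak_partial \<Omega> i f g)"

definition L_infinity :: "(real^'n::finite) set \<Rightarrow> (real^'n \<Rightarrow> 'b::euclidean_space) \<Rightarrow> bool" where
  "L_infinity \<Omega> f \<longleftrightarrow> f \<in> borel_measurable (lebesgue_on \<Omega>) \<and>
     (\<exists>C. AE x in lebesgue_on \<Omega>. norm (f x) \<le> C)"

definition L_two :: "(real^'n::finite) set \<Rightarrow> (real^'n \<Rightarrow> 'b::euclidean_space) \<Rightarrow> bool" where
  "L_two \<Omega> f \<longleftrightarrow> f \<in> borel_measurable (lebesgue_on \<Omega>) \<and>
     integrable (lebesgue_on \<Omega>) (\<lambda>x. (norm (f x))\<^sup>2)"

definition W_1_infinity :: "(real^'n::finite) set \<Rightarrow> (real^'n \<Rightarrow> 'b::euclidean_space) \<Rightarrow> bool" where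
  "W_1_infinity \<Omega> f \<longleftrightarrow>
     L_infinity \<Omega> f \<and> (\<forall>i. \<exists>g. has_weak_partial \<Omega> i f g \<and> L_infinity \<Omega> g)"

definition W_1_two :: "(real^'n::finite) set \<Rightarrow> (real^'n \<Rightarrow> 'b::euclidean_space) \<Rightarrow> bool" where
  "W_1_two \<Omega> f \<longleftrightarrow>
     L_two \<Omega> f \<and> (\<forall>i. \<exists>g. has_weak_partial \<Omega> i f g \<and> L_two \<Omega> g)"


section \<open>Weak immersions of the disc\<close>

abbreviation disc :: "(real^2) set" where
  "disc \<equiv> ball 0 1"

abbreviation wpd :: "2 \<Rightarrow> (real^2 \<Rightarrow> 'b::euclidean_space) \<Rightarrow> real^2 \<Rightarrow> 'b" where
  "wpd \<equiv> weak_partial disc"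

definition metric :: "(real^2 \<Rightarrow> real^3) \<Rightarrow> real^2 \<Rightarrow> 2 \<Rightarrow> 2 \<Rightarrow> real" where
  "metric \<Phi> x i j = wpd i \<Phi> x \<bullet> wpd j \<Phi> x"

definition unit_normal :: "(real^2 \<Rightarrow> real^3) \<Rightarrow> real^2 \<Rightarrow> real^3" where
  "unit_normal \<Phi> x =
     cross3 (wpd 1 \<Phi> x) (wpd 2 \<Phi> x) /\<^sub>R norm (cross3 (wpd 1 \<Phi> x) (wpd 2 \<Phi> x))"

definition weak_immersions :: "(real^2 \<Rightarrow> real^3) set" where
  "weak_immersions = {\<Phi>.
     W_1_infinity disc \<Phi> \<and>
     (\<exists>C>0. AE x in lebesgue_on disc. \<forall>v::real^2.
        (norm v)\<^sup>2 / C \<le> (\<Sum>i\<in>UNIV. \<Sum>j\<in>UNIV. metric \<Phi> x i j * v $ i * v $ j) \<and>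
        (\<Sum>i\<in>UNIV. \<Sum>j\<in>UNIV. metric \<Phi> x i j * v $ i * v $ j) \<le> C * (norm v)\<^sup>2) \<and>
     W_1_two disc (unit_normal \<Phi>)}"

definition weakly_conformal :: "(real^2 \<Rightarrow> real^3) \<Rightarrow> bool" where
  "weakly_conformal \<Phi> \<longleftrightarrow>
     (AE x in lebesgue_on disc. norm (wpd 1 \<Phi> x) = norm (wpd 2 \<Phi> x) \<and> wpd 1 \<Phi> x \<bullet> wpd 2 \<Phi> x = 0)"

definition conformal_factor :: "(real^2 \<Rightarrow> real^3) \<Rightarrow> real^2 \<Rightarrow> real" where
  "conformal_factor \<Phi> x = ln (norm (wpd 1 \<Phi> x))"

definition frame :: "(real^2 \<Rightarrow> real^3) \<Rightarrow> 2 \<Rightarrow> real^2 \<Rightarrow> real^3" where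
  "frame \<Phi> i x = exp (- conformal_factor \<Phi> x) *\<^sub>R wpd i \<Phi> x"

definition connection_form :: "(real^2 \<Rightarrow> real^3) \<Rightarrow> real^2 \<Rightarrow> 2 \<Rightarrow> real" where
  "connection_form \<Phi> x i = frame \<Phi> 2 x \<bullet> wpd i (frame \<Phi> 1) x"

definition vec_second_form :: "(real^2 \<Rightarrow> real^3) \<Rightarrow> real^2 \<Rightarrow> 2 \<Rightarrow> 2 \<Rightarrow> real^3" where
  "vec_second_form \<Phi> x i j = (wpd i (wpd j \<Phi>) x \<bullet> unit_normal \<Phi> x) *\<^sub>R unit_normal \<Phi> x"

definition second_form :: "(real^2 \<Rightarrow> real^3) \<Rightarrow> real^2 \<Rightarrow> 2 \<Rightarrow> 2 \<Rightarrow> real" where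
  "second_form \<Phi> x i j = wpd i (wpd j \<Phi>) x \<bullet> unit_normal \<Phi> x"


section \<open>Pointwise tensor operations\<close>

text \<open>The value at a point of a (possibly vector valued) 1-form \<open>\<beta> = \<beta> 1 dx\<^sub>1 + \<beta> 2 dx\<^sub>2\<close> is the
  function \<open>\<beta>\<close> of its components. The parameter \<open>l\<close> below is the value of the conformal factor at
  that point, so that the metric is \<open>exp (2 * l)\<close> times the flat one.\<close>

definition differential :: "(real^2 \<Rightarrow> 'b::euclidean_space) \<Rightarrow> real^2 \<Rightarrow> 2 \<Rightarrow> 'b" where
  "differential f x i = wpd i f x"

definition hodge :: "(2 \<Rightarrow> 'b::real_vector) \<Rightarrow> 2 \<Rightarrow> 'b" where
  "hodge \<beta> j = (if j = 1 then - \<beta> 2 else \<beta> 1)"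

definition contract :: "real \<Rightarrow> (2 \<Rightarrow> 2 \<Rightarrow> real) \<Rightarrow> (2 \<Rightarrow> 'b::real_vector) \<Rightarrow> 2 \<Rightarrow> 'b" where
  "contract l T \<beta> j = exp (- 2 * l) *\<^sub>R (\<Sum>i\<in>UNIV. T j i *\<^sub>R \<beta> i)"

definition vec_contract :: "real \<Rightarrow> (2 \<Rightarrow> 2 \<Rightarrow> 'b::real_vector) \<Rightarrow> (2 \<Rightarrow> real) \<Rightarrow> 2 \<Rightarrow> 'b" where
  "vec_contract l T \<beta> j = exp (- 2 * l) *\<^sub>R (\<Sum>i\<in>UNIV. \<beta> i *\<^sub>R T j i)"

definition norm_sq_form :: "real \<Rightarrow> (2 \<Rightarrow> real) \<Rightarrow> real" where
  "norm_sq_form l \<beta> = exp (- 2 * l) * ((\<beta> 1)\<^sup>2 + (\<beta> 2)\<^sup>2)"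

definition dot_forms :: "real \<Rightarrow> (2 \<Rightarrow> real^3) \<Rightarrow> (2 \<Rightarrow> real^3) \<Rightarrow> real" where
  "dot_forms l X Y = exp (- 2 * l) * (\<Sum>j\<in>UNIV. X j \<bullet> Y j)"

definition pair_forms :: "real \<Rightarrow> (2 \<Rightarrow> real) \<Rightarrow> (2 \<Rightarrow> 'b::real_vector) \<Rightarrow> 'b" where
  "pair_forms l \<beta> \<gamma> = exp (- 2 * l) *\<^sub>R (\<Sum>j\<in>UNIV. \<beta> j *\<^sub>R \<gamma> j)"

text \<open>The second exterior power of \<open>\<real>\<^sup>3\<close> is realised as the space of skew-symmetric matrices, with
  \<open>u \<and> v\<close> the matrix with entries \<open>u\<^sub>i v\<^sub>j - u\<^sub>j v\<^sub>i\<close>.\<close>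

definition Lambda2 :: "(real^3^3) set" where
  "Lambda2 = {A. transpose A = - A}"

definition wedge :: "real^3 \<Rightarrow> real^3 \<Rightarrow> real^3^3" where
  "wedge u v = (\<chi> i j. u $ i * v $ j - u $ j * v $ i)"

definition wedge_forms :: "real \<Rightarrow> (2 \<Rightarrow> real^3) \<Rightarrow> (2 \<Rightarrow> real^3) \<Rightarrow> real^3^3" where
  "wedge_forms l X Y = exp (- 2 * l) *\<^sub>R (\<Sum>j\<in>UNIV. wedge (X j) (Y j))"


section \<open>The bracket and the potential\<close>

text \<open>The tensor \<open>\<alpha> \<otimes> \<alpha> - 1/2 |\<alpha>|\<^sup>2 g\<close>.\<close>

definition stress :: "(real^2 \<Rightarrow> real^3) \<Rightarrow> real^2 \<Rightarrow> 2 \<Rightarrow> 2 \<Rightarrow> real" where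
  "stress \<Phi> x i j =
     connection_form \<Phi> x i * connection_form \<Phi> x j
     - 1/2 * norm_sq_form (conformal_factor \<Phi> x) (connection_form \<Phi> x) * metric \<Phi> x i j"

definition bracket :: "(real^2 \<Rightarrow> real^3) \<Rightarrow> real^2 \<Rightarrow> 2 \<Rightarrow> real^3" where
  "bracket \<Phi> x j =
     vec_contract (conformal_factor \<Phi> x) (vec_second_form \<Phi> x) (connection_form \<Phi> x) j
     + hodge (contract (conformal_factor \<Phi> x) (stress \<Phi> x) (differential \<Phi> x)) j"

definition is_potential :: "(real^2 \<Rightarrow> real^3) \<Rightarrow> (real^2 \<Rightarrow> real^3^3) \<Rightarrow> bool" where
  "is_potential \<Phi> D \<longleftrightarrow>
     (\<forall>x\<in>disc. D x \<in> Lambda2) \<and>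
     (\<forall>j. has_weak_partial disc j D
        (\<lambda>x. - contract (conformal_factor \<Phi> x) (second_form \<Phi> x)
                (\<lambda>i. wedge (hodge (differential \<Phi> x) i) (unit_normal \<Phi> x)) j))"

end

theory Submission
  imports Defs
begin

text \<open>Write \<open>\<Phi>\<^sub>i\<close> for the weak partial derivatives of \<open>\<Phi>\<close>, \<open>n\<close> for the unit normal, \<open>I\<close> for the scalar second
fundamental form. The two identities are pointwise linear algebra once the second weak derivatives
of \<open>\<Phi>\<close> exist and the relations \<open>|\<Phi>\<^sub>1| = |\<Phi>\<^sub>2|\<close>, \<open>\<Phi>\<^sub>1 \<bullet> \<Phi>\<^sub>2 = 0\<close>, \<open>\<Phi>\<^sub>i \<bullet> n = 0\<close>, \<open>n \<bullet> n = 1\<close> may be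
differentiated. So the analytic work lies in regularity and in a calculus of weak derivatives.

Regularity. Conformality says \<open>\<Phi>\<^sub>1 = \<Phi>\<^sub>2 \<times> n\<close> and \<open>\<Phi>\<^sub>2 = - \<Phi>\<^sub>1 \<times> n\<close>. In the divergence of
\<open>(\<Phi>\<^sub>1, \<Phi>\<^sub>2) = (\<Phi>\<^sub>2 \<times> n, - \<Phi>\<^sub>1 \<times> n)\<close> the second derivatives of \<open>\<Phi>\<close> cancel, because mixed derivatives commute
(\<open>weak_jacobian_null_lagrangian\<close>), and what remains is \<open>\<Phi>\<^sub>2 \<times> \<partial>\<^sub>1n - \<Phi>\<^sub>1 \<times> \<partial>\<^sub>2n\<close>, a combination
of products of a bounded function and one in \<open>L\<^sup>2\<close>. The curl of \<open>(\<Phi>\<^sub>1, \<Phi>\<^sub>2)\<close> vanishes. A planar field with locally square integrable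
divergence and curl is weakly differentiable (\<open>div_curl_weak_partial\<close>), since for test
functions \<open>\<integral>|\<nabla>P|\<^sup>2 + |\<nabla>Q|\<^sup>2 = \<integral>(div (P, Q))\<^sup>2 + (curl (P, Q))\<^sup>2\<close>; mollifying and passing to the limit with this
estimate gives \<open>second_weak_partial\<close>. The conformal factor \<open>\<lambda>\<close> and \<open>e\<^bsup>-\<lambda>\<^esup>\<close> are smooth functions of
\<open>|\<Phi>\<^sub>1|\<^sup>2\<close>, which is bounded away from \<open>0\<close> and \<open>\<infinity>\<close>, so the chain rule makes them and the frame
weakly differentiable.

Geometry. Differentiating the conformality relations gives \<open>\<alpha> = *d\<lambda>\<close> (\<open>AE_connection_form\<close>). The
bracket consists of the normal field \<open>(I \<llcorner> \<alpha>) n\<close> and the tangential field \<open>*(T \<llcorner> d\<Phi>)\<close> with the symmetric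
tensor \<open>T = \<alpha> \<otimes> \<alpha> - |\<alpha>|\<^sup>2 g / 2\<close>. The scalar product with \<open>*d\<Phi>\<close> kills the former and turns the latter into the
trace of \<open>T\<close>, which is \<open>0\<close> in dimension two. Wedging with \<open>*d\<Phi>\<close> kills the latter because \<open>T\<close> is symmetric,
and turns the former into a sum over \<open>i\<close>, \<open>j\<close> of \<open>\<alpha>\<^sub>i I\<^sub>j\<^sub>i (*d\<Phi>)\<^sub>j \<and> n\<close>; as \<open>I\<close> is symmetric and
\<open>\<alpha> = *d\<lambda>\<close>, this is the right-hand side.

The potential is explicit. The cross product identifies \<open>\<Lambda>\<^sup>2\<real>\<^sup>3\<close> with \<open>\<real>\<^sup>3\<close>, and under this
identification the Weingarten equation says that \<open>- I \<llcorner> *d\<Phi> \<and> n\<close> is \<open>- dn\<close>; so \<open>D = - n\<close> works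
(\<open>is_potential_normal\<close>). Two potentials differ by a map with vanishing weak gradient, which is constant
because its mollifications are (\<open>weak_gradient_zero_imp_constant\<close>).\<close>

section \<open>Smooth functions and test functions\<close>

text \<open>Coinduction on \<^const>\<open>smooth\<close> cannot be used directly for products, as the derivative of a
product is a sum of products. Finite differentiability admits ordinary induction.\<close>

primrec diff_times :: "nat \<Rightarrow> (real^'n::finite \<Rightarrow> real) \<Rightarrow> bool" where
  "diff_times 0 f \<longleftrightarrow> True"
| "diff_times (Suc n) f \<longleftrightarrow> (\<forall>x. f differentiable (at x)) \<and> (\<forall>i. diff_times n (partial_deriv i f))"

lemma diff_times_Suc_imp: "diff_times (Suc n) f \<Longrightarrow> diff_times n f"
  by (induction n arbitrary: f) auto

lemma smooth_iff_diff_times: "smooth f \<longleftrightarrow> (\<forall>n. diff_times n f)"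
proof
  assume "smooth f"
  then have "diff_times n f" for n
  proof (induction n arbitrary: f)
    case (Suc n)
    from Suc.prems show ?case by cases (auto intro: Suc.IH)
  qed simp
  then show "\<forall>n. diff_times n f" ..
next
  assume "\<forall>n. diff_times n f"
  then show "smooth f"
  proof (coinduction arbitrary: f)
    case smooth
    have "diff_times (Suc n) f" for n using smooth by blast
    then show ?case by auto
  qed
qed

lemma smooth_differentiable: "smooth f \<Longrightarrow> f differentiable (at x)"
  by (erule smooth.cases) auto

lemma smooth_partial_deriv: "smooth f \<Longrightarrow> smooth (partial_deriv i f)"
  by (erule smooth.cases) auto

lemma smooth_continuous_on: "smooth f \<Longrightarrow> continuous_on S f"
  by (meson continuous_at_imp_continuous_on differentiable_imp_continuous_within smooth_differentiable)

lemma partial_deriv_eqI: "(f has_derivative D) (at x) \<Longrightarrow> partial_deriv i f x = D (axis i 1)"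
  unfolding partial_deriv_def by (metis frechet_derivative_at)

lemma has_derivative_partial_deriv:
  assumes "f differentiable (at x)"
  shows "(f has_derivative (\<lambda>v. \<Sum>i\<in>UNIV. v $ i * partial_deriv i f x)) (at x)"
proof -
  let ?D = "frechet_derivative f (at x)"
  have D: "(f has_derivative ?D) (at x)" using assms by (simp add: frechet_derivative_works)
  then interpret bounded_linear ?D by (rule has_derivative_bounded_linear)
  have "?D v = (\<Sum>i\<in>UNIV. v $ i * partial_deriv i f x)" for v
  proof -
    have "?D v = ?D (\<Sum>i\<in>UNIV. v $ i *\<^sub>R axis i 1)"
      by (metis basis_expansion scalar_mult_eq_scaleR)
    also have "\<dots> = (\<Sum>i\<in>UNIV. v $ i * partial_deriv i f x)"
      by (simp add: sum scaleR partial_deriv_def)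
    finally show ?thesis .
  qed
  with D show ?thesis by (metis (no_types, lifting) ext)
qed

lemma partial_deriv_const: "partial_deriv i (\<lambda>x. c) = (\<lambda>x. 0)"
  by (rule ext, rule partial_deriv_eqI[THEN trans]) auto

lemma partial_deriv_add:
  assumes "\<And>x. f differentiable (at x)" "\<And>x. g differentiable (at x)"
  shows "partial_deriv i (\<lambda>x. f x + g x) = (\<lambda>x. partial_deriv i f x + partial_deriv i g x)"
proof
  fix x
  show "partial_deriv i (\<lambda>x. f x + g x) x = partial_deriv i f x + partial_deriv i g x"
    unfolding partial_deriv_def[of i f] partial_deriv_def[of i g]
    by (rule partial_deriv_eqI)
       (intro has_derivative_add; use assms in \<open>simp add: frechet_derivative_works[symmetric]\<close>)
qed

lemma partial_deriv_diff:
  assumes "\<And>x. f differentiable (at x)" "\<And>x. g differentiable (at x)"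
  shows "partial_deriv i (\<lambda>x. f x - g x) x = partial_deriv i f x - partial_deriv i g x"
  unfolding partial_deriv_def[of i f] partial_deriv_def[of i g]
  by (rule partial_deriv_eqI)
     (intro has_derivative_diff; use assms in \<open>simp add: frechet_derivative_works[symmetric]\<close>)

lemma partial_deriv_mult:
  assumes "\<And>x. f differentiable (at x)" "\<And>x. g differentiable (at x)"
  shows "partial_deriv i (\<lambda>x. f x * g x) = (\<lambda>x. f x * partial_deriv i g x + partial_deriv i f x * g x)"
proof
  fix x
  show "partial_deriv i (\<lambda>x. f x * g x) x = f x * partial_deriv i g x + partial_deriv i f x * g x"
    unfolding partial_deriv_def[of i f] partial_deriv_def[of i g]
    by (rule partial_deriv_eqI[OF has_derivative_mult])
       (use assms in \<open>simp_all add: frechet_derivative_works[symmetric]\<close>)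
qed

lemma diff_times_const: "diff_times n (\<lambda>x. c)"
  by (induction n arbitrary: c) (auto simp: partial_deriv_const)

lemma diff_times_add: "diff_times n f \<Longrightarrow> diff_times n g \<Longrightarrow> diff_times n (\<lambda>x. f x + g x)"
  by (induction n arbitrary: f g) (auto simp: partial_deriv_add)

lemma diff_times_mult: "diff_times n f \<Longrightarrow> diff_times n g \<Longrightarrow> diff_times n (\<lambda>x. f x * g x)"
proof (induction n arbitrary: f g)
  case (Suc n)
  then have "diff_times n f" "diff_times n g" using diff_times_Suc_imp by blast+
  with Suc show ?case by (auto simp: partial_deriv_mult intro!: diff_times_add)
qed simp

lemma has_derivative_nth: "((\<lambda>x::real^'n. x $ k) has_derivative (\<lambda>v. v $ k)) (at x)"
  by (intro bounded_linear_imp_has_derivative bounded_linear_vec_nth)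

lemma diff_times_nth: "diff_times n (\<lambda>x::real^'n. x $ k)"
proof (cases n)
  case (Suc m)
  have "partial_deriv i (\<lambda>x::real^'n. x $ k) = (\<lambda>x. axis i 1 $ k)" for i
    by (rule ext, rule partial_deriv_eqI[OF has_derivative_nth])
  then show ?thesis using has_derivative_nth Suc
    by (auto simp: differentiable_def diff_times_const)
qed simp

lemma smooth_const: "smooth (\<lambda>x. c)"
  by (simp add: smooth_iff_diff_times diff_times_const)

lemma smooth_add: "smooth f \<Longrightarrow> smooth g \<Longrightarrow> smooth (\<lambda>x. f x + g x)"
  by (simp add: smooth_iff_diff_times diff_times_add)

lemma smooth_mult: "smooth f \<Longrightarrow> smooth g \<Longrightarrow> smooth (\<lambda>x. f x * g x)"
  by (simp add: smooth_iff_diff_times diff_times_mult)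

text \<open>Convolution kernels are tested as functions of \<open>y\<close> in \<open>\<rho> (x - y)\<close>.\<close>

lemma partial_deriv_reflect:
  assumes "\<And>x. f differentiable (at x)"
  shows "partial_deriv i (\<lambda>y. f (a - y)) = (\<lambda>y. - partial_deriv i f (a - y))"
proof
  fix y
  let ?D = "frechet_derivative f (at (a - y))"
  have f: "(f has_derivative ?D) (at (a - y))" using assms by (simp add: frechet_derivative_works[symmetric])
  interpret bounded_linear ?D using f by (rule has_derivative_bounded_linear)
  have "((\<lambda>y. f (a - y)) has_derivative (\<lambda>v. ?D (- v))) (at y)"
    by (rule has_derivative_compose[where f = "\<lambda>y. a - y", OF _ f]) (auto intro!: derivative_eq_intros)
  then show "partial_deriv i (\<lambda>y. f (a - y)) y = - partial_deriv i f (a - y)"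
    using neg by (simp add: partial_deriv_eqI) (simp add: partial_deriv_def)
qed

lemma differentiable_reflect:
  assumes "\<And>x. f differentiable (at x)"
  shows "(\<lambda>y. f (a - y)) differentiable (at (y::real^'n))"
proof -
  have "(f \<circ> (\<lambda>y. a - y)) differentiable (at y)"
    by (rule differentiable_chain_at) (use assms in \<open>auto intro!: derivative_intros\<close>)
  then show ?thesis by (simp add: o_def)
qed

lemma smooth_reflect: "smooth f \<Longrightarrow> smooth (\<lambda>y. f (a - y))"
proof -
  have "diff_times n f \<Longrightarrow> diff_times n (\<lambda>y. f (a - y))" for n
  proof (induction n arbitrary: f)
    case (Suc n)
    have "diff_times n (\<lambda>y. (-1) * partial_deriv i f (a - y))" for i
      by (intro diff_times_mult diff_times_const Suc.IH) (use Suc in auto)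
    then show ?case using Suc.prems by (simp add: partial_deriv_reflect differentiable_reflect)
  qed simp
  then show "smooth f \<Longrightarrow> smooth (\<lambda>y. f (a - y))" by (simp add: smooth_iff_diff_times)
qed

text \<open>The functions \<open>p (1 / t) e\<^bsup>-1/t\<^esup>\<close>, extended by \<open>0\<close> to \<open>t \<le> 0\<close>. With all polynomials \<open>p\<close> admitted,
the family is closed under differentiation, so that smoothness of \<open>e\<^bsup>-1/t\<^esup>\<close> is a single induction.\<close>

definition flat_fun :: "real poly \<Rightarrow> real \<Rightarrow> real" where
  "flat_fun p t = (if t > 0 then poly p (1 / t) * exp (- (1 / t)) else 0)"

lemma flat_fun_tendsto_0: "(flat_fun p \<longlongrightarrow> 0) (at 0)"
proof -
  have "((\<lambda>s. \<Sum>k\<le>degree p. coeff p k * (s ^ k / exp s)) \<longlongrightarrow> (\<Sum>k\<le>degree p. coeff p k * 0)) at_top"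
    by (intro tendsto_intros tendsto_power_div_exp_0)
  then have "((\<lambda>s. poly p s * exp (- s)) \<longlongrightarrow> 0) at_top"
    by (simp add: poly_altdef sum_distrib_right exp_minus divide_inverse mult.assoc)
  then have "((\<lambda>t. poly p (inverse t) * exp (- inverse t)) \<longlongrightarrow> 0) (at_right 0)"
    by (rule filterlim_compose[OF _ filterlim_inverse_at_top_right])
  then have "(flat_fun p \<longlongrightarrow> 0) (at_right 0)"
    by (rule Lim_transform_eventually)
       (auto simp: eventually_at_right_field flat_fun_def divide_inverse intro!: exI[of _ 1])
  moreover have "(flat_fun p \<longlongrightarrow> 0) (at_left 0)"
    by (rule Lim_transform_eventually[OF tendsto_const])
       (auto simp: eventually_at_left_field flat_fun_def intro!: exI[of _ "-1"])
  ultimately show ?thesis by (simp add: filterlim_split_at)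
qed

text \<open>Away from \<open>0\<close> this is the product rule. At \<open>0\<close> the difference quotient of \<open>flat_fun p\<close> is
the flat function of the polynomial \<open>X p\<close>, hence tends to \<open>0\<close>.\<close>

lemma flat_fun_deriv:
  "(flat_fun p has_real_derivative flat_fun ([:0, 0, 1:] * (p - pderiv p)) t) (at t)"
proof -
  consider "t > 0" | "t < 0" | "t = 0" by linarith
  then show ?thesis
  proof cases
    case 1
    have "((\<lambda>t. poly p (1 / t) * exp (- (1 / t))) has_real_derivative
        flat_fun ([:0, 0, 1:] * (p - pderiv p)) t) (at t)"
      using 1 by (auto intro!: derivative_eq_intros DERIV_chain2[OF poly_DERIV]
          simp: flat_fun_def field_simps power2_eq_square)
    then show ?thesis
      by (rule has_field_derivative_transform_within_open[where S = "{0<..}"]) (use 1 in \<open>auto simp: flat_fun_def\<close>)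
  next
    case 2
    have "((\<lambda>t. 0) has_real_derivative flat_fun ([:0, 0, 1:] * (p - pderiv p)) t) (at t)"
      using 2 by (simp add: flat_fun_def)
    then show ?thesis
      by (rule has_field_derivative_transform_within_open[where S = "{..<0}"]) (use 2 in \<open>auto simp: flat_fun_def\<close>)
  next
    case 3
    have "((\<lambda>h. flat_fun p h / h) \<longlongrightarrow> 0) (at 0)"
      by (rule Lim_transform_eventually[OF flat_fun_tendsto_0[of "[:0,1:] * p"]])
         (auto simp: eventually_at_filter flat_fun_def)
    then show ?thesis using 3 by (simp add: DERIV_def) (simp add: flat_fun_def)
  qed
qed

lemma smooth_flat_fun: "smooth (\<lambda>x::real^'n::finite. flat_fun p (c - x \<bullet> x))"
proof -
  have "diff_times n (\<lambda>x::real^'n. flat_fun p (c - x \<bullet> x))" for n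
  proof (induction n arbitrary: p)
    case (Suc n)
    let ?q = "[:0, 0, 1:] * (p - pderiv p)"
    have d: "((\<lambda>x::real^'n. flat_fun p (c - x \<bullet> x)) has_derivative
        (\<lambda>v. flat_fun ?q (c - x \<bullet> x) * (- 2 * (x \<bullet> v)))) (at x)" for x
      by (rule has_derivative_eq_rhs[OF has_derivative_compose[where g = "flat_fun p",
            OF _ flat_fun_deriv[unfolded has_field_derivative_def]]])
         (auto intro!: derivative_eq_intros simp: inner_commute)
    have "partial_deriv i (\<lambda>x::real^'n. flat_fun p (c - x \<bullet> x))
        = (\<lambda>x. flat_fun ?q (c - x \<bullet> x) * (- 2 * x $ i))" for i
      by (rule ext, subst partial_deriv_eqI[OF d]) (simp add: inner_axis)
    moreover have "diff_times n (\<lambda>x::real^'n. flat_fun ?q (c - x \<bullet> x) * (- 2 * x $ i))" for i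
      by (intro diff_times_mult diff_times_const diff_times_nth Suc.IH)
    ultimately show ?case
      using d unfolding diff_times.simps differentiable_def by fastforce
  qed simp
  then show ?thesis by (simp add: smooth_iff_diff_times)
qed

lemma partial_deriv_eq_0_if_constant:
  assumes "open U" "x \<in> U" "\<And>y. y \<in> U \<Longrightarrow> f y = c"
  shows "partial_deriv i f x = 0"
proof -
  have "((\<lambda>x. c) has_derivative (\<lambda>v. 0)) (at x)" by simp
  then have "(f has_derivative (\<lambda>v. 0)) (at x)"
    by (rule has_derivative_transform_within_open[where s = U]) (use assms in auto)
  then show ?thesis by (rule partial_deriv_eqI)
qed

lemma partial_deriv_eq_0_outside:
  assumes "closed K" "\<And>x. x \<notin> K \<Longrightarrow> f x = 0" "x \<notin> K"
  shows "partial_deriv i f x = 0"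
  by (rule partial_deriv_eq_0_if_constant[of "- K" x f 0]) (use assms in auto)


lemma test_functionE:
  assumes "test_function \<Omega> \<phi>"
  obtains K where "compact K" "K \<subseteq> \<Omega>" "\<And>x. x \<notin> K \<Longrightarrow> \<phi> x = 0" "\<And>i x. x \<notin> K \<Longrightarrow> partial_deriv i \<phi> x = 0"
proof -
  from assms obtain K where K: "compact K" "K \<subseteq> \<Omega>" "\<And>x. x \<notin> K \<Longrightarrow> \<phi> x = 0" "smooth \<phi>"
    by (auto simp: test_function_def)
  have "partial_deriv i \<phi> x = 0" if "x \<notin> K" for i x
    by (rule partial_deriv_eq_0_outside[OF compact_imp_closed[OF K(1)] K(3) that])
  with K that show thesis by blast
qed

lemma test_function_smooth: "test_function \<Omega> \<phi> \<Longrightarrow> smooth \<phi>"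
  by (simp add: test_function_def)

lemma test_function_outside: "test_function \<Omega> \<phi> \<Longrightarrow> x \<notin> \<Omega> \<Longrightarrow> \<phi> x = 0"
  by (auto simp: test_function_def)

lemma test_function_mono: "test_function \<Omega> \<phi> \<Longrightarrow> \<Omega> \<subseteq> \<Omega>' \<Longrightarrow> test_function \<Omega>' \<phi>"
  unfolding test_function_def by (meson order_trans)

lemma test_function_partial_deriv: "test_function \<Omega> \<phi> \<Longrightarrow> test_function \<Omega> (partial_deriv i \<phi>)"
  by (rule test_functionE, assumption)
     (unfold test_function_def[of _ "partial_deriv i \<phi>"],
      blast intro: smooth_partial_deriv test_function_smooth)

lemma test_function_smooth_mult:
  "test_function \<Omega> \<phi> \<Longrightarrow> smooth \<psi> \<Longrightarrow> test_function \<Omega> (\<lambda>x. \<phi> x * \<psi> x)"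
  by (auto simp: test_function_def smooth_mult)

lemma test_function_diff:
  assumes f: "test_function \<Omega> f" and g: "test_function \<Omega> g"
  shows "test_function \<Omega> (\<lambda>x. f x - g x)"
proof -
  obtain K where K: "compact K" "K \<subseteq> \<Omega>" "\<And>x. x \<notin> K \<Longrightarrow> f x = 0" using f by (auto simp: test_function_def)
  obtain L where L: "compact L" "L \<subseteq> \<Omega>" "\<And>x. x \<notin> L \<Longrightarrow> g x = 0" using g by (auto simp: test_function_def)
  have "smooth (\<lambda>x. f x + g x * (-1))"
    by (intro smooth_add smooth_mult smooth_const test_function_smooth[OF f] test_function_smooth[OF g])
  then have "smooth (\<lambda>x. f x - g x)" by simp
  moreover have "f x - g x = 0" if "x \<notin> K \<union> L" for x using K(3) L(3) that by auto
  ultimately show ?thesis unfolding test_function_def using K(1,2) L(1,2) by (meson Un_least compact_Un)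
qed

lemma test_function_reflect:
  assumes "test_function \<Omega> \<phi>" and "(\<lambda>y. x - y) ` \<Omega> \<subseteq> \<Omega>'"
  shows "test_function \<Omega>' (\<lambda>y. \<phi> (x - y))"
proof -
  from assms(1) obtain K where K: "compact K" "K \<subseteq> \<Omega>" "\<And>x. x \<notin> K \<Longrightarrow> \<phi> x = 0" "smooth \<phi>"
    by (auto simp: test_function_def)
  have "compact ((\<lambda>y. x - y) ` K)" 
    by (intro compact_continuous_image continuous_intros K)
  moreover have "(\<lambda>y. x - y) ` K \<subseteq> \<Omega>'" using K assms(2) by blast
  moreover have "\<phi> (x - y) = 0" if "y \<notin> (\<lambda>y. x - y) ` K" for y
  proof (rule K(3))
    show "x - y \<notin> K" using that by (metis (no_types, lifting) diff_diff_eq2 add_diff_cancel_left' imageI)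
  qed
  ultimately show ?thesis using K(4) smooth_reflect unfolding test_function_def by blast
qed

lemma test_function_bounded:
  assumes "test_function \<Omega> \<phi>"
  obtains B where "B > 0" "\<And>x. \<bar>\<phi> x\<bar> \<le> B"
proof -
  from assms obtain K where K: "compact K" "\<And>x. x \<notin> K \<Longrightarrow> \<phi> x = 0" "smooth \<phi>"
    by (auto simp: test_function_def)
  have "bounded (\<phi> ` K)"
    by (intro compact_imp_bounded compact_continuous_image smooth_continuous_on K)
  then obtain B where "B > 0" "\<And>x. x \<in> K \<Longrightarrow> \<bar>\<phi> x\<bar> \<le> B"
    by (auto simp: bounded_pos)
  with K(2) that[of B] show thesis by (metis abs_zero less_imp_le)
qed

lemma test_function_measurable: "test_function \<Omega> \<phi> \<Longrightarrow> \<phi> \<in> borel_measurable borel"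
  by (simp add: borel_measurable_continuous_onI smooth_continuous_on test_function_smooth)

text \<open>One constant bounds both difference quotients and directional derivatives; it dominates the
quotients when differentiating under the integral.\<close>

lemma test_function_Lipschitz:
  assumes "test_function \<Omega> \<phi>"
  obtains L where "L > 0" "\<And>x h. \<bar>\<phi> (x + h) - \<phi> x\<bar> \<le> L * norm h"
    "\<And>x v. \<bar>\<Sum>i\<in>UNIV. v $ i * partial_deriv i \<phi> x\<bar> \<le> L * norm v"
proof -
  have "\<exists>B. B > 0 \<and> (\<forall>x. \<bar>partial_deriv i \<phi> x\<bar> \<le> B)" for i
    using test_function_bounded[OF test_function_partial_deriv[OF assms]] by metis
  then obtain B where B: "\<And>i. B i > 0" "\<And>i x. \<bar>partial_deriv i \<phi> x\<bar> \<le> B i" by metis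
  define L where "L = (\<Sum>i\<in>UNIV. B i)"
  have L: "L > 0" unfolding L_def using B by (intro sum_pos) auto
  have 1: "\<bar>\<Sum>i\<in>UNIV. v $ i * partial_deriv i \<phi> x\<bar> \<le> L * norm v" for v x
  proof -
    have "\<bar>\<Sum>i\<in>UNIV. v $ i * partial_deriv i \<phi> x\<bar> \<le> (\<Sum>i\<in>UNIV. \<bar>v $ i * partial_deriv i \<phi> x\<bar>)"
      by (rule sum_abs)
    also have "\<dots> \<le> (\<Sum>i\<in>UNIV. norm v * B i)"
      unfolding abs_mult by (intro sum_mono mult_mono component_le_norm_cart B) auto
    finally show ?thesis by (simp add: L_def sum_distrib_left mult.commute)
  qed
  have d: "(\<phi> has_derivative (\<lambda>v. \<Sum>i\<in>UNIV. v $ i * partial_deriv i \<phi> x)) (at x)" for x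
    by (intro has_derivative_partial_deriv smooth_differentiable test_function_smooth[OF assms])
  have "\<bar>\<phi> (x + h) - \<phi> x\<bar> \<le> L * norm h" for x h
    using differentiable_bound[of UNIV \<phi> "\<lambda>x v. \<Sum>i\<in>UNIV. v $ i * partial_deriv i \<phi> x" L "x + h" x]
      d onorm_le[OF 1[unfolded real_norm_def[symmetric]]] by auto
  with 1 L that show thesis by blast
qed

section \<open>Integration by parts and symmetry of second derivatives\<close>

lemma integral_lborel_reflect:
  fixes f :: "'a::euclidean_space \<Rightarrow> real"
  assumes "f \<in> borel_measurable borel"
  shows "(LINT x|lborel. f (a - x)) = (LINT x|lborel. f x)"
proof -
  have "lborel = distr lborel borel (\<lambda>x::'a. a - x)"
    using lborel_affine[of "-1" a] by (simp add: density_1)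
  then have "(LINT x|lborel. f x) = (LINT x|distr lborel borel (\<lambda>x::'a. a - x). f x)" by simp
  also have "\<dots> = (LINT x|lborel. f (a - x))"
    by (rule integral_distr) (use assms in auto)
  finally show ?thesis ..
qed

lemma integrable_lborel_reflect:
  fixes f :: "'a::euclidean_space \<Rightarrow> real"
  assumes "integrable lborel f"
  shows "integrable lborel (\<lambda>x. f (a - x))"
proof -
  have e: "lborel = distr lborel borel (\<lambda>x::'a. a - x)"
    using lborel_affine[of "-1" a] by (simp add: density_1)
  have "integrable (distr lborel borel (\<lambda>x::'a. a - x)) f" using assms by (simp only: e[symmetric])
  then show ?thesis
    by (subst (asm) integrable_distr_eq) (use borel_measurable_integrable[OF assms] in auto)
qed

lemma integral_lborel_translate:
  fixes f :: "'a::euclidean_space \<Rightarrow> real"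
  assumes "f \<in> borel_measurable borel"
  shows "(LINT x|lborel. f (x + a)) = (LINT x|lborel. f x)"
proof -
  have "(LINT x|lborel. f x) = (LINT x|distr lborel borel ((+) a). f x)" by (simp add: lborel_distr_plus)
  also have "\<dots> = (LINT x|lborel. f (a + x))"
    by (rule integral_distr) (use assms in auto)
  finally show ?thesis by (simp add: add.commute)
qed

lemma integrable_lborel_translate:
  fixes f :: "'a::euclidean_space \<Rightarrow> real"
  assumes "integrable lborel f"
  shows "integrable lborel (\<lambda>x. f (x + a))"
proof -
  have "integrable (distr lborel borel ((+) a)) f" using assms by (simp add: lborel_distr_plus)
  then have "integrable lborel (\<lambda>x. f (a + x))"
    by (subst (asm) integrable_distr_eq) (use borel_measurable_integrable[OF assms] in auto)
  then show ?thesis by (simp add: add.commute)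
qed


lemma compact_sets_lebesgue: "compact (K::(real^'n) set) \<Longrightarrow> K \<in> sets lebesgue"
  by (simp add: borel_compact)

lemma locally_integrable_const:
  fixes \<Omega> :: "(real^'n) set"
  shows "locally_integrable \<Omega> (\<lambda>x. c)"
  unfolding locally_integrable_def
proof (intro allI impI)
  fix K :: "(real^'n) set" assume "compact K \<and> K \<subseteq> \<Omega>"
  then have "finite_measure (lebesgue_on K)"
    by (simp add: finite_measure_lebesgue_on lmeasurable_compact)
  then show "integrable (lebesgue_on K) (\<lambda>x. c)"
    by (simp add: finite_measure.integrable_const)
qed

text \<open>A test function is bounded and vanishes off a compact subset of \<open>\<Omega>\<close>.\<close>

lemma integrable_test_function_mult:
  fixes g :: "real^'n \<Rightarrow> real"
  assumes "test_function \<Omega> \<phi>" "locally_integrable \<Omega> g"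
  shows "integrable lebesgue (\<lambda>x. \<phi> x * g x)"
proof -
  obtain K where K: "compact K" "K \<subseteq> \<Omega>" "\<And>x. x \<notin> K \<Longrightarrow> \<phi> x = 0"
    using assms(1) by (auto simp: test_function_def)
  obtain B where B: "\<And>x. \<bar>\<phi> x\<bar> \<le> B" by (rule test_function_bounded[OF assms(1)]) (rule that)
  have g: "integrable (lebesgue_on K) g" using assms(2) K by (auto simp: locally_integrable_def)
  have \<phi>: "\<phi> \<in> borel_measurable (lebesgue_on K)"
    using test_function_measurable[OF assms(1)] by (simp add: measurable_restrict_space1 measurable_completion)
  have "integrable (lebesgue_on K) (\<lambda>x. \<phi> x * g x)"
  proof (rule Bochner_Integration.integrable_bound[where f = "\<lambda>x. B * g x"])
    have "\<bar>\<phi> x\<bar> * \<bar>g x\<bar> \<le> \<bar>B\<bar> * \<bar>g x\<bar>" for x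
      by (rule mult_right_mono[OF order_trans[OF B abs_ge_self]]) simp
    then have "norm (\<phi> x * g x) \<le> norm (B * g x)" for x
      by (simp only: real_norm_def abs_mult)
    then show "AE x in lebesgue_on K. norm (\<phi> x * g x) \<le> norm (B * g x)"
      by (rule AE_I2)
    show "integrable (lebesgue_on K) (\<lambda>x. B * g x)" by (rule integrable_mult_right) (rule g)
    show "(\<lambda>x. \<phi> x * g x) \<in> borel_measurable (lebesgue_on K)"
      by (rule borel_measurable_times) (use g \<phi> in auto)
  qed
  then have "integrable lebesgue (\<lambda>x. indicator K x *\<^sub>R (\<phi> x * g x))"
    using compact_sets_lebesgue[OF K(1)] by (simp add: integrable_restrict_space del: real_scaleR_def)
  also have "(\<lambda>x. indicator K x *\<^sub>R (\<phi> x * g x)) = (\<lambda>x. \<phi> x * g x)"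
  proof
    fix x show "indicator K x *\<^sub>R (\<phi> x * g x) = \<phi> x * g x"
      using K(3)[of x] by (cases "x \<in> K") auto
  qed
  finally show ?thesis .
qed

lemma integrable_test_function: "test_function \<Omega> \<phi> \<Longrightarrow> integrable lebesgue \<phi>"
  using integrable_test_function_mult[OF _ locally_integrable_const[of \<Omega> 1]] by simp

lemma integrable_lborel_test_function: "test_function \<Omega> \<phi> \<Longrightarrow> integrable lborel \<phi>"
  using integrable_test_function[of \<Omega> \<phi>] integrable_completion[of \<phi> lborel] test_function_measurable[of \<Omega> \<phi>]
  by simp

lemma smooth_has_real_derivative_line:
  assumes "smooth f"
  shows "((\<lambda>s. f (p + s *\<^sub>R axis i 1)) has_real_derivative partial_deriv i f (p + s *\<^sub>R axis i 1)) (at s)"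
proof -
  have "((\<lambda>s. f (p + s *\<^sub>R axis i 1)) has_derivative
      (\<lambda>t. \<Sum>k\<in>UNIV. (t *\<^sub>R axis i 1) $ k * partial_deriv k f (p + s *\<^sub>R axis i 1))) (at s)"
    by (rule has_derivative_compose[OF _ has_derivative_partial_deriv])
       (auto intro!: derivative_eq_intros smooth_differentiable assms)
  moreover have "(\<Sum>k\<in>UNIV. (t *\<^sub>R axis i 1) $ k * partial_deriv k f (p + s *\<^sub>R axis i 1))
      = partial_deriv i f (p + s *\<^sub>R axis i 1) * t" for t
  proof -
    have "(\<Sum>k\<in>UNIV. (t *\<^sub>R axis i 1) $ k * partial_deriv k f (p + s *\<^sub>R axis i 1))
      = (\<Sum>k\<in>UNIV. if k = i then t * partial_deriv i f (p + s *\<^sub>R axis i 1) else 0)"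
      by (rule sum.cong) (auto simp: axis_def)
    then show ?thesis by simp
  qed
  ultimately show ?thesis by (simp add: has_field_derivative_def)
qed

text \<open>The integral of a difference quotient vanishes by translation invariance; dominated
convergence passes to the derivative.\<close>

lemma integral_partial_deriv_test_function:
  assumes "test_function \<Omega> \<phi>"
  shows "(LINT x|lebesgue. partial_deriv i \<phi> x) = 0"
proof -
  obtain K where K: "compact K" "\<And>x. x \<notin> K \<Longrightarrow> \<phi> x = 0"
    using assms by (auto simp: test_function_def)
  obtain L where L: "L > 0" "\<And>x h. \<bar>\<phi> (x + h) - \<phi> x\<bar> \<le> L * norm h"
    by (rule test_function_Lipschitz[OF assms]) (rule that)
  obtain R where R: "\<And>x. x \<in> K \<Longrightarrow> norm x \<le> R"
    using compact_imp_bounded[OF K(1)] unfolding bounded_iff by blast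
  define t where "t n = inverse (real (Suc n))" for n
  have t: "t n > 0" "t n \<le> 1" for n by (auto simp: t_def divide_simps)
  have t0: "t \<longlonglongrightarrow> 0" unfolding t_def by (rule LIMSEQ_inverse_real_of_nat)
  have \<phi>: "\<phi> \<in> borel_measurable borel" "integrable lborel \<phi>"
    using assms test_function_measurable integrable_lborel_test_function by auto
  have d\<phi>: "partial_deriv i \<phi> \<in> borel_measurable borel"
    using assms test_function_measurable test_function_partial_deriv by blast
  let ?q = "\<lambda>n x. (\<phi> (x + t n *\<^sub>R axis i 1) - \<phi> x) / t n"
  have "(\<lambda>n. LINT x|lborel. ?q n x) \<longlonglongrightarrow> (LINT x|lborel. partial_deriv i \<phi> x)"
  proof (rule integral_dominated_convergence[where w = "\<lambda>x. L * indicator (cball 0 (R + 1)) x"])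
    show "integrable lborel (\<lambda>x. L * indicator (cball 0 (R + 1)) x)"
      by (intro integrable_mult_right integrable_real_indicator) (auto simp: emeasure_bounded_finite[unfolded infinity_ennreal_def])
    show "AE x in lborel. (\<lambda>n. ?q n x) \<longlonglongrightarrow> partial_deriv i \<phi> x"
    proof (rule AE_I2)
      fix x
      have "((\<lambda>s. (\<phi> (x + s *\<^sub>R axis i 1) - \<phi> x) / s) \<longlongrightarrow> partial_deriv i \<phi> x) (at 0)"
        using smooth_has_real_derivative_line[OF test_function_smooth[OF assms], of x i 0]
        by (simp add: DERIV_def)
      then show "(\<lambda>n. ?q n x) \<longlonglongrightarrow> partial_deriv i \<phi> x"
        by (rule filterlim_compose) (use t0 t in \<open>auto simp: filterlim_at less_imp_neq[symmetric]\<close>)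
    qed
    show "AE x in lborel. norm (?q n x) \<le> L * indicator (cball 0 (R + 1)) x" for n
    proof (rule AE_I2)
      fix x
      show "norm (?q n x) \<le> L * indicator (cball 0 (R + 1)) x"
      proof (cases "x \<in> cball 0 (R + 1)")
        case True
        then show ?thesis using L(2)[of x "t n *\<^sub>R axis i 1"] t[of n] by (simp add: divide_simps)
      next
        case False
        have "norm x \<le> norm (x + t n *\<^sub>R axis i 1) + norm (t n *\<^sub>R axis i (1::real) :: real^'a)"
          using norm_triangle_ineq4[of "x + t n *\<^sub>R axis i 1" "t n *\<^sub>R axis i 1"] by simp
        then have "x + t n *\<^sub>R axis i 1 \<notin> K" "x \<notin> K" using False R[of x] R[of "x + t n *\<^sub>R axis i 1"] t[of n] by auto
        then show ?thesis using K(2) False by auto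
      qed
    qed
  qed (use \<phi> d\<phi> in auto)
  moreover have "(LINT x|lborel. ?q n x) = 0" for n
    using \<phi> by (simp add: integral_lborel_translate integrable_lborel_translate)
  ultimately have "(LINT x|lborel. partial_deriv i \<phi> x) = 0" by (simp only: LIMSEQ_const_iff)
  then show ?thesis using d\<phi> by (simp add: integral_completion)
qed

lemma integration_by_parts_test_function:
  assumes "test_function \<Omega> \<phi>" "smooth \<psi>"
  shows "(LINT x|lebesgue. partial_deriv i \<phi> x * \<psi> x) = - (LINT x|lebesgue. \<phi> x * partial_deriv i \<psi> x)"
proof -
  note d = smooth_differentiable[OF test_function_smooth[OF assms(1)]] smooth_differentiable[OF assms(2)]
  have i: "integrable lebesgue (\<lambda>x. \<phi> x * partial_deriv i \<psi> x)"
    "integrable lebesgue (\<lambda>x. partial_deriv i \<phi> x * \<psi> x)"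
    by (rule integrable_test_function[OF test_function_smooth_mult[OF assms(1) smooth_partial_deriv[OF assms(2)]]],
        rule integrable_test_function[OF test_function_smooth_mult[OF test_function_partial_deriv[OF assms(1)] assms(2)]])
  moreover have "(LINT x|lebesgue. partial_deriv i (\<lambda>x. \<phi> x * \<psi> x) x) = 0"
    by (rule integral_partial_deriv_test_function[OF test_function_smooth_mult[OF assms]])
  ultimately show ?thesis
    unfolding partial_deriv_mult[OF d] using Bochner_Integration.integral_add[OF i] by linarith
qed

text \<open>The second difference over a small square is, by applying the mean value theorem in each direction,
a second derivative at an intermediate point. The second difference does not depend on the order of the
directions, which is how Schwarz's theorem follows below.\<close>

lemma mixed_partial_mean_value:
  assumes "smooth f" "h > 0"
  obtains s t where "0 < s" "s < h" "0 < t" "t < h"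
    "f (a + h *\<^sub>R axis i 1 + h *\<^sub>R axis j 1) - f (a + h *\<^sub>R axis i 1) - f (a + h *\<^sub>R axis j 1) + f a
     = h * h * partial_deriv j (partial_deriv i f) (a + s *\<^sub>R axis i 1 + t *\<^sub>R axis j 1)"
proof -
  let ?u = "\<lambda>s. f ((a + h *\<^sub>R axis j 1) + s *\<^sub>R axis i 1) - f (a + s *\<^sub>R axis i 1)"
  let ?u' = "\<lambda>s. partial_deriv i f ((a + h *\<^sub>R axis j 1) + s *\<^sub>R axis i 1) - partial_deriv i f (a + s *\<^sub>R axis i 1)"
  have "\<And>s. (?u has_real_derivative ?u' s) (at s)"
    by (intro DERIV_diff smooth_has_real_derivative_line assms)
  then obtain s where s: "0 < s" "s < h" "?u h - ?u 0 = (h - 0) * ?u' s"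
    using MVT2[of 0 h ?u ?u'] assms(2) by auto
  let ?v = "\<lambda>t. partial_deriv i f ((a + s *\<^sub>R axis i 1) + t *\<^sub>R axis j 1)"
  let ?v' = "\<lambda>t. partial_deriv j (partial_deriv i f) ((a + s *\<^sub>R axis i 1) + t *\<^sub>R axis j 1)"
  have "\<And>t. (?v has_real_derivative ?v' t) (at t)"
    by (intro smooth_has_real_derivative_line smooth_partial_deriv assms)
  then obtain t where t: "0 < t" "t < h" "?v h - ?v 0 = (h - 0) * ?v' t"
    using MVT2[of 0 h ?v ?v'] assms(2) by auto
  have "?u' s = ?v h - ?v 0" by (simp add: add.commute add.left_commute)
  then have "?u h - ?u 0 = h * h * ?v' t" using s(3) t(3) by simp
  moreover have "?u h - ?u 0 = f (a + h *\<^sub>R axis i 1 + h *\<^sub>R axis j 1) - f (a + h *\<^sub>R axis i 1) - f (a + h *\<^sub>R axis j 1) + f a"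
    by (simp add: add.commute add.left_commute)
  ultimately show thesis using s(1,2) t(1,2) that[of s t] by simp
qed

lemma partial_deriv_commute:
  fixes f :: "real^'n::finite \<Rightarrow> real"
  assumes "smooth f"
  shows "partial_deriv j (partial_deriv i f) = partial_deriv i (partial_deriv j f)"
proof
  fix a :: "real^'n"
  let ?F = "partial_deriv j (partial_deriv i f)" and ?G = "partial_deriv i (partial_deriv j f)"
  define t where "t n = inverse (real (Suc n))" for n
  have t: "t n > 0" for n by (auto simp: t_def)
  have t0: "t \<longlonglongrightarrow> 0" unfolding t_def by (rule LIMSEQ_inverse_real_of_nat)
  have near: "norm (a + s *\<^sub>R axis k 1 + s' *\<^sub>R axis l 1 - a) \<le> 2 * r"
    if "0 < s" "s < r" "0 < s'" "s' < r" for s s' r :: real and k l :: 'n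
  proof -
    have "norm (s *\<^sub>R axis k 1 + s' *\<^sub>R axis l (1::real) :: real^'n) \<le> s + s'"
      by (rule order_trans[OF norm_triangle_ineq]) (use that in simp)
    moreover have "a + s *\<^sub>R axis k 1 + s' *\<^sub>R axis l 1 - a = s *\<^sub>R axis k 1 + s' *\<^sub>R axis l 1" by simp
    ultimately have "norm (a + s *\<^sub>R axis k 1 + s' *\<^sub>R axis l 1 - a) \<le> s + s'" by simp
    then show ?thesis using that(2,4) by linarith
  qed
  have "\<exists>x y. ?F x = ?G y \<and> norm (x - a) \<le> 2 * t n \<and> norm (y - a) \<le> 2 * t n" for n
  proof -
    obtain s s' where s: "0 < s" "s < t n" "0 < s'" "s' < t n"
      "f (a + t n *\<^sub>R axis i 1 + t n *\<^sub>R axis j 1) - f (a + t n *\<^sub>R axis i 1) - f (a + t n *\<^sub>R axis j 1) + f a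
       = t n * t n * ?F (a + s *\<^sub>R axis i 1 + s' *\<^sub>R axis j 1)"
      by (rule mixed_partial_mean_value[OF assms t])
    obtain r r' where r: "0 < r" "r < t n" "0 < r'" "r' < t n"
      "f (a + t n *\<^sub>R axis j 1 + t n *\<^sub>R axis i 1) - f (a + t n *\<^sub>R axis j 1) - f (a + t n *\<^sub>R axis i 1) + f a
       = t n * t n * ?G (a + r *\<^sub>R axis j 1 + r' *\<^sub>R axis i 1)"
      by (rule mixed_partial_mean_value[OF assms t])
    have sw: "a + t n *\<^sub>R axis j 1 + t n *\<^sub>R axis i 1 = a + t n *\<^sub>R axis i 1 + t n *\<^sub>R axis j 1"
      by (simp add: add.assoc add.commute)
    have "t n * t n * ?F (a + s *\<^sub>R axis i 1 + s' *\<^sub>R axis j 1) = t n * t n * ?G (a + r *\<^sub>R axis j 1 + r' *\<^sub>R axis i 1)"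
      using s(5) r(5) unfolding sw by linarith
    then have "?F (a + s *\<^sub>R axis i 1 + s' *\<^sub>R axis j 1) = ?G (a + r *\<^sub>R axis j 1 + r' *\<^sub>R axis i 1)"
      using t[of n] by simp
    with near[OF s(1-4)] near[OF r(1-4)] show ?thesis by blast
  qed
  then obtain x y where xy: "\<And>n. ?F (x n) = ?G (y n)" "\<And>n. norm (x n - a) \<le> 2 * t n" "\<And>n. norm (y n - a) \<le> 2 * t n"
    by metis
  have lim: "u \<longlonglongrightarrow> a" if "\<And>n. norm (u n - a) \<le> 2 * t n" for u
  proof -
    have "(\<lambda>n. norm (u n - a)) \<longlonglongrightarrow> 0"
      by (rule tendsto_sandwich[OF _ _ tendsto_const tendsto_mult_right_zero[OF t0]])
         (use that in \<open>auto intro!: always_eventually\<close>)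
    then show ?thesis by (metis LIM_zero_cancel tendsto_norm_zero_cancel)
  qed
  have c: "isCont ?F a" "isCont ?G a"
    by (intro differentiable_imp_continuous_within smooth_differentiable smooth_partial_deriv assms)+
  have "(\<lambda>n. ?F (x n)) \<longlonglongrightarrow> ?F a" by (rule isCont_tendsto_compose[OF c(1) lim[OF xy(2)]])
  moreover have "(\<lambda>n. ?F (x n)) \<longlonglongrightarrow> ?G a"
    unfolding xy(1) by (rule isCont_tendsto_compose[OF c(2) lim[OF xy(3)]])
  ultimately show "?F a = ?G a" by (rule LIMSEQ_unique)
qed

section \<open>Convolution and continuity of translations\<close>

lemma has_derivative_at_sequentiallyI:
  fixes f :: "'a::real_normed_vector \<Rightarrow> 'b::real_normed_vector"
  assumes "bounded_linear D"
    and "\<And>X. X \<longlonglongrightarrow> 0 \<Longrightarrow> (\<And>n. X n \<noteq> 0) \<Longrightarrow> (\<lambda>n. (f (x + X n) - f x - D (X n)) /\<^sub>R norm (X n)) \<longlonglongrightarrow> 0"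
  shows "(f has_derivative D) (at x)"
proof -
  have "((\<lambda>h. norm (f (x + h) - f x - D h) / norm h) \<longlongrightarrow> 0) (at 0)"
    unfolding tendsto_at_iff_sequentially
  proof (intro allI impI)
    fix X :: "nat \<Rightarrow> 'a" assume X: "\<forall>i. X i \<in> UNIV - {0}" "X \<longlonglongrightarrow> 0"
    have "(\<lambda>n. norm ((f (x + X n) - f x - D (X n)) /\<^sub>R norm (X n))) \<longlonglongrightarrow> norm (0::'b)"
      by (intro tendsto_norm assms(2)) (use X in auto)
    then show "((\<lambda>h. norm (f (x + h) - f x - D h) / norm h) \<circ> X) \<longlonglongrightarrow> 0"
      by (simp add: o_def divide_inverse mult.commute)
  qed
  with assms(1) show ?thesis by (simp add: has_derivative_at)
qed

definition convolution :: "(real^'n::finite \<Rightarrow> real) \<Rightarrow> (real^'n \<Rightarrow> real) \<Rightarrow> real^'n \<Rightarrow> real" where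
  "convolution \<rho> f x = (LINT y|lebesgue. \<rho> (x - y) * f y)"

lemma test_function_measurable_lebesgue: "test_function \<Omega> \<phi> \<Longrightarrow> \<phi> \<in> borel_measurable lebesgue"
  by (simp add: measurable_completion test_function_measurable)

lemma integrable_mult_test_function:
  assumes "test_function \<Omega> \<phi>" "integrable lebesgue (f :: real^'n \<Rightarrow> real)"
  shows "integrable lebesgue (\<lambda>y. \<phi> y * f y)"
proof -
  obtain B where B: "\<And>x. \<bar>\<phi> x\<bar> \<le> B" by (rule test_function_bounded[OF assms(1)]) (rule that)
  have *: "\<bar>\<phi> x\<bar> * \<bar>f x\<bar> \<le> \<bar>B\<bar> * \<bar>f x\<bar>" for x
    by (rule mult_right_mono[OF order_trans[OF B abs_ge_self]]) simp
  show ?thesis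
  proof (rule Bochner_Integration.integrable_bound[where f = "\<lambda>x. B * f x"])
    show "AE x in lebesgue. norm (\<phi> x * f x) \<le> norm (B * f x)"
      by (rule AE_I2) (use * in \<open>simp only: real_norm_def abs_mult\<close>)
    show "(\<lambda>x. \<phi> x * f x) \<in> borel_measurable lebesgue"
      by (rule borel_measurable_times) (use assms in \<open>auto simp: test_function_measurable_lebesgue\<close>)
    show "integrable lebesgue (\<lambda>x. B * f x)" using assms(2) by (rule integrable_mult_right)
  qed
qed

lemma test_function_reflect_UNIV: "test_function \<Omega> \<phi> \<Longrightarrow> test_function UNIV (\<lambda>y. \<phi> (x - y))"
  by (rule test_function_reflect) auto

lemma integrable_convolution:
  "test_function \<Omega> \<rho> \<Longrightarrow> integrable lebesgue f \<Longrightarrow> integrable lebesgue (\<lambda>y. \<rho> (x - y) * f y)"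
  by (rule integrable_mult_test_function[OF test_function_reflect_UNIV])

text \<open>Differentiation under the integral: the difference quotients of the kernel are bounded by a Lipschitz
constant, so dominated convergence applies.\<close>

lemma convolution_has_derivative:
  assumes \<rho>: "test_function \<Omega> \<rho>" and f: "integrable lebesgue f"
  shows "(convolution \<rho> f has_derivative (\<lambda>v. \<Sum>i\<in>UNIV. v $ i * convolution (partial_deriv i \<rho>) f x)) (at x)"
proof (rule has_derivative_at_sequentiallyI)
  show "bounded_linear (\<lambda>v. \<Sum>i\<in>UNIV. v $ i * convolution (partial_deriv i \<rho>) f x)"
    by (intro bounded_linear_sum bounded_linear_mult_const bounded_linear_vec_nth)
next
  fix X :: "nat \<Rightarrow> real^'a" assume X: "X \<longlonglongrightarrow> 0" "\<And>n. X n \<noteq> 0"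
  obtain L where L: "L > 0" "\<And>x h. \<bar>\<rho> (x + h) - \<rho> x\<bar> \<le> L * norm h"
    "\<And>x v. \<bar>\<Sum>i\<in>UNIV. v $ i * partial_deriv i \<rho> x\<bar> \<le> L * norm v"
    by (rule test_function_Lipschitz[OF \<rho>]) (rule that)
  \<comment> \<open>the integrand of the difference quotient of the convolution, without the factor \<open>f y\<close>\<close>
  define q where "q n y = (\<rho> (x + X n - y) - \<rho> (x - y) - (\<Sum>i\<in>UNIV. X n $ i * partial_deriv i \<rho> (x - y))) / norm (X n)" for n y
  have int: "integrable lebesgue (\<lambda>y. \<rho> (x - y) * f y)" for x
    by (rule integrable_convolution[OF \<rho> f])
  have intd: "integrable lebesgue (\<lambda>y. partial_deriv i \<rho> (x - y) * f y)" for x i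
    by (rule integrable_convolution[OF test_function_partial_deriv[OF \<rho>] f])
  have q_eq: "q n y * f y = (\<rho> (x + X n - y) * f y - \<rho> (x - y) * f y - (\<Sum>i\<in>UNIV. X n $ i * (partial_deriv i \<rho> (x - y) * f y))) / norm (X n)" for n y
    by (simp add: q_def diff_divide_distrib left_diff_distrib sum_distrib_right sum_divide_distrib mult.assoc)
  have q: "(convolution \<rho> f (x + X n) - convolution \<rho> f x - (\<Sum>i\<in>UNIV. X n $ i * convolution (partial_deriv i \<rho>) f x)) /\<^sub>R norm (X n)
      = (LINT y|lebesgue. q n y * f y)" for n
  proof -
    have "(LINT y|lebesgue. q n y * f y) = (LINT y|lebesgue. \<rho> (x + X n - y) * f y - \<rho> (x - y) * f y - (\<Sum>i\<in>UNIV. X n $ i * (partial_deriv i \<rho> (x - y) * f y))) / norm (X n)"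
      unfolding q_eq by simp
    also have "(LINT y|lebesgue. \<rho> (x + X n - y) * f y - \<rho> (x - y) * f y - (\<Sum>i\<in>UNIV. X n $ i * (partial_deriv i \<rho> (x - y) * f y)))
      = convolution \<rho> f (x + X n) - convolution \<rho> f x - (\<Sum>i\<in>UNIV. X n $ i * convolution (partial_deriv i \<rho>) f x)"
      unfolding convolution_def
      by (subst Bochner_Integration.integral_diff Bochner_Integration.integral_sum
          | intro Bochner_Integration.integrable_diff Bochner_Integration.integrable_sum integrable_mult_right int intd
          | simp)+
    finally show ?thesis by (simp add: divide_inverse mult.commute)
  qed
  have "(\<lambda>n. LINT y|lebesgue. q n y * f y) \<longlonglongrightarrow> (LINT y|(lebesgue :: (real^'a) measure). 0 :: real)"
  proof (rule integral_dominated_convergence[where w = "\<lambda>y. 2 * L * \<bar>f y\<bar>"])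
    show "integrable lebesgue (\<lambda>y. 2 * L * \<bar>f y\<bar>)" using f by simp
    show "(\<lambda>y. q n y * f y) \<in> borel_measurable lebesgue" for n
      unfolding q_eq
      by (intro borel_measurable_divide borel_measurable_diff borel_measurable_sum borel_measurable_times
          borel_measurable_const borel_measurable_integrable[OF f]
          test_function_measurable_lebesgue[OF test_function_reflect_UNIV[OF \<rho>]]
          test_function_measurable_lebesgue[OF test_function_reflect_UNIV[OF test_function_partial_deriv[OF \<rho>]]])
    have "\<bar>q n y\<bar> \<le> 2 * L" for n y
    proof -
      let ?s = "\<Sum>i\<in>UNIV. X n $ i * partial_deriv i \<rho> (x - y)"
      have shift: "x + X n - y = (x - y) + X n" by simp
      have "\<bar>\<rho> (x + X n - y) - \<rho> (x - y)\<bar> \<le> L * norm (X n)" unfolding shift by (rule L(2))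
      moreover have "\<bar>?s\<bar> \<le> L * norm (X n)" by (rule L(3))
      ultimately have "\<bar>\<rho> (x + X n - y) - \<rho> (x - y) - ?s\<bar> \<le> 2 * L * norm (X n)" by linarith
      then show ?thesis using X(2)[of n] by (simp add: q_def divide_simps)
    qed
    then have "\<bar>q n y\<bar> * \<bar>f y\<bar> \<le> 2 * L * \<bar>f y\<bar>" for n y by (rule mult_right_mono) simp
    then show "AE y in lebesgue. norm (q n y * f y) \<le> 2 * L * \<bar>f y\<bar>" for n
      by (intro AE_I2) (simp only: real_norm_def abs_mult)
    show "AE y in lebesgue. (\<lambda>n. q n y * f y) \<longlonglongrightarrow> 0"
    proof (rule AE_I2)
      fix y
      have "(\<rho> has_derivative (\<lambda>v. \<Sum>i\<in>UNIV. v $ i * partial_deriv i \<rho> (x - y))) (at (x - y))"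
        by (intro has_derivative_partial_deriv smooth_differentiable test_function_smooth[OF \<rho>])
      then have "((\<lambda>h. norm (\<rho> (x - y + h) - \<rho> (x - y) - (\<Sum>i\<in>UNIV. h $ i * partial_deriv i \<rho> (x - y))) / norm h) \<longlongrightarrow> 0) (at 0)"
        by (simp add: has_derivative_at)
      moreover have "filterlim X (at 0) sequentially" using X by (simp add: filterlim_at)
      ultimately have "(\<lambda>n. norm (\<rho> (x - y + X n) - \<rho> (x - y) - (\<Sum>i\<in>UNIV. X n $ i * partial_deriv i \<rho> (x - y))) / norm (X n)) \<longlonglongrightarrow> 0"
        by (rule filterlim_compose)
      moreover have "norm (\<rho> (x - y + X n) - \<rho> (x - y) - (\<Sum>i\<in>UNIV. X n $ i * partial_deriv i \<rho> (x - y))) / norm (X n) = \<bar>q n y\<bar>" for n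
        by (simp add: q_def abs_divide algebra_simps)
      ultimately have "(\<lambda>n. q n y) \<longlonglongrightarrow> 0" by (simp add: tendsto_rabs_zero_iff)
      then show "(\<lambda>n. q n y * f y) \<longlonglongrightarrow> 0" by (rule tendsto_mult_left_zero)
    qed
  qed auto
  then show "(\<lambda>n. (convolution \<rho> f (x + X n) - convolution \<rho> f x - (\<Sum>i\<in>UNIV. X n $ i * convolution (partial_deriv i \<rho>) f x)) /\<^sub>R norm (X n)) \<longlonglongrightarrow> 0"
    unfolding q by simp
qed

lemma partial_deriv_convolution:
  assumes "test_function \<Omega> \<rho>" "integrable lebesgue f"
  shows "partial_deriv i (convolution \<rho> f) = convolution (partial_deriv i \<rho>) f"
proof
  fix x
  have "partial_deriv i (convolution \<rho> f) x = (\<Sum>k\<in>UNIV. axis i 1 $ k * convolution (partial_deriv k \<rho>) f x)"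
    by (rule partial_deriv_eqI[OF convolution_has_derivative[OF assms]])
  also have "\<dots> = (\<Sum>k\<in>UNIV. if k = i then convolution (partial_deriv i \<rho>) f x else 0)"
    by (rule sum.cong) (auto simp: axis_def)
  finally show "partial_deriv i (convolution \<rho> f) x = convolution (partial_deriv i \<rho>) f x" by simp
qed

text \<open>A derivative of a convolution is again a convolution with a test function, so the induction closes.\<close>

lemma smooth_convolution:
  assumes "test_function \<Omega> \<rho>" "integrable lebesgue f"
  shows "smooth (convolution \<rho> f)"
proof -
  have "diff_times n (convolution \<rho> f)" for n
    using assms(1)
  proof (induction n arbitrary: \<rho>)
    case (Suc n)
    have "diff_times n (partial_deriv i (convolution \<rho> f))" for i
      unfolding partial_deriv_convolution[OF Suc.prems assms(2)]
      by (rule Suc.IH[OF test_function_partial_deriv[OF Suc.prems]])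
    moreover have "convolution \<rho> f differentiable (at x)" for x
      unfolding differentiable_def using convolution_has_derivative[OF Suc.prems assms(2)] by blast
    ultimately show ?case by simp
  qed simp
  then show ?thesis by (simp add: smooth_iff_diff_times)
qed


text \<open>Continuity of translations in \<open>L\<^sup>1\<close> is inherited by \<open>L\<^sup>1\<close> limits, because translations are isometries.\<close>

lemma translation_continuous_L1_closed:
  fixes f :: "'a::euclidean_space \<Rightarrow> real"
  assumes f: "integrable lborel f"
    and approx: "\<And>e. e > 0 \<Longrightarrow> \<exists>g. integrable lborel g \<and> (LINT x|lborel. \<bar>g x - f x\<bar>) \<le> e \<and>
      (\<lambda>n. LINT x|lborel. \<bar>g (x - z n) - g x\<bar>) \<longlonglongrightarrow> 0"
  shows "(\<lambda>n. LINT x|lborel. \<bar>f (x - z n) - f x\<bar>) \<longlonglongrightarrow> 0"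
proof (rule LIMSEQ_I)
  fix e :: real assume e: "e > 0"
  obtain g where g: "integrable lborel g" "(LINT x|lborel. \<bar>g x - f x\<bar>) \<le> e / 4"
    "(\<lambda>n. LINT x|lborel. \<bar>g (x - z n) - g x\<bar>) \<longlonglongrightarrow> 0"
    using approx[of "e / 4"] e by auto
  obtain N where N: "\<And>n. n \<ge> N \<Longrightarrow> \<bar>LINT x|lborel. \<bar>g (x - z n) - g x\<bar>\<bar> < e / 2"
    using LIMSEQ_D[OF g(3), of "e / 2"] e by auto
  have tr: "integrable lborel (\<lambda>x. h (x - z n))" if "integrable lborel h" for h :: "'a \<Rightarrow> real" and n
    using integrable_lborel_translate[OF that, of "- z n"] by simp
  have "(LINT x|lborel. \<bar>f (x - z n) - f x\<bar>) < e" if "n \<ge> N" for n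
  proof -
    have "(LINT x|lborel. \<bar>f (x - z n) - f x\<bar>)
        \<le> (LINT x|lborel. \<bar>g (x - z n) - f (x - z n)\<bar> + \<bar>g (x - z n) - g x\<bar> + \<bar>g x - f x\<bar>)"
      by (rule integral_mono) (use f g tr in auto)
    also have "\<dots> = (LINT x|lborel. \<bar>g (x - z n) - f (x - z n)\<bar>) + (LINT x|lborel. \<bar>g (x - z n) - g x\<bar>)
        + (LINT x|lborel. \<bar>g x - f x\<bar>)"
      using f g tr by simp
    also have "(LINT x|lborel. \<bar>g (x - z n) - f (x - z n)\<bar>) = (LINT x|lborel. \<bar>g x - f x\<bar>)"
      using integral_lborel_translate[of "\<lambda>x. \<bar>g x - f x\<bar>" "- z n"] f g by simp
    finally show ?thesis using g(2) N[OF that] by linarith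
  qed
  moreover have "(LINT x|lborel. \<bar>f (x - z n) - f x\<bar>) \<ge> 0" for n by simp
  ultimately show "\<exists>N. \<forall>n\<ge>N. norm ((LINT x|lborel. \<bar>f (x - z n) - f x\<bar>) - 0) < e" 
    by (intro exI[of _ N]) auto
qed

text \<open>For an open set \<open>U\<close> the functions \<open>1\<^sub>U(x) 1\<^sub>U(x - z\<^sub>n)\<close> converge pointwise to \<open>1\<^sub>U(x)\<close>, and
\<open>|1\<^sub>U(x - z) - 1\<^sub>U(x)| = 1\<^sub>U(x - z) + 1\<^sub>U(x) - 2 1\<^sub>U(x) 1\<^sub>U(x - z)\<close>.\<close>

lemma translation_continuous_L1_open:
  fixes U :: "'a::euclidean_space set"
  assumes U: "open U" "emeasure lborel U < \<infinity>" and z: "z \<longlonglongrightarrow> 0"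
  shows "(\<lambda>n. LINT x|lborel. \<bar>indicator U (x - z n) - indicator U x\<bar> :: real) \<longlonglongrightarrow> 0"
proof -
  let ?I = "indicator U :: 'a \<Rightarrow> real"
  have m: "U \<in> sets borel" using U by simp
  have i: "integrable lborel ?I" using U m by simp
  have it: "integrable lborel (\<lambda>x. ?I (x - z n))" for n
    using integrable_lborel_translate[OF i, of "- z n"] by simp
  have ip: "integrable lborel (\<lambda>x. ?I x * ?I (x - z n))" for n
    by (rule Bochner_Integration.integrable_bound[OF i]) (use m in \<open>auto simp: indicator_def\<close>)
  have "(\<lambda>n. LINT x|lborel. ?I x * ?I (x - z n)) \<longlonglongrightarrow> (LINT x|lborel. ?I x)"
  proof (rule integral_dominated_convergence[where w = ?I])
    show "AE x in lborel. (\<lambda>n. ?I x * ?I (x - z n)) \<longlonglongrightarrow> ?I x"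
    proof (rule AE_I2)
      fix x
      show "(\<lambda>n. ?I x * ?I (x - z n)) \<longlonglongrightarrow> ?I x"
      proof (cases "x \<in> U")
        case True
        have "(\<lambda>n. x - z n) \<longlonglongrightarrow> x - 0" by (intro tendsto_intros z)
        then have "\<forall>\<^sub>F n in sequentially. x - z n \<in> U" using topological_tendstoD[of _ x _ U] U True by simp
        then show ?thesis
          by (intro tendsto_eventually) (use True in \<open>auto elim: eventually_mono\<close>)
      qed simp
    qed
    show "(\<lambda>x. ?I x * ?I (x - z n)) \<in> borel_measurable lborel" for n
      using borel_measurable_integrable[OF ip] .
  qed (use i m in \<open>auto simp: indicator_def\<close>)
  then have "(\<lambda>n. 2 * (LINT x|lborel. ?I x) - 2 * (LINT x|lborel. ?I x * ?I (x - z n)))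
      \<longlonglongrightarrow> 2 * (LINT x|lborel. ?I x) - 2 * (LINT x|lborel. ?I x)"
    by (intro tendsto_intros)
  moreover have "(LINT x|lborel. \<bar>?I (x - z n) - ?I x\<bar>) = 2 * (LINT x|lborel. ?I x) - 2 * (LINT x|lborel. ?I x * ?I (x - z n))" for n
  proof -
    have "(LINT x|lborel. \<bar>?I (x - z n) - ?I x\<bar>) = (LINT x|lborel. ?I (x - z n) + ?I x - 2 * (?I x * ?I (x - z n)))"
      by (rule Bochner_Integration.integral_cong) (auto simp: indicator_def)
    also have "\<dots> = (LINT x|lborel. ?I (x - z n)) + (LINT x|lborel. ?I x) - 2 * (LINT x|lborel. ?I x * ?I (x - z n))"
      using it i ip by (simp del: Bochner_Integration.integral_indicator)
    also have "(LINT x|lborel. ?I (x - z n)) = (LINT x|lborel. ?I x)"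
      using integral_lborel_translate[of ?I "- z n"] m by simp
    finally show ?thesis by simp
  qed
  ultimately show ?thesis by simp
qed

text \<open>Measurable sets of finite measure are approximated by open sets from outside, and integrable functions
by simple functions.\<close>

lemma translation_continuous_L1:
  fixes f :: "'a::euclidean_space \<Rightarrow> real"
  assumes "integrable lborel f" and z: "z \<longlonglongrightarrow> 0"
  shows "(\<lambda>n. LINT x|lborel. \<bar>f (x - z n) - f x\<bar>) \<longlonglongrightarrow> 0"
  using assms(1)
proof (induction f)
  case (base A c)
  let ?I = "indicator A :: 'a \<Rightarrow> real"
  have i: "integrable lborel ?I" using base by simp
  have "(\<lambda>n. LINT x|lborel. \<bar>?I (x - z n) - ?I x\<bar>) \<longlonglongrightarrow> 0"
  proof (rule translation_continuous_L1_closed[OF i])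
    fix e :: real assume e: "e > 0"
    obtain U where U: "open U" "A \<subseteq> U" "emeasure lborel (U - A) < e"
      using outer_regular_lborel[of A e] base e by auto
    have "emeasure lborel U \<le> emeasure lborel A + emeasure lborel (U - A)"
      using U base emeasure_subadditive[of A lborel "U - A"] by (simp add: Un_absorb1)
    also have "\<dots> < \<infinity>" using U(3) base ennreal_less_top[of e] by (auto intro: less_trans)
    finally have fin: "emeasure lborel U < \<infinity>" .
    have "(LINT x|lborel. \<bar>indicator U x - ?I x\<bar>) = (LINT x|lborel. indicator (U - A) x)"
      using U(2) by (intro Bochner_Integration.integral_cong) (auto simp: indicator_def)
    also have "\<dots> = measure lborel (U - A)" by simp
    also have "\<dots> \<le> e" using U(3) e by (simp add: measure_def enn2real_leI)
    finally show "\<exists>g. integrable lborel g \<and> (LINT x|lborel. \<bar>g x - ?I x\<bar>) \<le> e \<and>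
      (\<lambda>n. LINT x|lborel. \<bar>g (x - z n) - g x\<bar>) \<longlonglongrightarrow> 0"
      using translation_continuous_L1_open[OF U(1) fin z] U(1) fin by (intro exI[of _ "indicator U"]) auto
  qed
  then have "(\<lambda>n. (LINT x|lborel. \<bar>?I (x - z n) - ?I x\<bar>) * \<bar>c\<bar>) \<longlonglongrightarrow> 0" by (rule tendsto_mult_left_zero)
  then show ?case by (simp add: left_diff_distrib[symmetric] abs_mult)
next
  case (add f g)
  have tr: "integrable lborel (\<lambda>x. h (x - z n))" if "integrable lborel h" for h :: "'a \<Rightarrow> real" and n
    using integrable_lborel_translate[OF that, of "- z n"] by simp
  show ?case
  proof (rule tendsto_sandwich[OF _ _ tendsto_const tendsto_add_zero[OF add.IH(1,2)]])
    show "\<forall>\<^sub>F n in sequentially. (LINT x|lborel. \<bar>f (x - z n) + g (x - z n) - (f x + g x)\<bar>)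
       \<le> (LINT x|lborel. \<bar>f (x - z n) - f x\<bar>) + (LINT x|lborel. \<bar>g (x - z n) - g x\<bar>)"
    proof (intro always_eventually allI)
      fix n
      have "(LINT x|lborel. \<bar>f (x - z n) + g (x - z n) - (f x + g x)\<bar>)
         \<le> (LINT x|lborel. \<bar>f (x - z n) - f x\<bar> + \<bar>g (x - z n) - g x\<bar>)"
        by (rule integral_mono) (use add.hyps tr in auto)
      then show "(LINT x|lborel. \<bar>f (x - z n) + g (x - z n) - (f x + g x)\<bar>)
       \<le> (LINT x|lborel. \<bar>f (x - z n) - f x\<bar>) + (LINT x|lborel. \<bar>g (x - z n) - g x\<bar>)"
        using add.hyps tr by simp
    qed
  qed auto
next
  case (lim f s)
  show ?case
  proof (rule translation_continuous_L1_closed[OF lim.hyps(4)])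
    fix e :: real assume e: "e > 0"
    have "(\<lambda>i. LINT x|lborel. \<bar>s i x - f x\<bar>) \<longlonglongrightarrow> (LINT x|(lborel :: 'a measure). 0 :: real)"
    proof (rule integral_dominated_convergence[where w = "\<lambda>x. 3 * \<bar>f x\<bar>"])
      have "norm \<bar>s i x - f x\<bar> \<le> 3 * \<bar>f x\<bar>" for i x using lim.hyps(3)[of x i] by auto
      then show "AE x in lborel. norm \<bar>s i x - f x\<bar> \<le> 3 * \<bar>f x\<bar>" for i by simp
      have "(\<lambda>i. \<bar>s i x - f x\<bar>) \<longlonglongrightarrow> \<bar>f x - f x\<bar>" for x
        by (intro tendsto_intros lim.hyps(2)) simp
      then show "AE x in lborel. (\<lambda>i. \<bar>s i x - f x\<bar>) \<longlonglongrightarrow> 0" by simp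
    qed (use lim.hyps in auto)
    then obtain i where "\<bar>LINT x|lborel. \<bar>s i x - f x\<bar>\<bar> < e"
      using LIMSEQ_D[of "\<lambda>i. LINT x|lborel. \<bar>s i x - f x\<bar>" 0 e] e by auto
    then show "\<exists>g. integrable lborel g \<and> (LINT x|lborel. \<bar>g x - f x\<bar>) \<le> e \<and>
      (\<lambda>n. LINT x|lborel. \<bar>g (x - z n) - g x\<bar>) \<longlonglongrightarrow> 0"
      using lim.hyps(1) lim.IH by (intro exI[of _ "s i"]) auto
  qed
qed

section \<open>Mollification\<close>

lemma flat_fun_1_pos_iff: "flat_fun 1 t > 0 \<longleftrightarrow> t > 0"
  by (simp add: flat_fun_def)

lemma flat_fun_1_nonneg: "flat_fun 1 t \<ge> 0"
  by (simp add: flat_fun_def)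

text \<open>A smooth function that is positive exactly on the open ball of radius \<open>1 / (n + 1)\<close>.\<close>

definition bump :: "nat \<Rightarrow> real^'n::finite \<Rightarrow> real" where
  "bump n x = flat_fun 1 ((inverse (real (Suc n)))\<^sup>2 - x \<bullet> x)"

definition mollifier :: "nat \<Rightarrow> real^'n::finite \<Rightarrow> real" where
  "mollifier n x = bump n x * inverse (LINT y|lebesgue. bump n (y :: real^'n))"

lemma test_function_bump: "test_function (cball 0 (inverse (real (Suc n)))) (bump n)"
proof -
  have "bump n x = 0" if "x \<notin> cball 0 (inverse (real (Suc n)))" for x :: "real^'a"
  proof -
    have "(inverse (real (Suc n)))\<^sup>2 \<le> (norm x)\<^sup>2" using that by (intro power_mono) auto
    then show ?thesis by (simp add: bump_def flat_fun_def power2_norm_eq_inner)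
  qed
  moreover have "smooth (bump n :: real^'a \<Rightarrow> real)"
    using smooth_flat_fun[of 1 "(inverse (real (Suc n)))\<^sup>2"] by (simp add: bump_def[abs_def])
  ultimately show ?thesis unfolding test_function_def
    by (intro conjI exI[of _ "cball 0 (inverse (real (Suc n)))"]) auto
qed

lemma bump_nonneg: "bump n x \<ge> 0"
  by (simp add: bump_def flat_fun_1_nonneg)

text \<open>A nonempty open set is not a null set.\<close>

lemma AE_lebesgue_open_ex:
  assumes "AE x in lebesgue. P x" "open U" "U \<noteq> {}"
  shows "\<exists>x::'a::euclidean_space\<in>U. P x"
proof (rule ccontr)
  assume "\<not> ?thesis"
  moreover obtain N where "{x \<in> space lebesgue. \<not> P x} \<subseteq> N" "N \<in> null_sets lebesgue"
    using assms(1) by (auto simp: eventually_ae_filter)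
  ultimately have "U \<subseteq> N" by auto
  then have "negligible U" using \<open>N \<in> null_sets lebesgue\<close> negligible_iff_null_sets negligible_subset by blast
  then show False using open_not_negligible assms by blast
qed

lemma integral_bump_pos: "(LINT x|lebesgue. bump n (x :: real^'n::finite)) > 0"
proof -
  have i: "integrable lebesgue (bump n :: real^'n \<Rightarrow> real)" by (rule integrable_test_function[OF test_function_bump])
  have "(LINT x|lebesgue. bump n (x :: real^'n)) \<noteq> 0"
  proof
    assume "(LINT x|lebesgue. bump n (x :: real^'n)) = 0"
    then have "AE x in lebesgue. bump n (x :: real^'n) = 0"
      using integral_nonneg_eq_0_iff_AE[OF i] bump_nonneg by auto
    from AE_lebesgue_open_ex[OF this, of "ball 0 (inverse (real (Suc n)))"]
    obtain x :: "real^'n" where x: "norm x < inverse (real (Suc n))" "bump n x = 0" by auto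
    have "(norm x)\<^sup>2 < (inverse (real (Suc n)))\<^sup>2" using x by (intro power_strict_mono) auto
    then have "bump n x > 0" by (simp add: bump_def flat_fun_1_pos_iff power2_norm_eq_inner)
    then show False using x by simp
  qed
  moreover have "(LINT x|lebesgue. bump n (x :: real^'n)) \<ge> 0" by (rule integral_nonneg_AE) (simp add: bump_nonneg)
  ultimately show ?thesis by simp
qed

lemma test_function_mollifier: "test_function (cball 0 (inverse (real (Suc n)))) (mollifier n)"
  unfolding mollifier_def[abs_def] by (rule test_function_smooth_mult[OF test_function_bump smooth_const])

lemma mollifier_nonneg: "mollifier n x \<ge> 0"
  unfolding mollifier_def using bump_nonneg[of n x] integral_bump_pos[of n, where 'n = 'a] by simp

lemma mollifier_eq_0: "norm x > inverse (real (Suc n)) \<Longrightarrow> mollifier n x = 0"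
  by (rule test_function_outside[OF test_function_mollifier]) auto

lemma integral_mollifier: "(LINT x|lebesgue. mollifier n (x :: real^'n::finite)) = 1"
  unfolding mollifier_def using integral_bump_pos[of n, where 'n = 'n] by simp

lemma mollifier_measurable [measurable]: "mollifier n \<in> borel_measurable borel"
  by (rule test_function_measurable[OF test_function_mollifier])

lemma integrable_lborel_mollifier: "integrable lborel (mollifier n)"
  by (rule integrable_lborel_test_function[OF test_function_mollifier])

lemma integral_lborel_mollifier: "(LINT x|lborel. mollifier n (x :: real^'n::finite)) = 1"
  using integral_mollifier[of n] by (simp add: integral_completion)

lemma nn_integral_mollifier: "(\<integral>\<^sup>+x. ennreal (mollifier n (x :: real^'n::finite)) \<partial>lborel) = 1"
  by (subst nn_integral_eq_integral)
     (auto simp: integrable_lborel_mollifier integral_lborel_mollifier mollifier_nonneg)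

definition mollify :: "nat \<Rightarrow> (real^'n::finite \<Rightarrow> real) \<Rightarrow> real^'n \<Rightarrow> real" where
  "mollify n f = convolution (mollifier n) f"

lemma mollify_cong_AE:
  assumes "integrable lebesgue f" "integrable lebesgue g" "AE x in lebesgue. f x = g x"
  shows "mollify n f = mollify n g"
  unfolding mollify_def convolution_def
  using integrable_convolution[OF test_function_mollifier assms(1)] integrable_convolution[OF test_function_mollifier assms(2)] assms(3)
  by (intro ext integral_cong_AE) (auto elim!: eventually_mono)

lemma mollify_average:
  assumes "integrable lborel f"
  shows "integrable lborel (\<lambda>z. mollifier n z * f (x - z))"
    and "mollify n f x = (LINT z|lborel. mollifier n z * f (x - z))"
proof -
  have f: "integrable lebesgue f" "f \<in> borel_measurable borel"
    using assms borel_measurable_integrable[OF assms] by (auto simp: integrable_completion)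
  have m: "(\<lambda>y. mollifier n (x - y) * f y) \<in> borel_measurable borel" using f(2) by simp
  have "integrable lborel (\<lambda>y. mollifier n (x - y) * f y)"
    using integrable_convolution[OF test_function_mollifier[of n] f(1), of x] m by (simp add: integrable_completion)
  from integrable_lborel_reflect[OF this, of x]
  show "integrable lborel (\<lambda>z. mollifier n z * f (x - z))" by simp
  show "mollify n f x = (LINT z|lborel. mollifier n z * f (x - z))"
    using integral_lborel_reflect[OF m, of x] m
    by (simp add: mollify_def convolution_def integral_completion)
qed

text \<open>\<open>mollify n f x - f x\<close> is the average of \<open>f (x - z) - f x\<close> with respect to the mollifier.\<close>

lemma mollify_diff_le:
  assumes "integrable lborel f"
  shows "ennreal \<bar>mollify n f x - f x\<bar> \<le> (\<integral>\<^sup>+z. ennreal (mollifier n z) * ennreal \<bar>f (x - z) - f x\<bar> \<partial>lborel)"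
proof -
  have i: "integrable lborel (\<lambda>z. mollifier n z * f (x - z))" "integrable lborel (\<lambda>z. mollifier n z * f x)"
    using mollify_average(1)[OF assms] integrable_lborel_mollifier by auto
  have "mollify n f x - f x = (LINT z|lborel. mollifier n z * f (x - z) - mollifier n z * f x)"
    unfolding Bochner_Integration.integral_diff[OF i]
    by (simp add: mollify_average(2)[OF assms] integral_lborel_mollifier)
  then have "ennreal \<bar>mollify n f x - f x\<bar> \<le> (\<integral>\<^sup>+z. norm (mollifier n z * f (x - z) - mollifier n z * f x) \<partial>lborel)"
    using integral_norm_bound_ennreal[OF Bochner_Integration.integrable_diff[OF i]] by simp
  also have "\<dots> = (\<integral>\<^sup>+z. ennreal (mollifier n z) * ennreal \<bar>f (x - z) - f x\<bar> \<partial>lborel)"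
    by (intro nn_integral_cong)
       (simp add: right_diff_distrib[symmetric] abs_mult mollifier_nonneg ennreal_mult)
  finally show ?thesis .
qed

text \<open>This reduces the modulus of continuity of \<open>f\<close> under translations in \<open>L\<^sup>2\<close> to that of the integrable
function \<open>f |f|\<close> in \<open>L\<^sup>1\<close>.\<close>

lemma square_diff_le: "(a - b)\<^sup>2 \<le> 2 * \<bar>a * \<bar>a\<bar> - b * \<bar>b\<bar>\<bar>" for a b :: real
proof -
  have 1: "(a - b)\<^sup>2 \<le> 2 * \<bar>a * \<bar>a\<bar> - b * \<bar>b\<bar>\<bar>" if "\<bar>b\<bar> \<le> a" for a b :: real
  proof (cases "b \<ge> 0")
    case True
    have 1: "a * a - b * b - (a - b)\<^sup>2 = 2 * b * (a - b)" by (simp add: power2_eq_square algebra_simps)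
    have 2: "2 * b * (a - b) \<ge> 0" "a * a - b * b \<ge> 0" using True that by (auto intro!: mult_nonneg_nonneg mult_mono)
    have 3: "\<bar>a * \<bar>a\<bar> - b * \<bar>b\<bar>\<bar> = a * a - b * b" using True that 2(2) by simp
    have "(a - b)\<^sup>2 \<le> a * a - b * b" by (metis 1 2(1) diff_ge_0_iff_ge)
    also have "\<dots> \<le> 2 * (a * a - b * b)" using 2(2) by simp
    finally show ?thesis unfolding 3 .
  next
    case False
    have "2 * (a * a + b * b) - (a - b)\<^sup>2 = (a + b)\<^sup>2" by (simp add: power2_eq_square algebra_simps)
    then have "(a - b)\<^sup>2 \<le> 2 * (a * a + b * b)" by (metis diff_ge_0_iff_ge zero_le_power2)
    moreover have "a * \<bar>a\<bar> - b * \<bar>b\<bar> = a * a + b * b" using False that by simp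
    ultimately show ?thesis by (simp add: abs_of_nonneg)
  qed
  consider "\<bar>b\<bar> \<le> a" | "\<bar>a\<bar> \<le> b" | "\<bar>- b\<bar> \<le> - a" | "\<bar>- a\<bar> \<le> - b" by linarith
  then show ?thesis
  proof cases
    case 1 then show ?thesis by (rule \<open>\<And>b a. \<bar>b\<bar> \<le> a \<Longrightarrow> _\<close>)
  next
    case 2
    from \<open>\<And>b a. \<bar>b\<bar> \<le> a \<Longrightarrow> _\<close>[OF this] show ?thesis by (simp add: power2_commute abs_minus_commute)
  next
    case 3
    from \<open>\<And>b a. \<bar>b\<bar> \<le> a \<Longrightarrow> _\<close>[OF this] show ?thesis by (simp add: power2_commute abs_minus_commute)
  next
    case 4
    from \<open>\<And>b a. \<bar>b\<bar> \<le> a \<Longrightarrow> _\<close>[OF this] show ?thesis by (simp add: power2_commute abs_minus_commute)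
  qed
qed

text \<open>Cauchy-Schwarz with respect to the probability density given by the mollifier, followed by
\<open>square_diff_le\<close>.\<close>

lemma mollify_diff_square_le:
  assumes "integrable lborel f"
  shows "ennreal ((mollify n f x - f x)\<^sup>2)
    \<le> 2 * (\<integral>\<^sup>+z. ennreal (mollifier n z) * ennreal \<bar>f (x - z) * \<bar>f (x - z)\<bar> - f x * \<bar>f x\<bar>\<bar> \<partial>lborel)"
proof -
  have [measurable]: "f \<in> borel_measurable borel" using borel_measurable_integrable[OF assms] by simp
  let ?k = "mollifier n" and ?d = "\<lambda>z. \<bar>f (x - z) - f x\<bar>"
  have "ennreal ((mollify n f x - f x)\<^sup>2) = (ennreal \<bar>mollify n f x - f x\<bar>)\<^sup>2" by (simp add: ennreal_power)
  also have "\<dots> \<le> (\<integral>\<^sup>+z. ennreal (?k z) * ennreal (?d z) \<partial>lborel)\<^sup>2"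
    by (rule power_mono[OF mollify_diff_le[OF assms]]) simp
  also have "(\<integral>\<^sup>+z. ennreal (?k z) * ennreal (?d z) \<partial>lborel)
      = (\<integral>\<^sup>+z. ennreal (sqrt (?k z)) * ennreal (sqrt (?k z) * ?d z) \<partial>lborel)"
    by (intro nn_integral_cong) (simp add: ennreal_mult[symmetric] mult.assoc[symmetric] mollifier_nonneg)
  also have "\<dots>\<^sup>2 \<le> (\<integral>\<^sup>+z. (ennreal (sqrt (?k z)))\<^sup>2 \<partial>(lborel :: (real^'a) measure)) * (\<integral>\<^sup>+z. (ennreal (sqrt (?k z) * ?d z))\<^sup>2 \<partial>lborel)"
    by (rule Cauchy_Schwarz_nn_integral) auto
  also have "(\<integral>\<^sup>+z. (ennreal (sqrt (?k z)))\<^sup>2 \<partial>(lborel :: (real^'a) measure)) = (1 :: ennreal)"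
    by (simp add: ennreal_power mollifier_nonneg nn_integral_mollifier)
  also have "1 * (\<integral>\<^sup>+z. (ennreal (sqrt (?k z) * ?d z))\<^sup>2 \<partial>lborel)
      \<le> (\<integral>\<^sup>+z. 2 * (ennreal (?k z) * ennreal \<bar>f (x - z) * \<bar>f (x - z)\<bar> - f x * \<bar>f x\<bar>\<bar>) \<partial>lborel)"
    unfolding mult_1
  proof (rule nn_integral_mono)
    fix z
    have "(ennreal (sqrt (?k z) * ?d z))\<^sup>2 = ennreal (?k z * (f (x - z) - f x)\<^sup>2)"
      by (simp add: ennreal_power power_mult_distrib mollifier_nonneg)
    also have "\<dots> \<le> ennreal (?k z * (2 * \<bar>f (x - z) * \<bar>f (x - z)\<bar> - f x * \<bar>f x\<bar>\<bar>))"
      by (intro ennreal_leI mult_left_mono square_diff_le mollifier_nonneg)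
    also have "\<dots> = 2 * (ennreal (?k z) * ennreal \<bar>f (x - z) * \<bar>f (x - z)\<bar> - f x * \<bar>f x\<bar>\<bar>)"
      by (simp add: ennreal_mult mollifier_nonneg mult.left_commute)
    finally show "(ennreal (sqrt (?k z) * ?d z))\<^sup>2 \<le> 2 * (ennreal (?k z) * ennreal \<bar>f (x - z) * \<bar>f (x - z)\<bar> - f x * \<bar>f x\<bar>\<bar>)" .
  qed
  also have "\<dots> = 2 * (\<integral>\<^sup>+z. ennreal (?k z) * ennreal \<bar>f (x - z) * \<bar>f (x - z)\<bar> - f x * \<bar>f x\<bar>\<bar> \<partial>lborel)"
    by (rule nn_integral_cmult) simp
  finally show ?thesis .
qed

lemma translation_modulus_L1:
  fixes f :: "'a::euclidean_space \<Rightarrow> real"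
  assumes f: "integrable lborel f" and "e > 0"
  obtains d where "d > 0" "\<And>z. norm z < d \<Longrightarrow> (\<integral>\<^sup>+x. ennreal \<bar>f (x - z) - f x\<bar> \<partial>lborel) \<le> ennreal e"
proof -
  have "((\<lambda>z. LINT x|lborel. \<bar>f (x - z) - f x\<bar>) \<longlongrightarrow> 0) (at 0)"
    unfolding tendsto_at_iff_sequentially by (auto simp: o_def intro!: translation_continuous_L1[OF f])
  then have "\<forall>\<^sub>F z in at 0. (LINT x|lborel. \<bar>f (x - z) - f x\<bar>) < e"
    using assms(2) by (rule order_tendstoD)
  then obtain d where d: "d > 0" "\<And>z. z \<noteq> 0 \<Longrightarrow> norm z < d \<Longrightarrow> (LINT x|lborel. \<bar>f (x - z) - f x\<bar>) < e"
    by (auto simp: eventually_at dist_norm)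
  have "(\<integral>\<^sup>+x. ennreal \<bar>f (x - z) - f x\<bar> \<partial>lborel) \<le> ennreal e" if "norm z < d" for z
  proof -
    have "integrable lborel (\<lambda>x. f (x - z))" using integrable_lborel_translate[OF f, of "- z"] by simp
    then have "(\<integral>\<^sup>+x. ennreal \<bar>f (x - z) - f x\<bar> \<partial>lborel) = ennreal (LINT x|lborel. \<bar>f (x - z) - f x\<bar>)"
      using f by (intro nn_integral_eq_integral) auto
    also have "\<dots> \<le> ennreal e"
      by (cases "z = 0") (use d(2)[of z] that assms(2) in \<open>auto intro!: ennreal_leI\<close>)
    finally show ?thesis .
  qed
  with d that show thesis by blast
qed

text \<open>After exchanging the integrals, the inner one is the \<open>L\<^sup>1\<close> distance of \<open>G\<close> to a translate by at most
the radius of the mollifier.\<close>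

lemma mollifier_modulus_tendsto_0:
  fixes G :: "real^'n::finite \<Rightarrow> real"
  assumes G: "integrable lborel G"
  shows "(\<lambda>n. \<integral>\<^sup>+x. \<integral>\<^sup>+z. ennreal (mollifier n z) * ennreal \<bar>G (x - z) - G x\<bar> \<partial>lborel \<partial>lborel) \<longlonglongrightarrow> 0"
proof (rule order_tendstoI)
  have [measurable]: "G \<in> borel_measurable borel" using borel_measurable_integrable[OF G] by simp
  fix a :: ennreal assume "0 < a"
  then obtain b where b: "0 < b" "b < a" using dense by blast
  \<comment> \<open>the bound \<open>b\<close> is finite because it lies strictly below \<open>a\<close>\<close>
  then obtain e where e: "b = ennreal e" "e > 0" by (cases b) (auto simp: top_unique)
  obtain d where d: "d > 0" "\<And>z. norm z < d \<Longrightarrow> (\<integral>\<^sup>+x. ennreal \<bar>G (x - z) - G x\<bar> \<partial>lborel) \<le> ennreal e"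
    by (rule translation_modulus_L1[OF G e(2)]) (rule that)
  have "\<forall>\<^sub>F n in sequentially. inverse (real (Suc n)) < d"
    using order_tendstoD(2)[OF LIMSEQ_inverse_real_of_nat d(1)] .
  then show "\<forall>\<^sub>F n in sequentially. (\<integral>\<^sup>+x. \<integral>\<^sup>+z. ennreal (mollifier n z) * ennreal \<bar>G (x - z) - G x\<bar> \<partial>lborel \<partial>lborel) < a"
  proof (rule eventually_mono)
    fix n assume n: "inverse (real (Suc n)) < d"
    have "(\<integral>\<^sup>+x. \<integral>\<^sup>+z. ennreal (mollifier n z) * ennreal \<bar>G (x - z) - G x\<bar> \<partial>lborel \<partial>lborel)
        = (\<integral>\<^sup>+z. \<integral>\<^sup>+x. ennreal (mollifier n z) * ennreal \<bar>G (x - z) - G x\<bar> \<partial>lborel \<partial>lborel)"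
      by (rule lborel_pair.Fubini') simp
    also have "\<dots> = (\<integral>\<^sup>+z. ennreal (mollifier n z) * (\<integral>\<^sup>+x. ennreal \<bar>G (x - z) - G x\<bar> \<partial>lborel) \<partial>lborel)"
      by (intro nn_integral_cong nn_integral_cmult) simp
    also have "\<dots> \<le> (\<integral>\<^sup>+z. ennreal (mollifier n z) * ennreal e \<partial>(lborel :: (real^'n) measure))"
    proof (rule nn_integral_mono)
      fix z :: "real^'n"
      show "ennreal (mollifier n z) * (\<integral>\<^sup>+x. ennreal \<bar>G (x - z) - G x\<bar> \<partial>lborel) \<le> ennreal (mollifier n z) * ennreal e"
        using d(2)[of z] n mollifier_eq_0[of n z] by (cases "norm z < d") (auto intro!: mult_left_mono)
    qed
    also have "\<dots> = (\<integral>\<^sup>+z. ennreal (mollifier n z) \<partial>(lborel :: (real^'n) measure)) * ennreal e"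
      by (rule nn_integral_multc) simp
    also have "\<dots> = b" by (simp add: nn_integral_mollifier e)
    finally show "(\<integral>\<^sup>+x. \<integral>\<^sup>+z. ennreal (mollifier n z) * ennreal \<bar>G (x - z) - G x\<bar> \<partial>lborel \<partial>lborel) < a"
      using b by simp
  qed
qed simp

text \<open>Fubini's theorem and translations are applied to Borel functions; mollification does not see the
difference.\<close>

lemma integrable_lebesgue_borel_version:
  fixes f :: "real^'n::finite \<Rightarrow> real"
  assumes "integrable lebesgue f"
  obtains g where "integrable lborel g" "integrable lebesgue g" "AE x in lebesgue. f x = g x"
proof -
  obtain g where g: "g \<in> borel_measurable lborel" "AE x in lborel. f x = g x"
    using completion_ex_borel_measurable_real[OF borel_measurable_integrable[OF assms]] by blast
  have ae: "AE x in lebesgue. f x = g x" using g(2) by (simp add: AE_completion)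
  have m: "g \<in> borel_measurable lebesgue" using g(1) by (simp add: measurable_completion)
  have "integrable lebesgue g"
    by (rule integrable_cong_AE_imp[OF assms m ae])
  moreover from this have "integrable lborel g" using g(1) by (simp add: integrable_completion)
  ultimately show thesis using ae that by blast
qed

lemma mollify_measurable:
  "integrable lebesgue f \<Longrightarrow> mollify n f \<in> borel_measurable lebesgue"
  unfolding mollify_def
  by (intro measurable_completion)
     (simp add: borel_measurable_continuous_onI smooth_continuous_on smooth_convolution[OF test_function_mollifier])

lemma mollify_L1:
  assumes f: "integrable lebesgue f"
  shows "(\<lambda>n. LINT x|lebesgue. \<bar>mollify n f x - f x\<bar>) \<longlonglongrightarrow> 0"
proof -
  obtain g where g: "integrable lborel g" "integrable lebesgue g" "AE x in lebesgue. f x = g x"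
    by (rule integrable_lebesgue_borel_version[OF f]) (rule that)
  have m: "mollify n f \<in> borel_measurable lebesgue" "f \<in> borel_measurable lebesgue" "g \<in> borel_measurable lebesgue" for n
    using mollify_measurable[OF f] f g by auto
  have "(\<lambda>n. \<integral>\<^sup>+x. ennreal \<bar>mollify n g x - g x\<bar> \<partial>lborel) \<longlonglongrightarrow> 0"
    by (rule tendsto_sandwich[OF _ _ tendsto_const mollifier_modulus_tendsto_0[OF g(1)]])
       (auto intro!: always_eventually nn_integral_mono mollify_diff_le[OF g(1)])
  then have "(\<lambda>n. enn2real (\<integral>\<^sup>+x. ennreal \<bar>mollify n g x - g x\<bar> \<partial>lborel)) \<longlonglongrightarrow> enn2real 0"
    by (intro tendsto_enn2real) auto
  moreover have "(LINT x|lebesgue. \<bar>mollify n f x - f x\<bar>) = enn2real (\<integral>\<^sup>+x. ennreal \<bar>mollify n g x - g x\<bar> \<partial>lborel)" for n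
  proof -
    have "(LINT x|lebesgue. \<bar>mollify n f x - f x\<bar>) = enn2real (\<integral>\<^sup>+x. ennreal \<bar>mollify n f x - f x\<bar> \<partial>lebesgue)"
      using m by (intro integral_eq_nn_integral) auto
    also have "(\<integral>\<^sup>+x. ennreal \<bar>mollify n f x - f x\<bar> \<partial>lebesgue) = (\<integral>\<^sup>+x. ennreal \<bar>mollify n g x - g x\<bar> \<partial>lebesgue)"
      unfolding mollify_cong_AE[OF f g(2,3)]
      by (rule nn_integral_cong_AE) (use g(3) in \<open>auto elim!: eventually_mono\<close>)
    finally show ?thesis by (simp add: nn_integral_completion)
  qed
  ultimately show ?thesis by simp
qed

lemma mollify_L2:
  assumes f: "integrable lebesgue f" and f2: "integrable lebesgue (\<lambda>x. (f x)\<^sup>2)"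
  shows "(\<lambda>n. LINT x|lebesgue. (mollify n f x - f x)\<^sup>2) \<longlonglongrightarrow> 0"
proof -
  obtain g where g: "integrable lborel g" "integrable lebesgue g" "AE x in lebesgue. f x = g x"
    by (rule integrable_lebesgue_borel_version[OF f]) (rule that)
  have m: "mollify n f \<in> borel_measurable lebesgue" "f \<in> borel_measurable lebesgue" "g \<in> borel_measurable lebesgue" for n
    using mollify_measurable[OF f] f g by auto
  have mg: "g \<in> borel_measurable borel" using borel_measurable_integrable[OF g(1)] by simp
  have "integrable lebesgue (\<lambda>x. (g x)\<^sup>2)"
    by (rule integrable_cong_AE_imp[OF f2]) (use g(3) m in \<open>auto elim!: eventually_mono\<close>)
  then have "integrable lborel (\<lambda>x. (g x)\<^sup>2)" using mg by (simp add: integrable_completion)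
  then have G: "integrable lborel (\<lambda>x. g x * \<bar>g x\<bar>)"
    by (rule Bochner_Integration.integrable_bound) (use mg in \<open>auto simp: abs_mult power2_eq_square\<close>)
  have "(\<lambda>n. \<integral>\<^sup>+x. ennreal ((mollify n g x - g x)\<^sup>2) \<partial>lborel) \<longlonglongrightarrow> 0"
  proof (rule tendsto_sandwich[OF _ _ tendsto_const])
    let ?M = "\<lambda>n. \<integral>\<^sup>+x. \<integral>\<^sup>+z. ennreal (mollifier n z) * ennreal \<bar>g (x - z) * \<bar>g (x - z)\<bar> - g x * \<bar>g x\<bar>\<bar> \<partial>lborel \<partial>lborel"
    have "(\<lambda>n. 2 * ?M n) \<longlonglongrightarrow> 2 * 0"
      by (rule ennreal_tendsto_cmult[OF _ mollifier_modulus_tendsto_0[OF G]]) simp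
    then show "(\<lambda>n. 2 * ?M n) \<longlonglongrightarrow> 0" by simp
    show "\<forall>\<^sub>F n in sequentially. (\<integral>\<^sup>+x. ennreal ((mollify n g x - g x)\<^sup>2) \<partial>lborel) \<le> 2 * ?M n"
    proof (intro always_eventually allI)
      fix n
      have "(\<integral>\<^sup>+x. ennreal ((mollify n g x - g x)\<^sup>2) \<partial>lborel)
         \<le> (\<integral>\<^sup>+x. 2 * \<integral>\<^sup>+z. ennreal (mollifier n z) * ennreal \<bar>g (x - z) * \<bar>g (x - z)\<bar> - g x * \<bar>g x\<bar>\<bar> \<partial>lborel \<partial>lborel)"
        by (intro nn_integral_mono mollify_diff_square_le[OF g(1)])
      also have "\<dots> = 2 * ?M n"
        by (rule nn_integral_cmult) (use mg in measurable)
      finally show "(\<integral>\<^sup>+x. ennreal ((mollify n g x - g x)\<^sup>2) \<partial>lborel) \<le> 2 * ?M n" .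
    qed
  qed auto
  then have "(\<lambda>n. enn2real (\<integral>\<^sup>+x. ennreal ((mollify n g x - g x)\<^sup>2) \<partial>lborel)) \<longlonglongrightarrow> enn2real 0"
    by (intro tendsto_enn2real) auto
  moreover have "(LINT x|lebesgue. (mollify n f x - f x)\<^sup>2) = enn2real (\<integral>\<^sup>+x. ennreal ((mollify n g x - g x)\<^sup>2) \<partial>lborel)" for n
  proof -
    have "(LINT x|lebesgue. (mollify n f x - f x)\<^sup>2) = enn2real (\<integral>\<^sup>+x. ennreal ((mollify n f x - f x)\<^sup>2) \<partial>lebesgue)"
      using m by (intro integral_eq_nn_integral) auto
    also have "(\<integral>\<^sup>+x. ennreal ((mollify n f x - f x)\<^sup>2) \<partial>lebesgue) = (\<integral>\<^sup>+x. ennreal ((mollify n g x - g x)\<^sup>2) \<partial>lebesgue)"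
      unfolding mollify_cong_AE[OF f g(2,3)]
      by (rule nn_integral_cong_AE) (use g(3) in \<open>auto elim!: eventually_mono\<close>)
    finally show ?thesis by (simp add: nn_integral_completion)
  qed
  ultimately show ?thesis by simp
qed

section \<open>Locally integrable functions and weak partial derivatives\<close>

lemma AE_lebesgue_on_iff:
  "S \<in> sets lebesgue \<Longrightarrow> (AE x in lebesgue_on S. P x) \<longleftrightarrow> (AE x in lebesgue. x \<in> S \<longrightarrow> P x)"
  by (rule AE_restrict_space_iff) simp

lemma open_sets_lebesgue: "open S \<Longrightarrow> S \<in> sets lebesgue" by simp

lemma AE_lebesgue_on_subset:
  assumes "AE x in lebesgue_on S. P x" "T \<subseteq> S" "S \<in> sets lebesgue" "T \<in> sets lebesgue"
  shows "AE x in lebesgue_on T. P x"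
  using assms(1) by (auto simp: AE_lebesgue_on_iff assms(3,4) elim!: eventually_mono dest: subsetD[OF assms(2)])

lemma integrable_lebesgue_on_iff:
  fixes f :: "'a::euclidean_space \<Rightarrow> 'b::euclidean_space"
  shows "S \<in> sets lebesgue \<Longrightarrow> integrable (lebesgue_on S) f \<longleftrightarrow> f absolutely_integrable_on S"
  by (simp add: integrable_restrict_space set_integrable_def)

lemma integrable_lebesgue_on_cong_AE:
  fixes f :: "'a::euclidean_space \<Rightarrow> 'b::euclidean_space"
  assumes "integrable (lebesgue_on S) f" "AE x in lebesgue_on S. f x = g x" "S \<in> sets lebesgue"
  shows "integrable (lebesgue_on S) g"
proof -
  have "AE x in lebesgue. x \<in> S \<longrightarrow> f x = g x" using assms(2,3) by (simp add: AE_lebesgue_on_iff)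
  then obtain N where N: "{x \<in> space lebesgue. \<not> (x \<in> S \<longrightarrow> f x = g x)} \<subseteq> N" "N \<in> null_sets lebesgue"
    by (auto simp only: eventually_ae_filter)
  have "g absolutely_integrable_on S"
    by (rule absolutely_integrable_spike[where f = f and S = N])
       (use assms(1,3) N negligible_iff_null_sets in \<open>auto simp: integrable_lebesgue_on_iff\<close>)
  then show ?thesis using assms(3) by (simp add: integrable_lebesgue_on_iff)
qed

lemma locally_integrable_cong_AE:
  fixes f :: "real^'n::finite \<Rightarrow> 'b::euclidean_space"
  assumes "locally_integrable \<Omega> f" "AE x in lebesgue_on \<Omega>. f x = g x" "open \<Omega>"
  shows "locally_integrable \<Omega> g"
  unfolding locally_integrable_def
proof (intro allI impI)
  fix K assume K: "compact K \<and> K \<subseteq> \<Omega>"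
  show "integrable (lebesgue_on K) g"
    by (rule integrable_lebesgue_on_cong_AE[of K f])
       (use assms K AE_lebesgue_on_subset[OF assms(2)] in \<open>auto simp: locally_integrable_def compact_sets_lebesgue\<close>)
qed

lemma locally_integrable_subset: "locally_integrable \<Omega> f \<Longrightarrow> \<Omega>' \<subseteq> \<Omega> \<Longrightarrow> locally_integrable \<Omega>' f"
  unfolding locally_integrable_def by blast

lemma locally_integrable_integrable:
  fixes f :: "real^'n::finite \<Rightarrow> 'b::euclidean_space"
  assumes "integrable lebesgue f"
  shows "locally_integrable \<Omega> f"
  unfolding locally_integrable_def
  using integrable_mult_indicator[OF _ assms]
  by (auto simp: integrable_restrict_space compact_sets_lebesgue)

lemma locally_integrable_if_integrable_on:
  fixes f :: "real^'n::finite \<Rightarrow> 'b::euclidean_space"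
  assumes "integrable (lebesgue_on \<Omega>) f" "open \<Omega>"
  shows "locally_integrable \<Omega> f"
proof -
  have "integrable lebesgue (\<lambda>x. indicator \<Omega> x *\<^sub>R f x)"
    using assms integrable_restrict_space[of \<Omega> lebesgue f] by simp
  then have "locally_integrable \<Omega> (\<lambda>x. indicator \<Omega> x *\<^sub>R f x)" by (rule locally_integrable_integrable)
  then show ?thesis
    by (rule locally_integrable_cong_AE) (use assms(2) in \<open>auto simp: AE_lebesgue_on_iff\<close>)
qed

lemma locally_integrable_add:
  fixes f :: "real^'n::finite \<Rightarrow> 'b::euclidean_space"
  shows "locally_integrable \<Omega> f \<Longrightarrow> locally_integrable \<Omega> g \<Longrightarrow> locally_integrable \<Omega> (\<lambda>x. f x + g x)"
  unfolding locally_integrable_def by blast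

lemma locally_integrable_linear:
  fixes f :: "real^'n::finite \<Rightarrow> 'b::euclidean_space" and T :: "'b \<Rightarrow> 'c::euclidean_space"
  shows "bounded_linear T \<Longrightarrow> locally_integrable \<Omega> f \<Longrightarrow> locally_integrable \<Omega> (\<lambda>x. T (f x))"
  unfolding locally_integrable_def using integrable_bounded_linear by blast

lemma locally_integrable_sum:
  fixes f :: "'i \<Rightarrow> real^'n::finite \<Rightarrow> 'b::euclidean_space"
  shows "(\<And>i. i \<in> I \<Longrightarrow> locally_integrable \<Omega> (f i)) \<Longrightarrow> locally_integrable \<Omega> (\<lambda>x. \<Sum>i\<in>I. f i x)"
  unfolding locally_integrable_def by (intro allI impI Bochner_Integration.integrable_sum) blast

lemma compact_exhaustion:
  fixes \<Omega> :: "'a::euclidean_space set"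
  assumes "open \<Omega>"
  shows "\<exists>C. (\<forall>n. compact (C n)) \<and> (\<forall>n. C n \<subseteq> \<Omega>) \<and> (\<forall>n. C n \<subseteq> C (Suc n)) \<and> (\<forall>x\<in>\<Omega>. \<exists>n. x \<in> C n) \<and>
    (\<forall>K. compact K \<longrightarrow> K \<subseteq> \<Omega> \<longrightarrow> (\<exists>N::nat. \<forall>n\<ge>N. K \<subseteq> C n))"
proof (rule open_Union_compact_subsets[OF assms])
  fix C :: "nat \<Rightarrow> 'a set"
  assume "\<And>n. compact (C n)" "\<And>n. C n \<subseteq> \<Omega>" and i: "\<And>n. C n \<subseteq> interior (C (Suc n))"
    and u: "\<Union> (range C) = \<Omega>" and "\<And>K. compact K \<Longrightarrow> K \<subseteq> \<Omega> \<Longrightarrow> \<exists>N. \<forall>n\<ge>N. K \<subseteq> C n"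
  moreover have "C n \<subseteq> C (Suc n)" for n using i interior_subset by blast
  moreover have "\<exists>n. x \<in> C n" if "x \<in> \<Omega>" for x using u that by blast
  ultimately show ?thesis by (intro exI[of _ C] conjI allI ballI impI)
qed

text \<open>Local integrability speaks about compact sets one at a time; measurability on the whole open set is
recovered along a compact exhaustion.\<close>

lemma locally_integrable_measurable:
  fixes f :: "real^'n::finite \<Rightarrow> 'b::euclidean_space"
  assumes "locally_integrable \<Omega> f" "open \<Omega>"
  shows "(\<lambda>x. indicator \<Omega> x *\<^sub>R f x) \<in> borel_measurable lebesgue"
proof -
  obtain C where C: "\<forall>n. compact (C n)" "\<forall>n. C n \<subseteq> \<Omega>" "\<forall>n. C n \<subseteq> C (Suc n)" "\<forall>x\<in>\<Omega>. \<exists>n. x \<in> C n"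
    "\<forall>K. compact K \<longrightarrow> K \<subseteq> \<Omega> \<longrightarrow> (\<exists>N::nat. \<forall>n\<ge>N. K \<subseteq> C n)"
    using compact_exhaustion[OF assms(2)] by (elim exE conjE) (rule that)
  note C = C(1,2)[rule_format] C(5)[rule_format]
  show ?thesis
  proof (rule borel_measurable_LIMSEQ_metric)
    fix n
    have "integrable (lebesgue_on (C n)) f" using assms(1) C(1,2) by (auto simp: locally_integrable_def)
    then show "(\<lambda>x. indicator (C n) x *\<^sub>R f x) \<in> borel_measurable lebesgue"
      using integrable_restrict_space[of "C n" lebesgue f] compact_sets_lebesgue[OF C(1)] by auto
  next
    fix x
    show "(\<lambda>n. indicator (C n) x *\<^sub>R f x) \<longlonglongrightarrow> indicator \<Omega> x *\<^sub>R f x"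
    proof (cases "x \<in> \<Omega>")
      case True
      then obtain N where "\<forall>n\<ge>N. x \<in> C n" using C(3)[of "{x}"] by auto
      then have "\<forall>\<^sub>F n in sequentially. indicator (C n) x *\<^sub>R f x = indicator \<Omega> x *\<^sub>R f x"
        using True by (auto simp: eventually_sequentially intro!: exI[of _ N])
      then show ?thesis by (rule tendsto_eventually)
    next
      case False
      then have "x \<notin> C n" for n using C(2) by blast
      with False show ?thesis by simp
    qed
  qed
qed

lemma measurable_lebesgue_on_of_indicator:
  fixes f :: "'a::euclidean_space \<Rightarrow> 'b::euclidean_space"
  assumes "(\<lambda>x. indicator \<Omega> x *\<^sub>R f x) \<in> borel_measurable lebesgue" "K \<subseteq> \<Omega>"
  shows "f \<in> borel_measurable (lebesgue_on K)"
proof -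
  have "(\<lambda>x. indicator \<Omega> x *\<^sub>R f x) \<in> borel_measurable (lebesgue_on K)"
    using assms(1) by (rule measurable_restrict_space1)
  then show ?thesis
    by (rule measurable_cong[THEN iffD1, rotated]) (use assms(2) in \<open>auto simp: indicator_def space_restrict_space\<close>)
qed

lemma locally_integrable_mult_bounded:
  fixes f g :: "real^'n::finite \<Rightarrow> real"
  assumes "f \<in> borel_measurable (lebesgue_on \<Omega>)" "AE x in lebesgue_on \<Omega>. \<bar>f x\<bar> \<le> M" "locally_integrable \<Omega> g" "open \<Omega>"
  shows "locally_integrable \<Omega> (\<lambda>x. f x * g x)"
  unfolding locally_integrable_def
proof (intro allI impI)
  fix K assume K: "compact K \<and> K \<subseteq> \<Omega>"
  have g: "integrable (lebesgue_on K) g" using assms(3) K by (auto simp: locally_integrable_def)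
  have m: "f \<in> borel_measurable (lebesgue_on K)"
    using measurable_restrict_mono[OF assms(1)] K by blast
  have "AE x in lebesgue_on K. \<bar>f x\<bar> \<le> M"
    using AE_lebesgue_on_subset[OF assms(2)] K assms(4) compact_sets_lebesgue by auto
  then show "integrable (lebesgue_on K) (\<lambda>x. f x * g x)"
    by (intro Bochner_Integration.integrable_bound[OF integrable_mult_right[OF g, of M]] borel_measurable_times m borel_measurable_integrable[OF g])
       (auto elim!: eventually_mono simp: abs_mult intro!: mult_right_mono)
qed

lemma locally_integrable_measurable_on:
  fixes f :: "real^'n::finite \<Rightarrow> 'b::euclidean_space"
  assumes "locally_integrable \<Omega> f" "open \<Omega>"
  shows "f \<in> borel_measurable (lebesgue_on \<Omega>)"
  by (rule measurable_lebesgue_on_of_indicator[OF locally_integrable_measurable[OF assms]]) simp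

lemma integrable_test_function_scaleR:
  fixes g :: "real^'n \<Rightarrow> 'b::euclidean_space"
  assumes "test_function \<Omega> \<phi>" "locally_integrable \<Omega> g"
  shows "integrable lebesgue (\<lambda>x. \<phi> x *\<^sub>R g x)"
proof -
  have "integrable lebesgue (\<lambda>x. \<Sum>b\<in>Basis. (\<phi> x * (g x \<bullet> b)) *\<^sub>R b)"
    by (intro Bochner_Integration.integrable_sum integrable_scaleR_left integrable_test_function_mult[OF assms(1)]
        locally_integrable_linear[OF bounded_linear_inner_left assms(2)])
  also have "(\<lambda>x. \<Sum>b\<in>Basis. (\<phi> x * (g x \<bullet> b)) *\<^sub>R b) = (\<lambda>x. \<phi> x *\<^sub>R g x)"
    by (simp add: scaleR_scaleR[symmetric] scaleR_sum_right[symmetric] euclidean_representation del: scaleR_scaleR)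
  finally show ?thesis .
qed

lemma integral_test_function_lebesgue_on:
  fixes g :: "real^'n \<Rightarrow> 'b::euclidean_space"
  assumes "test_function \<Omega> \<phi>" "open \<Omega>"
  shows "(LINT x|lebesgue_on \<Omega>. \<phi> x *\<^sub>R g x) = (LINT x|lebesgue. \<phi> x *\<^sub>R g x)"
proof -
  have "(LINT x|lebesgue_on \<Omega>. \<phi> x *\<^sub>R g x) = (LINT x|lebesgue. indicator \<Omega> x *\<^sub>R \<phi> x *\<^sub>R g x)"
    using assms(2) by (intro integral_restrict_space) simp
  also have "(\<lambda>x. indicator \<Omega> x *\<^sub>R \<phi> x *\<^sub>R g x) = (\<lambda>x. \<phi> x *\<^sub>R g x)"
  proof
    fix x show "indicator \<Omega> x *\<^sub>R \<phi> x *\<^sub>R g x = \<phi> x *\<^sub>R g x"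
      using test_function_outside[OF assms(1), of x] by (cases "x \<in> \<Omega>") auto
  qed
  finally show ?thesis .
qed

text \<open>Extending the integrals to the whole space removes the domain from all later computations.\<close>

lemma has_weak_partial_iff:
  fixes f :: "real^'n \<Rightarrow> 'b::euclidean_space"
  assumes "open \<Omega>"
  shows "has_weak_partial \<Omega> i f g \<longleftrightarrow> locally_integrable \<Omega> f \<and> locally_integrable \<Omega> g \<and>
     (\<forall>\<phi>. test_function \<Omega> \<phi> \<longrightarrow>
        (LINT x|lebesgue. partial_deriv i \<phi> x *\<^sub>R f x) = - (LINT x|lebesgue. \<phi> x *\<^sub>R g x))"
proof -
  have e: "(LINT x|lebesgue_on \<Omega>. partial_deriv i \<phi> x *\<^sub>R f x) = (LINT x|lebesgue. partial_deriv i \<phi> x *\<^sub>R f x)"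
    "(LINT x|lebesgue_on \<Omega>. \<phi> x *\<^sub>R g x) = (LINT x|lebesgue. \<phi> x *\<^sub>R g x)" if "test_function \<Omega> \<phi>" for \<phi>
    by (rule integral_test_function_lebesgue_on[OF test_function_partial_deriv[OF that] assms],
        rule integral_test_function_lebesgue_on[OF that assms])
  show ?thesis unfolding has_weak_partial_def
    by (intro conj_cong refl iff_allI imp_cong) (simp only: e)
qed

lemma has_weak_partial_linear:
  fixes f :: "real^'n::finite \<Rightarrow> 'b::euclidean_space" and T :: "'b \<Rightarrow> 'c::euclidean_space"
  assumes T: "bounded_linear T" and f: "has_weak_partial \<Omega> i f g" and "open \<Omega>"
  shows "has_weak_partial \<Omega> i (\<lambda>x. T (f x)) (\<lambda>x. T (g x))"
proof -
  interpret bounded_linear T by fact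
  have l: "locally_integrable \<Omega> f" "locally_integrable \<Omega> g" using f by (auto simp: has_weak_partial_def)
  show ?thesis
    unfolding has_weak_partial_iff[OF assms(3)]
  proof (intro conjI allI impI locally_integrable_linear[OF T] l)
    fix \<phi> assume \<phi>: "test_function \<Omega> \<phi>"
    note i = integrable_test_function_scaleR[OF test_function_partial_deriv[OF \<phi>] l(1), of i]
      integrable_test_function_scaleR[OF \<phi> l(2)]
    have "T (LINT x|lebesgue. partial_deriv i \<phi> x *\<^sub>R f x) = T (- (LINT x|lebesgue. \<phi> x *\<^sub>R g x))"
      using f \<phi> by (simp add: has_weak_partial_iff[OF assms(3)])
    then show "(LINT x|lebesgue. partial_deriv i \<phi> x *\<^sub>R T (f x)) = - (LINT x|lebesgue. \<phi> x *\<^sub>R T (g x))"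
      using integral_bounded_linear[OF T i(1)] integral_bounded_linear[OF T i(2)] by (simp add: scaleR neg)
  qed
qed

lemma has_weak_partial_sum:
  fixes f :: "'i \<Rightarrow> real^'n::finite \<Rightarrow> 'b::euclidean_space"
  assumes f: "\<And>k. k \<in> I \<Longrightarrow> has_weak_partial \<Omega> i (f k) (g k)" and "open \<Omega>"
  shows "has_weak_partial \<Omega> i (\<lambda>x. \<Sum>k\<in>I. f k x) (\<lambda>x. \<Sum>k\<in>I. g k x)"
proof -
  have l: "k \<in> I \<Longrightarrow> locally_integrable \<Omega> (f k)" "k \<in> I \<Longrightarrow> locally_integrable \<Omega> (g k)" for k
    using f by (auto simp: has_weak_partial_def)
  show ?thesis
    unfolding has_weak_partial_iff[OF assms(2)]
  proof (intro conjI allI impI locally_integrable_sum l)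
    fix \<phi> assume \<phi>: "test_function \<Omega> \<phi>"
    note i = integrable_test_function_scaleR[OF test_function_partial_deriv[OF \<phi>] l(1)]
      integrable_test_function_scaleR[OF \<phi> l(2)]
    have "(LINT x|lebesgue. partial_deriv i \<phi> x *\<^sub>R (\<Sum>k\<in>I. f k x)) = (\<Sum>k\<in>I. LINT x|lebesgue. partial_deriv i \<phi> x *\<^sub>R f k x)"
      unfolding scaleR_sum_right by (rule Bochner_Integration.integral_sum) (rule i)
    also have "\<dots> = (\<Sum>k\<in>I. - (LINT x|lebesgue. \<phi> x *\<^sub>R g k x))"
      using f \<phi> by (intro sum.cong) (auto simp: has_weak_partial_iff[OF assms(2)])
    also have "\<dots> = - (\<Sum>k\<in>I. LINT x|lebesgue. \<phi> x *\<^sub>R g k x)" by (rule sum_negf)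
    also have "(\<Sum>k\<in>I. LINT x|lebesgue. \<phi> x *\<^sub>R g k x) = (LINT x|lebesgue. \<phi> x *\<^sub>R (\<Sum>k\<in>I. g k x))"
      unfolding scaleR_sum_right by (rule Bochner_Integration.integral_sum[symmetric]) (rule i)
    finally show "(LINT x|lebesgue. partial_deriv i \<phi> x *\<^sub>R (\<Sum>k\<in>I. f k x)) = - (LINT x|lebesgue. \<phi> x *\<^sub>R (\<Sum>k\<in>I. g k x))" .
  qed
qed

lemma has_weak_partial_add:
  fixes f g :: "real^'n::finite \<Rightarrow> 'b::euclidean_space"
  assumes "has_weak_partial \<Omega> i f f'" "has_weak_partial \<Omega> i g g'" "open \<Omega>"
  shows "has_weak_partial \<Omega> i (\<lambda>x. f x + g x) (\<lambda>x. f' x + g' x)"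
proof -
  have "has_weak_partial \<Omega> i (\<lambda>x. \<Sum>k\<in>{True, False}. (if k then f else g) x) (\<lambda>x. \<Sum>k\<in>{True, False}. (if k then f' else g') x)"
    by (rule has_weak_partial_sum) (use assms in auto)
  then show ?thesis by simp
qed

text \<open>Together with \<open>has_weak_partial_linear\<close> this reduces vector valued statements to real valued ones.\<close>

lemma has_weak_partial_componentwise:
  fixes f :: "real^'n::finite \<Rightarrow> 'b::euclidean_space"
  assumes "\<And>b. b \<in> Basis \<Longrightarrow> has_weak_partial \<Omega> i (\<lambda>x. f x \<bullet> b) (\<lambda>x. g x \<bullet> b)" "open \<Omega>"
  shows "has_weak_partial \<Omega> i f g"
proof -
  have "has_weak_partial \<Omega> i (\<lambda>x. \<Sum>b\<in>Basis. (f x \<bullet> b) *\<^sub>R b) (\<lambda>x. \<Sum>b\<in>Basis. (g x \<bullet> b) *\<^sub>R b)"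
  proof (rule has_weak_partial_sum[OF _ assms(2)])
    fix b :: 'b assume "b \<in> Basis"
    show "has_weak_partial \<Omega> i (\<lambda>x. (f x \<bullet> b) *\<^sub>R b) (\<lambda>x. (g x \<bullet> b) *\<^sub>R b)"
      by (rule has_weak_partial_linear[OF bounded_linear_scaleR_left assms(1)[OF \<open>b \<in> Basis\<close>] assms(2)])
  qed
  then show ?thesis by (simp add: euclidean_representation)
qed

lemma has_weak_partial_cong_AE:
  fixes f :: "real^'n::finite \<Rightarrow> 'b::euclidean_space"
  assumes "has_weak_partial \<Omega> i f g" "AE x in lebesgue_on \<Omega>. f x = f' x" "AE x in lebesgue_on \<Omega>. g x = g' x" "open \<Omega>"
  shows "has_weak_partial \<Omega> i f' g'"
proof -
  have l: "locally_integrable \<Omega> f" "locally_integrable \<Omega> g" using assms(1) by (auto simp: has_weak_partial_def)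
  have l': "locally_integrable \<Omega> f'" "locally_integrable \<Omega> g'" using l assms locally_integrable_cong_AE by blast+
  have eq: "(LINT x|lebesgue. \<phi> x *\<^sub>R h x) = (LINT x|lebesgue. \<phi> x *\<^sub>R h' x)"
    if "test_function \<Omega> \<phi>" "locally_integrable \<Omega> h" "locally_integrable \<Omega> h'" "AE x in lebesgue_on \<Omega>. h x = h' x"
    for \<phi> and h h' :: "real^'n \<Rightarrow> 'b"
  proof (rule integral_cong_AE)
    show "(\<lambda>x. \<phi> x *\<^sub>R h x) \<in> borel_measurable lebesgue" "(\<lambda>x. \<phi> x *\<^sub>R h' x) \<in> borel_measurable lebesgue"
      by (intro borel_measurable_integrable integrable_test_function_scaleR[OF that(1)] that(2,3))+
    have "AE x in lebesgue. x \<in> \<Omega> \<longrightarrow> h x = h' x" using that(4) assms(4) by (simp add: AE_lebesgue_on_iff)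
    then show "AE x in lebesgue. \<phi> x *\<^sub>R h x = \<phi> x *\<^sub>R h' x"
      by eventually_elim (use test_function_outside[OF that(1)] in auto)
  qed
  show ?thesis
    using assms(1) l' eq[OF _ l(2) l'(2) assms(3)] eq[OF test_function_partial_deriv l(1) l'(1) assms(2)]
    by (auto simp: has_weak_partial_iff[OF assms(4)])
qed

lemma has_weak_partial_subset:
  assumes "has_weak_partial \<Omega> i f g" "\<Omega>' \<subseteq> \<Omega>" "open \<Omega>" "open \<Omega>'"
  shows "has_weak_partial \<Omega>' i f g"
  using assms test_function_mono[OF _ assms(2)] locally_integrable_subset[OF _ assms(2)]
  by (auto simp: has_weak_partial_iff)

lemma has_weak_partial_const: 
  fixes c :: "'b::euclidean_space"
  assumes "open \<Omega>"
  shows "has_weak_partial \<Omega> i (\<lambda>x. c) (\<lambda>x. 0)"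
  unfolding has_weak_partial_iff[OF assms]
proof (intro conjI allI impI locally_integrable_const)
  fix \<phi> assume \<phi>: "test_function \<Omega> \<phi>"
  show "(LINT x|lebesgue. partial_deriv i \<phi> x *\<^sub>R c) = - (LINT x|lebesgue. \<phi> x *\<^sub>R 0)"
    using integral_scaleR_left[of c, OF integrable_test_function[OF test_function_partial_deriv[OF \<phi>]]]
    by (simp add: integral_partial_deriv_test_function[OF \<phi>])
qed


section \<open>Cutoffs and uniqueness of weak derivatives\<close>

text \<open>Test the derivative of \<open>f\<close> with \<open>\<eta> \<phi>\<close>. As \<open>\<eta>\<close> has compact support, the product is weakly differentiable
on the whole space, where mollification is available.\<close>

lemma has_weak_partial_cutoff:
  fixes f :: "real^'n::finite \<Rightarrow> real"
  assumes \<eta>: "test_function \<Omega> \<eta>" and f: "has_weak_partial \<Omega> i f g" and "open \<Omega>"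
  shows "has_weak_partial UNIV i (\<lambda>x. \<eta> x * f x) (\<lambda>x. \<eta> x * g x + partial_deriv i \<eta> x * f x)"
proof -
  have l: "locally_integrable \<Omega> f" "locally_integrable \<Omega> g" using f by (auto simp: has_weak_partial_def)
  note i = integrable_test_function_mult[OF \<eta> l(1)] integrable_test_function_mult[OF \<eta> l(2)]
    integrable_test_function_mult[OF test_function_partial_deriv[OF \<eta>] l(1)]
  show ?thesis
    unfolding has_weak_partial_iff[OF open_UNIV]
  proof (intro conjI allI impI locally_integrable_integrable Bochner_Integration.integrable_add i)
    fix \<phi> :: "real^'n \<Rightarrow> real" assume \<phi>: "test_function UNIV \<phi>"
    have \<eta>\<phi>: "test_function \<Omega> (\<lambda>x. \<eta> x * \<phi> x)" by (rule test_function_smooth_mult[OF \<eta> test_function_smooth[OF \<phi>]])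
    note d = smooth_differentiable[OF test_function_smooth[OF \<eta>]] smooth_differentiable[OF test_function_smooth[OF \<phi>]]
    have t1: "test_function \<Omega> (\<lambda>x. \<eta> x * partial_deriv i \<phi> x)"
      by (intro test_function_smooth_mult[OF \<eta>] smooth_partial_deriv test_function_smooth[OF \<phi>])
    have t2: "test_function \<Omega> (\<lambda>x. partial_deriv i \<eta> x * \<phi> x)"
      by (intro test_function_smooth_mult[OF test_function_partial_deriv[OF \<eta>]] test_function_smooth[OF \<phi>])
    note j = integrable_test_function_mult[OF t1 l(1)] integrable_test_function_mult[OF t2 l(1)]
       integrable_test_function_mult[OF \<eta>\<phi> l(2)]
    have "(LINT x|lebesgue. partial_deriv i (\<lambda>x. \<eta> x * \<phi> x) x * f x) = - (LINT x|lebesgue. (\<eta> x * \<phi> x) * g x)"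
      using f \<eta>\<phi> by (simp add: has_weak_partial_iff[OF assms(3)])
    then have "(LINT x|lebesgue. (\<eta> x * partial_deriv i \<phi> x) * f x) + (LINT x|lebesgue. (partial_deriv i \<eta> x * \<phi> x) * f x)
      = - (LINT x|lebesgue. (\<eta> x * \<phi> x) * g x)"
      unfolding partial_deriv_mult[OF d] distrib_right using Bochner_Integration.integral_add[OF j(1,2)] by simp
    moreover have "(LINT x|lebesgue. \<phi> x *\<^sub>R (\<eta> x * g x + partial_deriv i \<eta> x * f x))
        = (LINT x|lebesgue. (\<eta> x * \<phi> x) * g x) + (LINT x|lebesgue. (partial_deriv i \<eta> x * \<phi> x) * f x)"
      unfolding Bochner_Integration.integral_add[OF j(3,2), symmetric]
      by (intro Bochner_Integration.integral_cong) (auto simp: algebra_simps)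
    moreover have "(LINT x|lebesgue. partial_deriv i \<phi> x *\<^sub>R (\<eta> x * f x)) = (LINT x|lebesgue. (\<eta> x * partial_deriv i \<phi> x) * f x)"
      by (intro Bochner_Integration.integral_cong) (auto simp: algebra_simps)
    ultimately show "(LINT x|lebesgue. partial_deriv i \<phi> x *\<^sub>R (\<eta> x * f x)) = - (LINT x|lebesgue. \<phi> x *\<^sub>R (\<eta> x * g x + partial_deriv i \<eta> x * f x))"
      by simp
  qed
qed

text \<open>The kernel \<open>y \<mapsto> \<rho> (x - y)\<close> is itself a test function.\<close>

lemma partial_deriv_mollify:
  assumes w: "has_weak_partial UNIV i u g" and u: "integrable lebesgue u" and g: "integrable lebesgue (g :: real^'n::finite \<Rightarrow> real)"
  shows "partial_deriv i (mollify n u) = mollify n g"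
proof
  fix x
  let ?k = "mollifier n :: real^'n \<Rightarrow> real"
  have k: "test_function UNIV (\<lambda>y. ?k (x - y))" by (rule test_function_reflect_UNIV[OF test_function_mollifier])
  have d: "partial_deriv i (\<lambda>y. ?k (x - y)) = (\<lambda>y. - partial_deriv i ?k (x - y))"
    by (rule partial_deriv_reflect[OF smooth_differentiable[OF test_function_smooth[OF test_function_mollifier]]])
  have "partial_deriv i (mollify n u) x = (LINT y|lebesgue. partial_deriv i ?k (x - y) * u y)"
    unfolding mollify_def partial_deriv_convolution[OF test_function_mollifier u] convolution_def ..
  also have "\<dots> = - (LINT y|lebesgue. partial_deriv i (\<lambda>y. ?k (x - y)) y * u y)" unfolding d by simp
  also have "\<dots> = (LINT y|lebesgue. ?k (x - y) * g y)"
    using w k by (simp add: has_weak_partial_iff)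
  finally show "partial_deriv i (mollify n u) x = mollify n g x" by (simp add: mollify_def convolution_def)
qed

lemma mollify_eq_0:
  assumes "\<And>y. norm (x - y) \<le> inverse (real (Suc n)) \<Longrightarrow> f y = 0"
  shows "mollify n f x = 0"
proof -
  have "mollifier n (x - y) * f y = 0" for y
    using assms[of y] mollifier_eq_0[of n "x - y"] by (cases "norm (x - y) \<le> inverse (real (Suc n))") auto
  then have "(\<lambda>y. mollifier n (x - y) * f y) = (\<lambda>y. 0)" by (rule ext)
  then show ?thesis unfolding mollify_def convolution_def by simp
qed

text \<open>Mollification enlarges the support only by the radius of the mollifier. A common compact set for
the supports is needed to integrate the mollifications against locally integrable functions.\<close>

lemma mollify_eventually_test_function:
  fixes f :: "real^'n::finite \<Rightarrow> real"
  assumes f: "integrable lebesgue f" and K: "compact K" "K \<subseteq> \<Omega>" "\<And>x. x \<notin> K \<Longrightarrow> f x = 0" and "open \<Omega>"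
  obtains K' N where "compact K'" "K \<subseteq> K'" "K' \<subseteq> \<Omega>" "\<And>n x. n \<ge> N \<Longrightarrow> x \<notin> K' \<Longrightarrow> mollify n f x = 0"
    "\<And>n. n \<ge> N \<Longrightarrow> test_function \<Omega> (mollify n f)"
proof -
  obtain d where d: "d > 0" "(\<Union>x\<in>K. cball x d) \<subseteq> \<Omega>"
    using compact_subset_open_imp_cball_epsilon_subset[OF K(1) assms(5) K(2)] by blast
  define K' where "K' = {x + y |x y. x \<in> K \<and> y \<in> cball 0 d}"
  have K': "compact K'" unfolding K'_def by (intro compact_sums K compact_cball)
  have sup: "K \<subseteq> K'" using d(1) unfolding K'_def by force
  have sub: "K' \<subseteq> \<Omega>" using d(2) unfolding K'_def by (force simp: dist_norm)
  obtain N where N: "inverse (real (Suc N)) < d" using d(1) reals_Archimedean by blast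
  have z: "mollify n f x = 0" if "n \<ge> N" "x \<notin> K'" for n x
  proof (rule mollify_eq_0)
    fix y assume y: "norm (x - y) \<le> inverse (real (Suc n))"
    have "inverse (real (Suc n)) \<le> inverse (real (Suc N))" using that(1) by (intro le_imp_inverse_le) auto
    then have "norm (x - y) \<le> d" using y N by linarith
    then have "x \<in> K'" if "y \<in> K"
      unfolding K'_def using that by (intro CollectI exI[of _ y] exI[of _ "x - y"]) auto
    then have "y \<notin> K" using that(2) by blast
    then show "f y = 0" by (rule K(3))
  qed
  have "test_function \<Omega> (mollify n f)" if "n \<ge> N" for n
    unfolding test_function_def using K' sub z[OF that] smooth_convolution[OF test_function_mollifier f]
    by (auto simp: mollify_def)
  with K' sup sub z that show thesis by blast
qed

lemma integral_mollifier_reflect: "(LINT y|lebesgue. mollifier n (x - y)) = 1"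
  using integral_lborel_reflect[of "mollifier n" x] integral_lborel_mollifier[of n, where 'n = 'a]
  by (simp add: integral_completion)

lemma mollify_bounded:
  assumes f: "integrable lebesgue f" and M: "AE x in lebesgue. \<bar>f x\<bar> \<le> M"
  shows "\<bar>mollify n f x\<bar> \<le> M"
proof -
  note i = integrable_convolution[OF test_function_mollifier[of n] f, of x]
  have k: "integrable lebesgue (\<lambda>y. mollifier n (x - y))"
    by (rule integrable_test_function[OF test_function_reflect_UNIV[OF test_function_mollifier]])
  have "\<bar>mollify n f x\<bar> \<le> (LINT y|lebesgue. \<bar>mollifier n (x - y) * f y\<bar>)"
    unfolding mollify_def convolution_def by (rule integral_abs_bound)
  also have "\<dots> \<le> (LINT y|lebesgue. mollifier n (x - y) * M)"
    using M by (intro integral_mono_AE integrable_abs i integrable_mult_left k)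
      (auto elim!: eventually_mono simp: abs_mult mollifier_nonneg intro!: mult_left_mono)
  also have "\<dots> = M" using integral_mollifier_reflect[of n x] by simp
  finally show ?thesis .
qed

lemma mollify_eq_1:
  assumes "\<And>y. norm (x - y) \<le> inverse (real (Suc n)) \<Longrightarrow> f y = 1"
  shows "mollify n f x = 1"
proof -
  have "mollifier n (x - y) * f y = mollifier n (x - y)" for y
    using assms[of y] mollifier_eq_0[of n "x - y"] by (cases "norm (x - y) \<le> inverse (real (Suc n))") auto
  then have "(\<lambda>y. mollifier n (x - y) * f y) = (\<lambda>y. mollifier n (x - y))" by (rule ext)
  then have "mollify n f x = (LINT y|lebesgue. mollifier n (x - y))"
    unfolding mollify_def convolution_def by simp
  also have "\<dots> = 1" by (rule integral_mollifier_reflect)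
  finally show ?thesis .
qed

text \<open>Mollify the indicator of a compact neighbourhood of \<open>K\<close>.\<close>

lemma cutoff_function_exists:
  fixes K :: "(real^'n::finite) set"
  assumes K: "compact K" "K \<subseteq> \<Omega>" "open \<Omega>"
  obtains \<eta> V where "test_function \<Omega> \<eta>" "open V" "K \<subseteq> V" "V \<subseteq> \<Omega>" "\<And>x. x \<in> V \<Longrightarrow> \<eta> x = 1"
proof -
  obtain d where d: "d > 0" "(\<Union>x\<in>K. cball x d) \<subseteq> \<Omega>"
    using compact_subset_open_imp_cball_epsilon_subset[OF K(1,3,2)] by blast
  \<comment> \<open>mollifying the indicator of \<open>K1\<close> leaves the value \<open>1\<close> on the points of depth at least the radius of the mollifier\<close>
  define K1 where "K1 = {x + y |x y. x \<in> K \<and> y \<in> cball 0 d}"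
  define V where "V = (\<Union>x\<in>K. ball x (d / 2))"
  let ?f = "indicator K1 :: real^'n \<Rightarrow> real"
  have K1: "compact K1" unfolding K1_def by (intro compact_sums K compact_cball)
  have sub: "K1 \<subseteq> \<Omega>" using d(2) unfolding K1_def by (force simp: dist_norm)
  have f: "integrable lebesgue ?f"
    using lmeasurable_compact[OF K1] by (auto simp: fmeasurable_def)
  obtain K' N where N: "\<And>n. n \<ge> N \<Longrightarrow> test_function \<Omega> (mollify n ?f)"
    by (rule mollify_eventually_test_function[OF f K1 sub _ K(3)]) auto
  obtain m where m: "inverse (real (Suc m)) < d / 2" using d(1) reals_Archimedean[of "d / 2"] by auto
  define n where "n = max N m"
  have n: "inverse (real (Suc n)) < d / 2"
    by (rule order.strict_trans1[OF le_imp_inverse_le m]) (auto simp: n_def)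
  have "mollify n ?f x = 1" if xV: "x \<in> V" for x
  proof (rule mollify_eq_1)
    fix y assume y: "norm (x - y) \<le> inverse (real (Suc n))"
    obtain z where z: "z \<in> K" "norm (z - x) < d / 2" using xV by (auto simp: V_def dist_norm)
    have "norm (y - z) \<le> norm (x - y) + norm (z - x)"
      using norm_triangle_ineq[of "x - y" "z - x"] by (simp add: norm_minus_commute)
    then have "norm (y - z) \<le> d" using y z n by linarith
    then have "y \<in> K1" unfolding K1_def using z(1)
      by (intro CollectI exI[of _ z] exI[of _ "y - z"]) auto
    then show "?f y = 1" by simp
  qed
  moreover have "K \<subseteq> V" "open V" using d(1) unfolding V_def by auto
  moreover have "ball x (d / 2) \<subseteq> cball x d" for x :: "real^'n" using d(1) by auto
  then have "V \<subseteq> \<Omega>" unfolding V_def using d(2) by blast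
  ultimately show thesis using that[of "mollify n ?f" V] N[of n] by (auto simp: n_def)
qed

text \<open>For a test function \<open>\<eta>\<close> the mollifications of \<open>\<eta> g\<close> are integrals of \<open>g\<close> against test
functions, hence vanish; they converge to \<open>\<eta> g\<close> in \<open>L\<^sup>1\<close>. Let \<open>\<eta>\<close> run through cutoffs that equal \<open>1\<close> on the sets of an exhaustion.\<close>

lemma du_Bois_Reymond:
  fixes g :: "real^'n::finite \<Rightarrow> real"
  assumes g: "locally_integrable \<Omega> g" and "open \<Omega>"
    and 0: "\<And>\<phi>. test_function \<Omega> \<phi> \<Longrightarrow> (LINT x|lebesgue. \<phi> x * g x) = 0"
  shows "AE x in lebesgue_on \<Omega>. g x = 0"
proof -
  have cut: "AE x in lebesgue. \<eta> x * g x = 0" if \<eta>: "test_function \<Omega> \<eta>" for \<eta>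
  proof -
    let ?h = "\<lambda>x. \<eta> x * g x"
    have h: "integrable lebesgue ?h" by (rule integrable_test_function_mult[OF \<eta> g])
    have "mollify n ?h x = 0" for n x
    proof -
      have "test_function \<Omega> (\<lambda>y. \<eta> y * mollifier n (x - y))"
        by (intro test_function_smooth_mult[OF \<eta>] smooth_reflect test_function_smooth[OF test_function_mollifier])
      from 0[OF this] show ?thesis by (simp add: mollify_def convolution_def mult_ac)
    qed
    then have "(\<lambda>n::nat. LINT x|lebesgue. \<bar>?h x\<bar>) \<longlonglongrightarrow> 0" using mollify_L1[OF h] by simp
    then have "(LINT x|lebesgue. \<bar>?h x\<bar>) = 0" by (simp only: LIMSEQ_const_iff)
    then show ?thesis using integral_nonneg_eq_0_iff_AE[OF integrable_abs[OF h]] by simp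
  qed
  obtain C where C: "\<forall>n. compact (C n)" "\<forall>n. C n \<subseteq> \<Omega>" "\<forall>n. C n \<subseteq> C (Suc n)" "\<forall>x\<in>\<Omega>. \<exists>n. x \<in> C n"
    "\<forall>K. compact K \<longrightarrow> K \<subseteq> \<Omega> \<longrightarrow> (\<exists>N::nat. \<forall>n\<ge>N. K \<subseteq> C n)"
    using compact_exhaustion[OF assms(2)] by (elim exE conjE) (rule that)
  note C = C(1,2,4)[rule_format]
  have "AE x in lebesgue. x \<in> C n \<longrightarrow> g x = 0" for n
  proof -
    obtain \<eta> V where "test_function \<Omega> \<eta>" "C n \<subseteq> V" "\<And>x. x \<in> V \<Longrightarrow> \<eta> x = 1"
      by (rule cutoff_function_exists[OF C(1,2) assms(2)]) (rule that)
    then show ?thesis using cut[of \<eta>] by (auto elim!: eventually_mono simp: subset_iff)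
  qed
  then have "AE x in lebesgue. \<forall>n. x \<in> C n \<longrightarrow> g x = 0" unfolding AE_all_countable by (rule allI)
  then have "AE x in lebesgue. x \<in> \<Omega> \<longrightarrow> g x = 0" 
    by eventually_elim (use C(3) in blast)
  then show ?thesis using assms(2) by (simp add: AE_lebesgue_on_iff)
qed

lemma weak_partial_unique:
  fixes f :: "real^'n::finite \<Rightarrow> 'b::euclidean_space"
  assumes "has_weak_partial \<Omega> i f g" "has_weak_partial \<Omega> i f h" "open \<Omega>"
  shows "AE x in lebesgue_on \<Omega>. g x = h x"
proof -
  have "AE x in lebesgue_on \<Omega>. g x \<bullet> b - h x \<bullet> b = 0" for b
  proof (rule du_Bois_Reymond[OF _ assms(3)])
    note w = assms(1,2)[THEN has_weak_partial_linear[OF bounded_linear_inner_left[of b] _ assms(3)], unfolded has_weak_partial_iff[OF assms(3)]]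
    have l: "locally_integrable \<Omega> (\<lambda>x. g x \<bullet> b)" "locally_integrable \<Omega> (\<lambda>x. h x \<bullet> b)" using w by auto
    show "locally_integrable \<Omega> (\<lambda>x. g x \<bullet> b - h x \<bullet> b)"
      using locally_integrable_add[OF l(1) locally_integrable_linear[OF bounded_linear_minus[OF bounded_linear_ident] l(2)]] by simp
    fix \<phi> assume \<phi>: "test_function \<Omega> \<phi>"
    show "(LINT x|lebesgue. \<phi> x * (g x \<bullet> b - h x \<bullet> b)) = 0"
      unfolding right_diff_distrib
      using w \<phi> Bochner_Integration.integral_diff[OF integrable_test_function_mult[OF \<phi> l(1)] integrable_test_function_mult[OF \<phi> l(2)]]
      by simp
  qed
  then have "AE x in lebesgue_on \<Omega>. \<forall>b\<in>Basis. g x \<bullet> b - h x \<bullet> b = 0" by (simp add: AE_finite_all)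
  then show ?thesis by (auto elim!: eventually_mono intro: euclidean_eqI)
qed

text \<open>Second derivatives of test functions commute.\<close>

lemma weak_partial_commute:
  fixes f :: "real^'n::finite \<Rightarrow> 'b::euclidean_space"
  assumes f: "has_weak_partial \<Omega> i f fi" "has_weak_partial \<Omega> j f fj"
    and ff: "has_weak_partial \<Omega> j fi fij" "has_weak_partial \<Omega> i fj fji" and \<Omega>: "open \<Omega>"
  shows "AE x in lebesgue_on \<Omega>. fij x = fji x"
proof -
  have l: "locally_integrable \<Omega> fi" "locally_integrable \<Omega> fji" using f ff by (auto simp: has_weak_partial_def)
  have "has_weak_partial \<Omega> j fi fji"
    unfolding has_weak_partial_iff[OF \<Omega>]
  proof (intro conjI allI impI l)
    fix \<phi> assume \<phi>: "test_function \<Omega> \<phi>"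
    note dd = test_function_partial_deriv[OF \<phi>]
    have "(LINT x|lebesgue. partial_deriv i (partial_deriv j \<phi>) x *\<^sub>R f x) = - (LINT x|lebesgue. partial_deriv j \<phi> x *\<^sub>R fi x)"
      "(LINT x|lebesgue. partial_deriv j (partial_deriv i \<phi>) x *\<^sub>R f x) = - (LINT x|lebesgue. partial_deriv i \<phi> x *\<^sub>R fj x)"
      "(LINT x|lebesgue. partial_deriv i \<phi> x *\<^sub>R fj x) = - (LINT x|lebesgue. \<phi> x *\<^sub>R fji x)"
      using f ff \<phi> dd by (auto simp: has_weak_partial_iff[OF \<Omega>])
    then show "(LINT x|lebesgue. partial_deriv j \<phi> x *\<^sub>R fi x) = - (LINT x|lebesgue. \<phi> x *\<^sub>R fji x)"
      using partial_deriv_commute[OF test_function_smooth[OF \<phi>], of i j] by simp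
  qed
  then show ?thesis by (rule weak_partial_unique[OF ff(1) _ \<Omega>])
qed

section \<open>Product rule, chain rule and null Lagrangian\<close>

lemma tendsto_integral_mult_bounded:
  fixes u :: "real^'n::finite \<Rightarrow> real"
  assumes "\<And>n. integrable lebesgue (u' n)" "integrable lebesgue u"
    and lim: "(\<lambda>n. LINT x|lebesgue. \<bar>u' n x - u x\<bar>) \<longlonglongrightarrow> 0"
    and v: "v \<in> borel_measurable lebesgue" "AE x in lebesgue. \<bar>v x\<bar> \<le> M"
  shows "(\<lambda>n. LINT x|lebesgue. u' n x * v x) \<longlonglongrightarrow> (LINT x|lebesgue. u x * v x)"
proof -
  have iv: "integrable lebesgue (\<lambda>x. h x * v x)" if "integrable lebesgue h" for h :: "real^'n \<Rightarrow> real"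
    by (rule Bochner_Integration.integrable_bound[OF integrable_mult_right[OF that, of M]])
       (use that v in \<open>auto elim!: eventually_mono simp: abs_mult intro!: mult_mono
          simp: mult.commute[of _ "\<bar>v _\<bar>"]\<close>)
  have le: "norm ((LINT x|lebesgue. u' n x * v x) - (LINT x|lebesgue. u x * v x)) \<le> (LINT x|lebesgue. \<bar>u' n x - u x\<bar>) * M" for n
  proof -
    have d: "integrable lebesgue (\<lambda>x. u' n x - u x)" using assms(1,2) by simp
    have "(LINT x|lebesgue. u' n x * v x) - (LINT x|lebesgue. u x * v x) = (LINT x|lebesgue. (u' n x - u x) * v x)"
      unfolding left_diff_distrib by (rule Bochner_Integration.integral_diff[symmetric]) (intro iv assms)+
    also have "norm \<dots> \<le> (LINT x|lebesgue. \<bar>(u' n x - u x) * v x\<bar>)"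
      using integral_abs_bound[of lebesgue "\<lambda>x. (u' n x - u x) * v x"] by simp
    also have "\<dots> \<le> (LINT x|lebesgue. \<bar>u' n x - u x\<bar> * M)"
      by (intro integral_mono_AE integrable_abs iv d integrable_mult_left)
         (use v(2) in \<open>auto elim!: eventually_mono simp: abs_mult intro!: mult_left_mono\<close>)
    finally show ?thesis by simp
  qed
  have "(\<lambda>n. (LINT x|lebesgue. u' n x * v x) - (LINT x|lebesgue. u x * v x)) \<longlonglongrightarrow> 0"
    by (rule Lim_null_comparison[OF always_eventually tendsto_mult_left_zero[OF lim]]) (use le in blast)
  then show ?thesis by (rule LIM_zero_cancel)
qed

text \<open>A bounded sequence that converges in \<open>L\<^sup>1\<close> may be paired with merely integrable functions, at the price of
a subsequence that converges almost everywhere.\<close>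

lemma tendsto_integral_bounded_subseq:
  fixes u :: "real^'n::finite \<Rightarrow> real"
  assumes "\<And>n. integrable lebesgue (u' n)" "integrable lebesgue u"
    and lim: "(\<lambda>n. LINT x|lebesgue. \<bar>u' n x - u x\<bar>) \<longlonglongrightarrow> 0"
    and M: "\<And>n x. \<bar>u' n x\<bar> \<le> M" and h: "integrable lebesgue h"
  obtains r where "strict_mono (r :: nat \<Rightarrow> nat)"
    "(\<lambda>n. LINT x|lebesgue. u' (r n) x * h x) \<longlonglongrightarrow> (LINT x|lebesgue. u x * h x)"
proof -
  obtain r where r: "strict_mono r" "AE x in lebesgue. (\<lambda>n. u' (r n) x - u x) \<longlonglongrightarrow> 0"
    using tendsto_L1_AE_subseq[of lebesgue "\<lambda>n x. u' n x - u x"] assms(1,2) lim by auto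
  have "(\<lambda>n. LINT x|lebesgue. u' (r n) x * h x) \<longlonglongrightarrow> (LINT x|lebesgue. u x * h x)"
  proof (rule integral_dominated_convergence[where w = "\<lambda>x. M * \<bar>h x\<bar>"])
    show "AE x in lebesgue. (\<lambda>n. u' (r n) x * h x) \<longlonglongrightarrow> u x * h x"
      using r(2) by eventually_elim (rule tendsto_mult_right[OF LIM_zero_cancel])
    show "AE x in lebesgue. norm (u' (r n) x * h x) \<le> M * \<bar>h x\<bar>" for n
      by (rule AE_I2) (unfold real_norm_def abs_mult, rule mult_right_mono[OF M abs_ge_zero])
    show "integrable lebesgue (\<lambda>x. M * \<bar>h x\<bar>)" using h by simp
  qed (use assms h in auto)
  with r(1) that show thesis by blast
qed


lemma integral_test_function_indicator:
  fixes v :: "real^'n::finite \<Rightarrow> real"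
  assumes "\<And>x. x \<notin> \<Omega> \<Longrightarrow> u x = 0"
  shows "(LINT x|lebesgue. u x * (indicator \<Omega> x *\<^sub>R v x)) = (LINT x|lebesgue. u x * v x)"
  by (rule Bochner_Integration.integral_cong) (use assms in \<open>auto simp: indicator_def\<close>)

lemma AE_indicator_bounded:
  fixes v :: "real^'n::finite \<Rightarrow> real"
  assumes "AE x in lebesgue_on \<Omega>. \<bar>v x\<bar> \<le> M" "open \<Omega>"
  shows "AE x in lebesgue. \<bar>indicator \<Omega> x *\<^sub>R v x\<bar> \<le> \<bar>M\<bar>"
  using assms(1) unfolding AE_lebesgue_on_iff[OF open_sets_lebesgue[OF assms(2)]]
  by (auto elim!: eventually_mono simp: indicator_def)

text \<open>The derivatives converge in \<open>L\<^sup>1\<close> to the weak derivative of \<open>\<phi> u\<close>, so they may be paired with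
bounded functions.\<close>

lemma mollified_cutoff_derivative_tendsto:
  fixes u v :: "real^'n::finite \<Rightarrow> real"
  assumes \<phi>: "test_function \<Omega> \<phi>" and u: "has_weak_partial \<Omega> i u g"
    and v: "locally_integrable \<Omega> v" "AE x in lebesgue_on \<Omega>. \<bar>v x\<bar> \<le> M" and \<Omega>: "open \<Omega>"
    and t: "\<And>n. test_function \<Omega> (mollify (n + N) (\<lambda>x. \<phi> x * u x))"
  shows "(\<lambda>n. LINT x|lebesgue. partial_deriv i (mollify (n + N) (\<lambda>x. \<phi> x * u x)) x * v x)
      \<longlonglongrightarrow> (LINT x|lebesgue. (\<phi> x * g x + partial_deriv i \<phi> x * u x) * v x)"
proof -
  let ?U = "\<lambda>x. \<phi> x * u x" and ?G = "\<lambda>x. \<phi> x * g x + partial_deriv i \<phi> x * u x"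
    and ?v = "\<lambda>x. indicator \<Omega> x *\<^sub>R v x"
  have l: "locally_integrable \<Omega> u" "locally_integrable \<Omega> g" using u by (auto simp: has_weak_partial_def)
  have iU: "integrable lebesgue ?U" by (rule integrable_test_function_mult[OF \<phi> l(1)])
  have iG: "integrable lebesgue ?G"
    by (intro Bochner_Integration.integrable_add integrable_test_function_mult[OF \<phi> l(2)]
        integrable_test_function_mult[OF test_function_partial_deriv[OF \<phi>] l(1)])
  have d: "partial_deriv i (mollify n ?U) = mollify n ?G" for n
    by (rule partial_deriv_mollify[OF has_weak_partial_cutoff[OF \<phi> u \<Omega>] iU iG])
  have itG: "integrable lebesgue (mollify (n + N) ?G)" for n
    unfolding d[symmetric] by (rule integrable_test_function[OF test_function_partial_deriv[OF t]])
  have "(\<lambda>n. LINT x|lebesgue. mollify (n + N) ?G x * ?v x) \<longlonglongrightarrow> (LINT x|lebesgue. ?G x * ?v x)"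
    by (rule tendsto_integral_mult_bounded[OF itG iG LIMSEQ_ignore_initial_segment[OF mollify_L1[OF iG]]
          locally_integrable_measurable[OF v(1) \<Omega>] AE_indicator_bounded[OF v(2) \<Omega>]])
  also have "(LINT x|lebesgue. ?G x * ?v x) = (LINT x|lebesgue. ?G x * v x)"
    by (rule integral_test_function_indicator)
       (use test_function_outside[OF \<phi>] test_function_outside[OF test_function_partial_deriv[OF \<phi>]] in auto)
  also have "(\<lambda>n. LINT x|lebesgue. mollify (n + N) ?G x * ?v x)
      = (\<lambda>n. LINT x|lebesgue. partial_deriv i (mollify (n + N) ?U) x * v x)"
    unfolding d[symmetric]
    by (rule ext, rule integral_test_function_indicator) (rule test_function_outside[OF test_function_partial_deriv[OF t]])
  finally show ?thesis .
qed

text \<open>In the definition of the weak derivative of \<open>v\<close>, the mollifications of \<open>U = \<phi> u\<close> are admissible test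
functions. They are bounded uniformly, so they may be paired with \<open>h\<close>, and their derivatives converge in \<open>L\<^sup>1\<close>,
so these may be paired with the bounded \<open>v\<close>.\<close>

lemma has_weak_partial_mult:
  fixes u v :: "real^'n::finite \<Rightarrow> real"
  assumes u: "has_weak_partial \<Omega> i u g" "AE x in lebesgue_on \<Omega>. \<bar>u x\<bar> \<le> M"
    and v: "has_weak_partial \<Omega> i v h" "AE x in lebesgue_on \<Omega>. \<bar>v x\<bar> \<le> M'" and \<Omega>: "open \<Omega>"
  shows "has_weak_partial \<Omega> i (\<lambda>x. u x * v x) (\<lambda>x. u x * h x + v x * g x)"
proof -
  have l: "locally_integrable \<Omega> u" "locally_integrable \<Omega> g" "locally_integrable \<Omega> v" "locally_integrable \<Omega> h"
    using u(1) v(1) by (auto simp: has_weak_partial_def)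
  note lm = locally_integrable_mult_bounded[OF locally_integrable_measurable_on[OF l(1) \<Omega>] u(2) _ \<Omega>]
    locally_integrable_mult_bounded[OF locally_integrable_measurable_on[OF l(3) \<Omega>] v(2) _ \<Omega>]
  note lI = lm(1)[OF l(3)] lm(1)[OF l(4)] lm(2)[OF l(2)]
  show ?thesis
    unfolding has_weak_partial_iff[OF \<Omega>]
  proof (intro conjI allI impI lI locally_integrable_add)
    fix \<phi> assume \<phi>: "test_function \<Omega> \<phi>"
    obtain K where K: "compact K" "K \<subseteq> \<Omega>" "\<And>x. x \<notin> K \<Longrightarrow> \<phi> x = 0" "\<And>i x. x \<notin> K \<Longrightarrow> partial_deriv i \<phi> x = 0"
      by (rule test_functionE[OF \<phi>]) (rule that)
    obtain B where B: "B > 0" "\<And>x. \<bar>\<phi> x\<bar> \<le> B" by (rule test_function_bounded[OF \<phi>]) (rule that)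
    define U where "U = (\<lambda>x. \<phi> x * u x)"
    define G where "G = (\<lambda>x. \<phi> x * g x + partial_deriv i \<phi> x * u x)"
    have iU: "integrable lebesgue U" unfolding U_def by (rule integrable_test_function_mult[OF \<phi> l(1)])
    have U0: "\<And>x. x \<notin> K \<Longrightarrow> U x = 0" using K by (auto simp: U_def)
    obtain K' N where KK': "K \<subseteq> K'" and K': "compact K'" "K' \<subseteq> \<Omega>" "\<And>n x. n \<ge> N \<Longrightarrow> x \<notin> K' \<Longrightarrow> mollify n U x = 0"
      "\<And>n. n \<ge> N \<Longrightarrow> test_function \<Omega> (mollify n U)"
      by (rule mollify_eventually_test_function[OF iU K(1,2) _ \<Omega>]) (erule U0, rule that)
    have itU: "integrable lebesgue (mollify (n + N) U)" for n by (rule integrable_test_function[OF K'(4)]) simp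
    \<comment> \<open>unlike \<open>h\<close> this function is integrable on the whole space, and \<open>K'\<close> contains all the supports\<close>
    let ?h = "\<lambda>x. indicator K' x *\<^sub>R h x"
    have ih: "integrable lebesgue ?h"
      using l(4) K'(1,2) integrable_restrict_space[of K' lebesgue h] compact_sets_lebesgue[OF K'(1)]
      by (auto simp: locally_integrable_def simp del: real_scaleR_def)
    have t: "test_function \<Omega> (mollify (n + N) U)" for n by (rule K'(4)) simp
    have parts: "(LINT x|lebesgue. partial_deriv i (mollify (n + N) U) x * v x) = - (LINT x|lebesgue. mollify (n + N) U x * ?h x)" for n
    proof -
      have "(LINT x|lebesgue. partial_deriv i (mollify (n + N) U) x * v x) = - (LINT x|lebesgue. mollify (n + N) U x * h x)"
        using v(1) t by (simp add: has_weak_partial_iff[OF \<Omega>])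
      also have "(LINT x|lebesgue. mollify (n + N) U x * h x) = (LINT x|lebesgue. mollify (n + N) U x * ?h x)"
        by (rule integral_test_function_indicator[symmetric]) (rule K'(3), simp)
      finally show ?thesis .
    qed
    have limG: "(\<lambda>n. LINT x|lebesgue. partial_deriv i (mollify (n + N) U) x * v x) \<longlonglongrightarrow> (LINT x|lebesgue. G x * v x)"
      unfolding U_def G_def
      by (rule mollified_cutoff_derivative_tendsto[OF \<phi> u(1) l(3) v(2) \<Omega>]) (rule t[unfolded U_def])
    have bU: "\<bar>mollify (n + N) U x\<bar> \<le> B * \<bar>M\<bar>" for n x
    proof (rule mollify_bounded[OF iU])
      have "AE x in lebesgue. x \<in> \<Omega> \<longrightarrow> \<bar>u x\<bar> \<le> M" using u(2) by (simp add: AE_lebesgue_on_iff[OF open_sets_lebesgue[OF \<Omega>]])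
      then show "AE x in lebesgue. \<bar>U x\<bar> \<le> B * \<bar>M\<bar>"
      proof eventually_elim
        fix x assume *: "x \<in> \<Omega> \<longrightarrow> \<bar>u x\<bar> \<le> M"
        show "\<bar>U x\<bar> \<le> B * \<bar>M\<bar>"
        proof (cases "x \<in> \<Omega>")
          case True
          then show ?thesis unfolding U_def abs_mult using * B by (intro mult_mono) auto
        qed (use test_function_outside[OF \<phi>] B(1) in \<open>simp add: U_def\<close>)
      qed
    qed
    obtain r where r: "strict_mono (r :: nat \<Rightarrow> nat)"
      "(\<lambda>n. LINT x|lebesgue. mollify (r n + N) U x * ?h x) \<longlonglongrightarrow> (LINT x|lebesgue. U x * ?h x)"
      by (rule tendsto_integral_bounded_subseq[OF itU iU LIMSEQ_ignore_initial_segment[OF mollify_L1[OF iU]] bU ih]) (rule that)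
    have limG': "(\<lambda>n. LINT x|lebesgue. partial_deriv i (mollify (r n + N) U) x * v x) \<longlonglongrightarrow> (LINT x|lebesgue. G x * v x)"
      using LIMSEQ_subseq_LIMSEQ[OF limG r(1)] by (simp add: o_def)
    have "(LINT x|lebesgue. G x * v x) = - (LINT x|lebesgue. U x * ?h x)"
      by (rule LIMSEQ_unique[OF limG']) (simp only: parts tendsto_minus[OF r(2)])
    also have "(LINT x|lebesgue. U x * ?h x) = (LINT x|lebesgue. U x * h x)"
      by (rule integral_test_function_indicator) (use U0 KK' in blast)
    finally have fin: "(LINT x|lebesgue. G x * v x) = - (LINT x|lebesgue. U x * h x)" .
    note j = integrable_test_function_mult[OF \<phi> lI(2)] integrable_test_function_mult[OF \<phi> lI(3)]
      integrable_test_function_mult[OF test_function_partial_deriv[OF \<phi>] lI(1), of i]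
    have "(LINT x|lebesgue. G x * v x) = (LINT x|lebesgue. \<phi> x * (v x * g x) + partial_deriv i \<phi> x * (u x * v x))"
      by (rule Bochner_Integration.integral_cong) (auto simp: G_def algebra_simps)
    also have "\<dots> = (LINT x|lebesgue. \<phi> x * (v x * g x)) + (LINT x|lebesgue. partial_deriv i \<phi> x * (u x * v x))"
      by (rule Bochner_Integration.integral_add[OF j(2,3)])
    finally have "(LINT x|lebesgue. partial_deriv i \<phi> x * (u x * v x)) = - (LINT x|lebesgue. U x * h x) - (LINT x|lebesgue. \<phi> x * (v x * g x))"
      using fin by simp
    moreover have "(LINT x|lebesgue. U x * h x) = (LINT x|lebesgue. \<phi> x * (u x * h x))"
      by (rule Bochner_Integration.integral_cong) (auto simp: U_def)
    moreover have "(LINT x|lebesgue. \<phi> x * (u x * h x + v x * g x)) = (LINT x|lebesgue. \<phi> x * (u x * h x)) + (LINT x|lebesgue. \<phi> x * (v x * g x))"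
      unfolding distrib_left by (rule Bochner_Integration.integral_add[OF j(1,2)])
    ultimately show "(LINT x|lebesgue. partial_deriv i \<phi> x *\<^sub>R (u x * v x)) = - (LINT x|lebesgue. \<phi> x *\<^sub>R (u x * h x + v x * g x))"
      by simp
  qed
qed

lemma has_weak_partial_inner:
  fixes u v :: "real^'n::finite \<Rightarrow> 'b::euclidean_space"
  assumes u: "has_weak_partial \<Omega> i u g" "AE x in lebesgue_on \<Omega>. norm (u x) \<le> M"
    and v: "has_weak_partial \<Omega> i v h" "AE x in lebesgue_on \<Omega>. norm (v x) \<le> M'" and \<Omega>: "open \<Omega>"
  shows "has_weak_partial \<Omega> i (\<lambda>x. u x \<bullet> v x) (\<lambda>x. u x \<bullet> h x + v x \<bullet> g x)"
proof -
  have "has_weak_partial \<Omega> i (\<lambda>x. \<Sum>b\<in>Basis. (u x \<bullet> b) * (v x \<bullet> b)) (\<lambda>x. \<Sum>b\<in>Basis. (u x \<bullet> b) * (h x \<bullet> b) + (v x \<bullet> b) * (g x \<bullet> b))"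
  proof (rule has_weak_partial_sum[OF _ \<Omega>])
    fix b :: 'b assume b: "b \<in> Basis"
    have le: "\<bar>y \<bullet> b\<bar> \<le> r" if "norm y \<le> r" for y r using Basis_le_norm[OF b, of y] that by linarith
    have bd: "AE x in lebesgue_on \<Omega>. \<bar>u x \<bullet> b\<bar> \<le> M" "AE x in lebesgue_on \<Omega>. \<bar>v x \<bullet> b\<bar> \<le> M'"
    proof -
      show "AE x in lebesgue_on \<Omega>. \<bar>u x \<bullet> b\<bar> \<le> M" using u(2) by eventually_elim (erule le)
      show "AE x in lebesgue_on \<Omega>. \<bar>v x \<bullet> b\<bar> \<le> M'" using v(2) by eventually_elim (erule le)
    qed
    show "has_weak_partial \<Omega> i (\<lambda>x. (u x \<bullet> b) * (v x \<bullet> b)) (\<lambda>x. (u x \<bullet> b) * (h x \<bullet> b) + (v x \<bullet> b) * (g x \<bullet> b))"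
      by (rule has_weak_partial_mult[OF has_weak_partial_linear[OF bounded_linear_inner_left u(1) \<Omega>] bd(1)
            has_weak_partial_linear[OF bounded_linear_inner_left v(1) \<Omega>] bd(2) \<Omega>])
  qed
  then show ?thesis by (simp add: euclidean_inner[symmetric] sum.distrib)
qed

lemma has_weak_partial_scaleR:
  fixes v :: "real^'n::finite \<Rightarrow> 'b::euclidean_space" and a :: "real^'n \<Rightarrow> real"
  assumes a: "has_weak_partial \<Omega> i a g" "AE x in lebesgue_on \<Omega>. \<bar>a x\<bar> \<le> M"
    and v: "has_weak_partial \<Omega> i v h" "AE x in lebesgue_on \<Omega>. norm (v x) \<le> M'" and \<Omega>: "open \<Omega>"
  shows "has_weak_partial \<Omega> i (\<lambda>x. a x *\<^sub>R v x) (\<lambda>x. a x *\<^sub>R h x + g x *\<^sub>R v x)"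
proof (rule has_weak_partial_componentwise[OF _ \<Omega>])
  fix b :: 'b assume b: "b \<in> Basis"
  have le: "\<bar>y \<bullet> b\<bar> \<le> r" if "norm y \<le> r" for y r using Basis_le_norm[OF b, of y] that by linarith
  have "AE x in lebesgue_on \<Omega>. \<bar>v x \<bullet> b\<bar> \<le> M'" using v(2) by eventually_elim (erule le)
  from has_weak_partial_mult[OF a has_weak_partial_linear[OF bounded_linear_inner_left v(1) \<Omega>] this \<Omega>]
  show "has_weak_partial \<Omega> i (\<lambda>x. (a x *\<^sub>R v x) \<bullet> b) (\<lambda>x. (a x *\<^sub>R h x + g x *\<^sub>R v x) \<bullet> b)"
    by (simp add: inner_add_left mult.commute)
qed

text \<open>For a test function \<open>W\<close> in place of \<open>\<phi> m\<close> both sides are \<open>- \<integral> f \<partial>\<^sub>i\<partial>\<^sub>jW\<close>. In general mollify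
\<open>\<phi> m\<close>: its derivatives converge in \<open>L\<^sup>1\<close>, while those of \<open>f\<close> are bounded.\<close>

lemma weak_jacobian_null_lagrangian:
  fixes f m :: "real^'n::finite \<Rightarrow> real"
  assumes f: "has_weak_partial \<Omega> i f fi" "has_weak_partial \<Omega> j f fj"
    and bd: "AE x in lebesgue_on \<Omega>. \<bar>fi x\<bar> \<le> M" "AE x in lebesgue_on \<Omega>. \<bar>fj x\<bar> \<le> M"
    and m: "has_weak_partial \<Omega> i m mi" "has_weak_partial \<Omega> j m mj"
    and \<Omega>: "open \<Omega>" and \<phi>: "test_function \<Omega> \<phi>"
  shows "(LINT x|lebesgue. (\<phi> x * mi x + partial_deriv i \<phi> x * m x) * fj x)
       = (LINT x|lebesgue. (\<phi> x * mj x + partial_deriv j \<phi> x * m x) * fi x)"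
proof -
  have l: "locally_integrable \<Omega> f" "locally_integrable \<Omega> fi" "locally_integrable \<Omega> fj"
    "locally_integrable \<Omega> m" "locally_integrable \<Omega> mi" "locally_integrable \<Omega> mj"
    using f m by (auto simp: has_weak_partial_def)
  obtain K where K: "compact K" "K \<subseteq> \<Omega>" "\<And>x. x \<notin> K \<Longrightarrow> \<phi> x = 0" "\<And>i x. x \<notin> K \<Longrightarrow> partial_deriv i \<phi> x = 0"
    by (rule test_functionE[OF \<phi>]) (rule that)
  define W where "W = (\<lambda>x. \<phi> x * m x)"
  have iW: "integrable lebesgue W" unfolding W_def by (rule integrable_test_function_mult[OF \<phi> l(4)])
  obtain K' N where K': "compact K'" "K \<subseteq> K'" "K' \<subseteq> \<Omega>" "\<And>n x. n \<ge> N \<Longrightarrow> x \<notin> K' \<Longrightarrow> mollify n W x = 0"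
    "\<And>n. n \<ge> N \<Longrightarrow> test_function \<Omega> (mollify n W)"
    by (rule mollify_eventually_test_function[OF iW K(1,2) _ \<Omega>]) (use K(3) in \<open>simp add: W_def\<close>, rule that)
  have t: "test_function \<Omega> (mollify (n + N) W)" for n by (rule K'(5)) simp
  note lim = mollified_cutoff_derivative_tendsto[OF \<phi> _ _ _ \<Omega> t[unfolded W_def], folded W_def]
  have "(LINT x|lebesgue. partial_deriv i (mollify (n + N) W) x * fj x) = (LINT x|lebesgue. partial_deriv j (mollify (n + N) W) x * fi x)" for n
  proof -
    let ?t = "mollify (n + N) W"
    have "(LINT x|lebesgue. partial_deriv j (partial_deriv i ?t) x * f x) = - (LINT x|lebesgue. partial_deriv i ?t x * fj x)"
      using f(2) test_function_partial_deriv[OF t[of n], of i] by (simp add: has_weak_partial_iff[OF \<Omega>])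
    moreover have "(LINT x|lebesgue. partial_deriv i (partial_deriv j ?t) x * f x) = - (LINT x|lebesgue. partial_deriv j ?t x * fi x)"
      using f(1) test_function_partial_deriv[OF t[of n], of j] by (simp add: has_weak_partial_iff[OF \<Omega>])
    ultimately show ?thesis unfolding partial_deriv_commute[OF test_function_smooth[OF t], of j i] by simp
  qed
  with lim[OF m(1) l(3) bd(2)] lim[OF m(2) l(2) bd(1)] show ?thesis
    by (simp add: LIMSEQ_unique)
qed

lemma poly_bounded_on_interval: "\<exists>M. \<forall>y\<in>{a..b::real}. \<bar>poly p y\<bar> \<le> M"
proof -
  have "bounded (poly p ` {a..b})"
    by (intro compact_imp_bounded compact_continuous_image continuous_intros) auto
  then show ?thesis by (auto simp: bounded_iff)
qed

lemma has_weak_partial_poly: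
  fixes s :: "real^'n::finite \<Rightarrow> real"
  assumes s: "has_weak_partial \<Omega> i s t" and ab: "AE x in lebesgue_on \<Omega>. s x \<in> {a..b}" and \<Omega>: "open \<Omega>"
  shows "has_weak_partial \<Omega> i (\<lambda>x. poly p (s x)) (\<lambda>x. poly (pderiv p) (s x) * t x)"
proof (induction p)
  case 0
  then show ?case using has_weak_partial_const[OF \<Omega>, of i 0] by simp
next
  case (pCons c p)
  obtain M where M: "\<forall>y\<in>{a..b}. \<bar>poly p y\<bar> \<le> M" using poly_bounded_on_interval by blast
  have b1: "AE x in lebesgue_on \<Omega>. \<bar>poly p (s x)\<bar> \<le> M" using ab by eventually_elim (use M in blast)
  have b2: "AE x in lebesgue_on \<Omega>. \<bar>s x\<bar> \<le> max \<bar>a\<bar> \<bar>b\<bar>" using ab by eventually_elim auto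
  have "has_weak_partial \<Omega> i (\<lambda>x. c + s x * poly p (s x)) (\<lambda>x. 0 + (s x * (poly (pderiv p) (s x) * t x) + poly p (s x) * t x))"
    by (rule has_weak_partial_add[OF has_weak_partial_const[OF \<Omega>] has_weak_partial_mult[OF s b2 pCons.IH b1 \<Omega>] \<Omega>])
  then show ?case by (simp add: pderiv_pCons algebra_simps)
qed

lemma pderiv_sum: "pderiv (sum f A) = (\<Sum>x\<in>A. pderiv (f x))"
  by (induction A rule: infinite_finite_induct) (auto simp: pderiv_add)

text \<open>Integrate a uniform polynomial approximation of the derivative.\<close>

lemma polynomial_C1_approximation:
  fixes G G' :: "real \<Rightarrow> real"
  assumes G: "\<And>y. y \<in> {a..b} \<Longrightarrow> (G has_real_derivative G' y) (at y)" "continuous_on {a..b} G'"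
    and "a \<le> b" "e > 0"
  obtains p where "\<And>y. y \<in> {a..b} \<Longrightarrow> \<bar>G y - poly p y\<bar> \<le> e * (b - a)"
    "\<And>y. y \<in> {a..b} \<Longrightarrow> \<bar>G' y - poly (pderiv p) y\<bar> \<le> e"
proof -
  obtain g where g: "real_polynomial_function g" "\<And>x. x \<in> {a..b} \<Longrightarrow> \<bar>G' x - g x\<bar> < e"
    by (rule Stone_Weierstrass_real_polynomial_function[OF compact_Icc G(2) \<open>e > 0\<close>]) (rule that)
  obtain c n where gc: "g = (\<lambda>x. \<Sum>i\<le>n. c i * x ^ i)"
    using g(1) unfolding real_polynomial_function_iff_sum by blast
  \<comment> \<open>an antiderivative of \<open>g\<close>, later shifted by a constant to agree with \<open>G\<close> at \<open>a\<close>\<close>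
  define q where "q = (\<Sum>i\<le>n. monom (c i / real (Suc i)) (Suc i))"
  have "pderiv q = (\<Sum>i\<le>n. monom (c i) i)"
    by (simp add: q_def pderiv_sum pderiv_monom del: of_nat_Suc)
  then have q: "poly (pderiv q) y = g y" for y by (simp add: gc poly_sum poly_monom)
  define p where "p = q + [:G a - poly q a:]"
  have p': "poly (pderiv p) y = g y" for y using q by (simp add: p_def pderiv_add pderiv_pCons)
  have pa: "poly p a = G a" by (simp add: p_def)
  have "\<bar>G y - poly p y\<bar> \<le> e * (b - a)" if y: "y \<in> {a..b}" for y
  proof -
    have "norm ((G y - poly p y) - (G a - poly p a)) \<le> e * norm (y - a)"
    proof (rule field_differentiable_bound[of "{a..b}"])
      fix z assume z: "z \<in> {a..b}"
      show "((\<lambda>y. G y - poly p y) has_field_derivative G' z - g z) (at z within {a..b})"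
        by (rule DERIV_subset[OF DERIV_diff[OF G(1)[OF z] poly_DERIV[of p z, unfolded p']]]) simp
      show "norm (G' z - g z) \<le> e" using g(2)[OF z] by simp
    qed (use y \<open>a \<le> b\<close> in auto)
    also have "\<dots> \<le> e * (b - a)" using y \<open>e > 0\<close> by (intro mult_left_mono) auto
    finally show ?thesis by (simp add: pa)
  qed
  moreover have "\<bar>G' y - poly (pderiv p) y\<bar> \<le> e" if "y \<in> {a..b}" for y
    using g(2)[OF that] by (simp add: p')
  ultimately show thesis using that by blast
qed

lemma eq_0_if_abs_le_epsilon:
  fixes E C :: real
  assumes "\<And>e. e > 0 \<Longrightarrow> \<bar>E\<bar> \<le> e * C"
  shows "E = 0"
proof (rule ccontr)
  assume E: "E \<noteq> 0"
  have C: "C > 0" using assms[of 1] E by simp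
  have "\<bar>E\<bar> \<le> \<bar>E\<bar> / (2 * C) * C" by (rule assms) (use E C in simp)
  also have "\<dots> = \<bar>E\<bar> / 2" using C by simp
  finally show False using E by simp
qed

text \<open>The product rule covers polynomials, and polynomials approximate \<open>G\<close> in \<open>C\<^sup>1\<close> on the compact interval that
contains almost all values of \<open>s\<close>.\<close>

lemma has_weak_partial_chain:
  fixes s :: "real^'n::finite \<Rightarrow> real" and G G' :: "real \<Rightarrow> real"
  assumes s: "has_weak_partial \<Omega> i s t" and ab: "AE x in lebesgue_on \<Omega>. s x \<in> {a..b}" "a \<le> b" and \<Omega>: "open \<Omega>"
    and G: "\<And>y. y \<in> {a..b} \<Longrightarrow> (G has_real_derivative G' y) (at y)" "continuous_on {a..b} G'"
    and m: "G \<in> borel_measurable borel" "G' \<in> borel_measurable borel"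
  shows "has_weak_partial \<Omega> i (\<lambda>x. G (s x)) (\<lambda>x. G' (s x) * t x)"
proof -
  have l: "locally_integrable \<Omega> s" "locally_integrable \<Omega> t" using s by (auto simp: has_weak_partial_def)
  have ms: "s \<in> borel_measurable (lebesgue_on \<Omega>)" by (rule locally_integrable_measurable_on[OF l(1) \<Omega>])
  have cG: "continuous_on {a..b} G"
    using G(1) by (meson DERIV_isCont continuous_at_imp_continuous_on)
  have "\<exists>M. \<forall>y\<in>{a..b}. \<bar>G y\<bar> \<le> M"
    using compact_imp_bounded[OF compact_continuous_image[OF cG compact_Icc]] by (auto simp: bounded_iff)
  then obtain M where M: "\<And>y. y \<in> {a..b} \<Longrightarrow> \<bar>G y\<bar> \<le> M" by blast
  have "\<exists>M. \<forall>y\<in>{a..b}. \<bar>G' y\<bar> \<le> M"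
    using compact_imp_bounded[OF compact_continuous_image[OF G(2) compact_Icc]] by (auto simp: bounded_iff)
  then obtain M' where M': "\<And>y. y \<in> {a..b} \<Longrightarrow> \<bar>G' y\<bar> \<le> M'" by blast
  have lG: "locally_integrable \<Omega> (\<lambda>x. G (s x))"
  proof -
    have "AE x in lebesgue_on \<Omega>. \<bar>G (s x)\<bar> \<le> M" using ab(1) by eventually_elim (rule M)
    from locally_integrable_mult_bounded[OF measurable_compose[OF ms m(1)] this locally_integrable_const[of \<Omega> 1] \<Omega>]
    show ?thesis by simp
  qed
  have lG': "locally_integrable \<Omega> (\<lambda>x. G' (s x) * t x)"
  proof (rule locally_integrable_mult_bounded[OF measurable_compose[OF ms m(2)] _ l(2) \<Omega>])
    show "AE x in lebesgue_on \<Omega>. \<bar>G' (s x)\<bar> \<le> M'" using ab(1) by eventually_elim (rule M')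
  qed
  show ?thesis
    unfolding has_weak_partial_iff[OF \<Omega>]
  proof (intro conjI allI impI lG lG')
    fix \<phi> assume \<phi>: "test_function \<Omega> \<phi>"
    note d\<phi> = test_function_partial_deriv[OF \<phi>, of i]
    \<comment> \<open>the defect in the integration by parts formula; it vanishes for polynomials in place of \<open>G\<close>\<close>
    let ?E = "(LINT x|lebesgue. partial_deriv i \<phi> x * G (s x)) + (LINT x|lebesgue. \<phi> x * (G' (s x) * t x))"
    let ?A = "LINT x|lebesgue. \<bar>partial_deriv i \<phi> x\<bar>" and ?B = "LINT x|lebesgue. \<bar>\<phi> x * t x\<bar>"
    have iA: "integrable lebesgue (\<lambda>x. \<bar>partial_deriv i \<phi> x\<bar>)" by (intro integrable_abs integrable_test_function[OF d\<phi>])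
    have iB: "integrable lebesgue (\<lambda>x. \<bar>\<phi> x * t x\<bar>)" by (intro integrable_abs integrable_test_function_mult[OF \<phi> l(2)])
    have ab': "AE x in lebesgue. x \<in> \<Omega> \<longrightarrow> s x \<in> {a..b}" using ab(1) unfolding AE_lebesgue_on_iff[OF open_sets_lebesgue[OF \<Omega>]] .
    have est: "\<bar>?E\<bar> \<le> e * ((b - a) * ?A + ?B)" if e: "e > 0" for e
    proof -
      obtain p where p: "\<And>y. y \<in> {a..b} \<Longrightarrow> \<bar>G y - poly p y\<bar> \<le> e * (b - a)"
        "\<And>y. y \<in> {a..b} \<Longrightarrow> \<bar>G' y - poly (pderiv p) y\<bar> \<le> e"
        by (rule polynomial_C1_approximation[OF G ab(2) e]) (assumption | rule that)+
      have w: "has_weak_partial \<Omega> i (\<lambda>x. poly p (s x)) (\<lambda>x. poly (pderiv p) (s x) * t x)"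
        by (rule has_weak_partial_poly[OF s ab(1) \<Omega>])
      then have lp: "locally_integrable \<Omega> (\<lambda>x. poly p (s x))" "locally_integrable \<Omega> (\<lambda>x. poly (pderiv p) (s x) * t x)"
        by (auto simp: has_weak_partial_def)
      note j = integrable_test_function_mult[OF d\<phi> lG] integrable_test_function_mult[OF d\<phi> lp(1)]
        integrable_test_function_mult[OF \<phi> lG'] integrable_test_function_mult[OF \<phi> lp(2)]
      have "(LINT x|lebesgue. partial_deriv i \<phi> x * poly p (s x)) + (LINT x|lebesgue. \<phi> x * (poly (pderiv p) (s x) * t x)) = 0"
        using w \<phi> by (simp add: has_weak_partial_iff[OF \<Omega>])
      then have E: "?E = (LINT x|lebesgue. partial_deriv i \<phi> x * G (s x) - partial_deriv i \<phi> x * poly p (s x))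
         + (LINT x|lebesgue. \<phi> x * (G' (s x) * t x) - \<phi> x * (poly (pderiv p) (s x) * t x))"
        unfolding Bochner_Integration.integral_diff[OF j(1,2)] Bochner_Integration.integral_diff[OF j(3,4)] by linarith
      have 1: "\<bar>LINT x|lebesgue. partial_deriv i \<phi> x * G (s x) - partial_deriv i \<phi> x * poly p (s x)\<bar> \<le> (LINT x|lebesgue. \<bar>partial_deriv i \<phi> x\<bar> * (e * (b - a)))"
      proof (rule order_trans[OF integral_abs_bound integral_mono_AE])
        show "integrable lebesgue (\<lambda>x. \<bar>partial_deriv i \<phi> x * G (s x) - partial_deriv i \<phi> x * poly p (s x)\<bar>)"
          using j(1,2) by auto
        show "integrable lebesgue (\<lambda>x. \<bar>partial_deriv i \<phi> x\<bar> * (e * (b - a)))" using iA by auto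
        show "AE x in lebesgue. \<bar>partial_deriv i \<phi> x * G (s x) - partial_deriv i \<phi> x * poly p (s x)\<bar> \<le> \<bar>partial_deriv i \<phi> x\<bar> * (e * (b - a))"
          using ab'
        proof eventually_elim
          fix x assume *: "x \<in> \<Omega> \<longrightarrow> s x \<in> {a..b}"
          show "\<bar>partial_deriv i \<phi> x * G (s x) - partial_deriv i \<phi> x * poly p (s x)\<bar> \<le> \<bar>partial_deriv i \<phi> x\<bar> * (e * (b - a))"
          proof (cases "x \<in> \<Omega>")
            case True
            then show ?thesis unfolding right_diff_distrib[symmetric] abs_mult using * p(1) by (intro mult_left_mono) auto
          qed (simp add: test_function_outside[OF d\<phi>])
        qed
      qed
      have 2: "\<bar>LINT x|lebesgue. \<phi> x * (G' (s x) * t x) - \<phi> x * (poly (pderiv p) (s x) * t x)\<bar> \<le> (LINT x|lebesgue. \<bar>\<phi> x * t x\<bar> * e)"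
      proof (rule order_trans[OF integral_abs_bound integral_mono_AE])
        show "integrable lebesgue (\<lambda>x. \<bar>\<phi> x * (G' (s x) * t x) - \<phi> x * (poly (pderiv p) (s x) * t x)\<bar>)"
          using j(3,4) by auto
        show "integrable lebesgue (\<lambda>x. \<bar>\<phi> x * t x\<bar> * e)" using iB by auto
        show "AE x in lebesgue. \<bar>\<phi> x * (G' (s x) * t x) - \<phi> x * (poly (pderiv p) (s x) * t x)\<bar> \<le> \<bar>\<phi> x * t x\<bar> * e"
          using ab'
        proof eventually_elim
          fix x assume *: "x \<in> \<Omega> \<longrightarrow> s x \<in> {a..b}"
          have eq: "\<phi> x * (G' (s x) * t x) - \<phi> x * (poly (pderiv p) (s x) * t x) = (\<phi> x * t x) * (G' (s x) - poly (pderiv p) (s x))"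
            by (simp add: algebra_simps)
          show "\<bar>\<phi> x * (G' (s x) * t x) - \<phi> x * (poly (pderiv p) (s x) * t x)\<bar> \<le> \<bar>\<phi> x * t x\<bar> * e"
          proof (cases "x \<in> \<Omega>")
            case True
            show ?thesis unfolding eq abs_mult[of "\<phi> x * t x"] using * p(2) True by (intro mult_left_mono) auto
          qed (simp add: test_function_outside[OF \<phi>])
        qed
      qed
      have "\<bar>?E\<bar> \<le> ?A * (e * (b - a)) + ?B * e" using 1 2 unfolding E by simp
      then show ?thesis by (simp add: algebra_simps)
    qed
    have "?E = 0"
      by (rule eq_0_if_abs_le_epsilon) (rule est)
    then show "(LINT x|lebesgue. partial_deriv i \<phi> x *\<^sub>R G (s x)) = - (LINT x|lebesgue. \<phi> x *\<^sub>R (G' (s x) * t x))" by simp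
  qed
qed

section \<open>Vanishing weak gradient and localisation\<close>

text \<open>Near \<open>K\<close> the mollifications of \<open>f\<close>, cut off far from \<open>K\<close>, have vanishing gradient, so they are constant on
the convex set \<open>K\<close>; a subsequence converges almost everywhere to \<open>f\<close>.\<close>

lemma weak_gradient_zero_on_compact:
  fixes f :: "real^'n::finite \<Rightarrow> real"
  assumes f: "\<And>i. has_weak_partial \<Omega> i f (\<lambda>x. 0)" and \<Omega>: "open \<Omega>" and K: "compact K" "convex K" "K \<subseteq> \<Omega>"
  shows "\<exists>c. AE x in lebesgue. x \<in> K \<longrightarrow> f x = c"
proof -
  have l: "locally_integrable \<Omega> f" using f by (auto simp: has_weak_partial_def)
  obtain \<eta> V where \<eta>: "test_function \<Omega> \<eta>" "open V" "K \<subseteq> V" "V \<subseteq> \<Omega>" "\<And>x. x \<in> V \<Longrightarrow> \<eta> x = 1"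
    by (rule cutoff_function_exists[OF K(1,3) \<Omega>]) (rule that)
  obtain d where d: "d > 0" "(\<Union>x\<in>K. cball x d) \<subseteq> V"
    using compact_subset_open_imp_cball_epsilon_subset[OF K(1) \<eta>(2,3)] by blast
  obtain N where N: "inverse (real (Suc N)) < d" using d(1) reals_Archimedean by blast
  define W where "W = (\<lambda>x. \<eta> x * f x)"
  have iW: "integrable lebesgue W" unfolding W_def by (rule integrable_test_function_mult[OF \<eta>(1) l])
  have dW: "partial_deriv i (mollify n W) x = 0" if "x \<in> K" "n \<ge> N" for i x n
  proof -
    let ?G = "\<lambda>x. partial_deriv i \<eta> x * f x"
    have iG: "integrable lebesgue ?G" by (rule integrable_test_function_mult[OF test_function_partial_deriv[OF \<eta>(1)] l])
    have w: "has_weak_partial UNIV i W ?G"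
      using has_weak_partial_cutoff[OF \<eta>(1) f \<Omega>] by (simp add: W_def)
    have "inverse (real (Suc n)) \<le> inverse (real (Suc N))" using that(2) by (intro le_imp_inverse_le) auto
    then have n: "inverse (real (Suc n)) \<le> d" using N by linarith
    have "mollify n ?G x = 0"
    proof (rule mollify_eq_0)
      fix y assume "norm (x - y) \<le> inverse (real (Suc n))"
      then have "y \<in> cball x d" using n by (simp add: dist_norm)
      then have y: "y \<in> V" using d(2) that(1) by blast
      then show "partial_deriv i \<eta> y * f y = 0"
        using partial_deriv_eq_0_if_constant[OF \<eta>(2) y, of \<eta> 1] \<eta>(5) by simp
    qed
    then show ?thesis unfolding partial_deriv_mollify[OF w iW iG] .
  qed
  have "\<exists>c. \<forall>x\<in>K. mollify n W x = c" if "n \<ge> N" for n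
  proof (rule has_derivative_zero_constant[OF K(2)])
    fix x assume x: "x \<in> K"
    have "smooth (mollify n W)" unfolding mollify_def by (rule smooth_convolution[OF test_function_mollifier iW])
    then have "(mollify n W has_derivative (\<lambda>v. \<Sum>i\<in>UNIV. v $ i * partial_deriv i (mollify n W) x)) (at x)"
      by (intro has_derivative_partial_deriv smooth_differentiable)
    then have "(mollify n W has_derivative (\<lambda>v. 0)) (at x)" using dW[OF x that] by simp
    then show "(mollify n W has_derivative (\<lambda>h. 0)) (at x within K)" by (rule has_derivative_at_withinI)
  qed
  then have "\<exists>c. n \<ge> N \<longrightarrow> (\<forall>x\<in>K. mollify n W x = c)" for n by blast
  then obtain c where "\<And>n. n \<ge> N \<longrightarrow> (\<forall>x\<in>K. mollify n W x = c n)" by metis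
  then have c: "\<And>n x. n \<ge> N \<Longrightarrow> x \<in> K \<Longrightarrow> mollify n W x = c n" by blast
  obtain KK where KK: "compact KK" "KK \<subseteq> \<Omega>" "\<And>x. x \<notin> KK \<Longrightarrow> \<eta> x = 0" using \<eta>(1) by (auto simp: test_function_def)
  obtain M where M: "\<And>n. n \<ge> M \<Longrightarrow> test_function \<Omega> (mollify n W)"
    by (rule mollify_eventually_test_function[OF iW KK(1,2) _ \<Omega>]) (use KK(3) in \<open>simp add: W_def\<close>, rule that)
  have "integrable lebesgue (mollify (n + (M + N)) W)" for n by (rule integrable_test_function[OF M]) simp
  then obtain r where r: "strict_mono r" "AE x in lebesgue. (\<lambda>n. mollify (r n + (M + N)) W x - W x) \<longlonglongrightarrow> 0"
    using tendsto_L1_AE_subseq[of lebesgue "\<lambda>n x. mollify (n + (M + N)) W x - W x"] iW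
      LIMSEQ_ignore_initial_segment[OF mollify_L1[OF iW], of "M + N"] by auto
  have W: "W x = f x" if "x \<in> K" for x using \<eta>(3,5) that by (auto simp: W_def)
  have lim: "(\<lambda>n. c (r n + (M + N))) \<longlonglongrightarrow> f x" if "x \<in> K" "(\<lambda>n. mollify (r n + (M + N)) W x - W x) \<longlonglongrightarrow> 0" for x
    using LIM_zero_cancel[OF that(2)] W[OF that(1)] c[OF _ that(1)] by simp
  show ?thesis
  proof (cases "\<exists>x\<in>K. (\<lambda>n. mollify (r n + (M + N)) W x - W x) \<longlonglongrightarrow> 0")
    case True
    then obtain z where z: "z \<in> K" "(\<lambda>n. mollify (r n + (M + N)) W z - W z) \<longlonglongrightarrow> 0" by blast
    from r(2) have "AE x in lebesgue. x \<in> K \<longrightarrow> f x = f z"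
      by eventually_elim (use lim[OF z] lim LIMSEQ_unique in blast)
    then show ?thesis by blast
  next
    case False
    from r(2) have "AE x in lebesgue. x \<in> K \<longrightarrow> f x = 0" by eventually_elim (use False in blast)
    then show ?thesis by blast
  qed
qed

text \<open>The constants belonging to the convex hulls of an exhaustion eventually agree, because these hulls
have a common ball.\<close>

lemma weak_gradient_zero_imp_constant_real:
  fixes f :: "real^'n::finite \<Rightarrow> real"
  assumes f: "\<And>i. has_weak_partial \<Omega> i f (\<lambda>x. 0)" and \<Omega>: "open \<Omega>" "convex \<Omega>"
  shows "\<exists>c. AE x in lebesgue_on \<Omega>. f x = c"
proof (cases "\<Omega> = {}")
  case True
  then show ?thesis by (simp add: AE_lebesgue_on_iff)
next
  case False
  obtain C where C: "\<forall>n. compact (C n)" "\<forall>n. C n \<subseteq> \<Omega>" "\<forall>n. C n \<subseteq> C (Suc n)" "\<forall>x\<in>\<Omega>. \<exists>n. x \<in> C n"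
    "\<forall>K. compact K \<longrightarrow> K \<subseteq> \<Omega> \<longrightarrow> (\<exists>N::nat. \<forall>n\<ge>N. K \<subseteq> C n)"
    using compact_exhaustion[OF \<Omega>(1)] by (elim exE conjE) (rule that)
  have "\<exists>c. AE x in lebesgue. x \<in> convex hull (C n) \<longrightarrow> f x = c" for n
    by (rule weak_gradient_zero_on_compact[OF f \<Omega>(1)])
       (use C(1,2) \<Omega>(2) in \<open>auto simp: compact_convex_hull hull_minimal convex_convex_hull subset_hull\<close>)
  then obtain c where c: "\<And>n. AE x in lebesgue. x \<in> convex hull (C n) \<longrightarrow> f x = c n" by metis
  obtain z where "z \<in> \<Omega>" using False by blast
  then obtain r where r: "r > 0" "cball z r \<subseteq> \<Omega>" using \<Omega>(1) open_contains_cball by blast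
  obtain N where N: "\<And>n. n \<ge> N \<Longrightarrow> cball z r \<subseteq> C n" using C(5)[rule_format, OF compact_cball r(2)] by blast
  have cN: "c n = c N" if n: "n \<ge> N" for n
  proof -
    have "AE x in lebesgue. (x \<in> convex hull (C n) \<longrightarrow> f x = c n) \<and> (x \<in> convex hull (C N) \<longrightarrow> f x = c N)"
      using c[of n] c[of N] by eventually_elim blast
    then have "\<exists>x\<in>ball z r. (x \<in> convex hull (C n) \<longrightarrow> f x = c n) \<and> (x \<in> convex hull (C N) \<longrightarrow> f x = c N)"
      by (rule AE_lebesgue_open_ex) (use r(1) in auto)
    then obtain x where x: "x \<in> ball z r" "x \<in> convex hull (C n) \<longrightarrow> f x = c n" "x \<in> convex hull (C N) \<longrightarrow> f x = c N"
      by blast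
    have "x \<in> C n" "x \<in> C N" using N[OF n] N[of N] x(1) by (auto simp: subset_iff)
    then show ?thesis using x(2,3) hull_inc[of x _ convex] by auto
  qed
  have "AE x in lebesgue. \<forall>n. x \<in> convex hull (C n) \<longrightarrow> f x = c n" unfolding AE_all_countable using c by (rule allI)
  then have "AE x in lebesgue. x \<in> \<Omega> \<longrightarrow> f x = c N"
  proof eventually_elim
    fix x assume *: "\<forall>n. x \<in> convex hull (C n) \<longrightarrow> f x = c n"
    show "x \<in> \<Omega> \<longrightarrow> f x = c N"
    proof
      assume "x \<in> \<Omega>"
      then obtain N' where "\<forall>n\<ge>N'. {x} \<subseteq> C n" using C(5)[rule_format, of "{x}"] by auto
      then have "x \<in> C (max N N')" by auto
      then have "f x = c (max N N')" using * hull_inc[of x _ convex] by blast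
      then show "f x = c N" using cN[of "max N N'"] by simp
    qed
  qed
  then show ?thesis using \<Omega>(1) by (auto simp: AE_lebesgue_on_iff)
qed

lemma weak_gradient_zero_imp_constant:
  fixes f :: "real^'n::finite \<Rightarrow> 'b::euclidean_space"
  assumes f: "\<And>i. has_weak_partial \<Omega> i f (\<lambda>x. 0)" and \<Omega>: "open \<Omega>" "convex \<Omega>"
  shows "\<exists>c. AE x in lebesgue_on \<Omega>. f x = c"
proof -
  have "\<exists>c. AE x in lebesgue_on \<Omega>. f x \<bullet> b = c" for b
    using has_weak_partial_linear[OF bounded_linear_inner_left[of b] f \<Omega>(1)]
    by (intro weak_gradient_zero_imp_constant_real[OF _ \<Omega>]) simp
  then obtain c where c: "\<And>b. AE x in lebesgue_on \<Omega>. f x \<bullet> b = c b" by metis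
  then have "AE x in lebesgue_on \<Omega>. \<forall>b\<in>Basis. f x \<bullet> b = c b" by (simp add: AE_finite_all)
  then have "AE x in lebesgue_on \<Omega>. f x = (\<Sum>b\<in>Basis. c b *\<^sub>R b)"
  proof eventually_elim
    fix x assume "\<forall>b\<in>Basis. f x \<bullet> b = c b"
    then have "(\<Sum>b\<in>Basis. c b *\<^sub>R b) = (\<Sum>b\<in>Basis. (f x \<bullet> b) *\<^sub>R b)" by (intro sum.cong) auto
    then show "f x = (\<Sum>b\<in>Basis. c b *\<^sub>R b)" by (simp only: euclidean_representation)
  qed
  then show ?thesis by blast
qed

text \<open>The local derivatives agree almost everywhere where they overlap, so they can be glued along a countable
open cover by using, at each point, the first set of the cover that contains it.\<close>

lemma has_weak_partial_locally:
  fixes f :: "real^'n::finite \<Rightarrow> real"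
  assumes l: "locally_integrable \<Omega> f" and \<Omega>: "open \<Omega>"
    and loc: "\<And>\<eta>. test_function \<Omega> \<eta> \<Longrightarrow> \<exists>w. has_weak_partial UNIV i (\<lambda>x. \<eta> x * f x) w"
  shows "\<exists>g. has_weak_partial \<Omega> i f g"
proof -
  obtain C where C: "\<forall>n. compact (C n)" "\<forall>n. C n \<subseteq> \<Omega>" "\<forall>n. C n \<subseteq> C (Suc n)" "\<forall>x\<in>\<Omega>. \<exists>n. x \<in> C n"
    "\<forall>K. compact K \<longrightarrow> K \<subseteq> \<Omega> \<longrightarrow> (\<exists>N::nat. \<forall>n\<ge>N. K \<subseteq> C n)"
    using compact_exhaustion[OF \<Omega>(1)] by (elim exE conjE) (rule that)
  have "\<exists>V w. open V \<and> C n \<subseteq> V \<and> V \<subseteq> \<Omega> \<and> has_weak_partial V i f w" for n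
  proof -
    obtain \<eta> V where \<eta>: "test_function \<Omega> \<eta>" "open V" "C n \<subseteq> V" "V \<subseteq> \<Omega>" "\<And>x. x \<in> V \<Longrightarrow> \<eta> x = 1"
      by (rule cutoff_function_exists[OF C(1)[rule_format] C(2)[rule_format] \<Omega>]) (rule that)
    obtain w where "has_weak_partial UNIV i (\<lambda>x. \<eta> x * f x) w" using loc[OF \<eta>(1)] by blast
    then have "has_weak_partial V i (\<lambda>x. \<eta> x * f x) w" by (rule has_weak_partial_subset) (use \<eta>(2) in auto)
    then have "has_weak_partial V i f w"
      by (rule has_weak_partial_cong_AE) (use \<eta>(2,5) in \<open>auto simp: AE_lebesgue_on_iff\<close>)
    with \<eta>(2,3,4) show ?thesis by blast
  qed
  then obtain V w where V: "\<And>n. open (V n)" "\<And>n. C n \<subseteq> V n" "\<And>n. V n \<subseteq> \<Omega>" and w: "\<And>n. has_weak_partial (V n) i f (w n)"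
    by metis
  \<comment> \<open>the value of the first local derivative that is available at \<open>x\<close>\<close>
  define g where "g x = w (LEAST n. x \<in> V n) x" for x
  have "AE x in lebesgue. x \<in> V m \<inter> V n \<longrightarrow> w m x = w n x" for m n
  proof -
    have o: "open (V m \<inter> V n)" using V(1) by blast
    have "AE x in lebesgue_on (V m \<inter> V n). w m x = w n x"
      by (rule weak_partial_unique[OF has_weak_partial_subset[OF w _ V(1) o] has_weak_partial_subset[OF w _ V(1) o] o]) auto
    then show ?thesis using o by (simp add: AE_lebesgue_on_iff)
  qed
  then have "AE x in lebesgue. \<forall>m n. x \<in> V m \<inter> V n \<longrightarrow> w m x = w n x"
    unfolding AE_all_countable by (intro allI)
  then have "AE x in lebesgue. \<forall>n. x \<in> V n \<longrightarrow> w n x = g x"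
  proof eventually_elim
    fix x assume *: "\<forall>m n. x \<in> V m \<inter> V n \<longrightarrow> w m x = w n x"
    show "\<forall>n. x \<in> V n \<longrightarrow> w n x = g x"
    proof (intro allI impI)
      fix n assume n: "x \<in> V n"
      then have "x \<in> V (LEAST n. x \<in> V n)" by (rule LeastI)
      then show "w n x = g x" using * n unfolding g_def by blast
    qed
  qed
  then have "AE x in lebesgue_on (V n). w n x = g x" for n
    using V(1) by (auto simp: AE_lebesgue_on_iff elim!: eventually_mono)
  then have g: "has_weak_partial (V n) i f g" for n
    by (intro has_weak_partial_cong_AE[OF w _ _ V(1)]) auto
  have ex: "\<exists>n. K \<subseteq> V n" if "compact K" "K \<subseteq> \<Omega>" for K
    using C(5) V(2) that by (meson order_refl subset_trans)
  have lg: "locally_integrable \<Omega> g"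
    unfolding locally_integrable_def
  proof (intro allI impI)
    fix K assume K: "compact K \<and> K \<subseteq> \<Omega>"
    then obtain n where "K \<subseteq> V n" using ex by blast
    then show "integrable (lebesgue_on K) g" using g[of n] K by (auto simp: has_weak_partial_def locally_integrable_def)
  qed
  have "has_weak_partial \<Omega> i f g"
    unfolding has_weak_partial_iff[OF \<Omega>]
  proof (intro conjI allI impI l lg)
    fix \<phi> assume \<phi>: "test_function \<Omega> \<phi>"
    then obtain K where K: "compact K" "K \<subseteq> \<Omega>" "\<And>x. x \<notin> K \<Longrightarrow> \<phi> x = 0" by (auto simp: test_function_def)
    obtain n where "K \<subseteq> V n" using ex K by blast
    then have "test_function (V n) \<phi>" using K test_function_smooth[OF \<phi>] unfolding test_function_def by blast
    then show "(LINT x|lebesgue. partial_deriv i \<phi> x *\<^sub>R f x) = - (LINT x|lebesgue. \<phi> x *\<^sub>R g x)"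
      using g[of n] by (simp add: has_weak_partial_iff[OF V(1)])
  qed
  then show ?thesis by blast
qed

section \<open>Regularity of planar fields from divergence and curl\<close>

text \<open>Completeness of \<open>L\<^sup>1\<close> in the form in which it is used: along a subsequence with summable increments
the telescoping series converges absolutely almost everywhere.\<close>

lemma L1_Cauchy_subseq_limit:
  fixes w :: "nat \<Rightarrow> 'a \<Rightarrow> real"
  assumes i: "\<And>n. integrable M (w n)"
    and C: "\<And>e. e > 0 \<Longrightarrow> \<exists>N. \<forall>m\<ge>N. \<forall>n\<ge>N. (LINT x|M. \<bar>w m x - w n x\<bar>) < e"
  obtains r v where "strict_mono (r :: nat \<Rightarrow> nat)" "integrable M v" "(\<lambda>n. LINT x|M. \<bar>w (r n) x - v x\<bar>) \<longlonglongrightarrow> 0"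
proof -
  have "\<exists>N. \<forall>m\<ge>N. \<forall>n\<ge>N. (LINT x|M. \<bar>w m x - w n x\<bar>) < (1/2)^k" for k by (rule C) simp
  then obtain N where N: "\<And>k m n. m \<ge> N k \<Longrightarrow> n \<ge> N k \<Longrightarrow> (LINT x|M. \<bar>w m x - w n x\<bar>) < (1/2)^k" by metis
  \<comment> \<open>summing the thresholds makes the indices strictly increasing\<close>
  define r where "r k = k + (\<Sum>j\<le>k. N j)" for k
  have r: "strict_mono r" unfolding strict_mono_Suc_iff r_def by simp
  have rN: "r k \<ge> N k" for k unfolding r_def by (simp add: sum.atMost_Suc[symmetric] member_le_sum trans_le_add2)
  define d where "d k x = w (r (Suc k)) x - w (r k) x" for k x
  have id: "integrable M (d k)" for k unfolding d_def using i by simp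
  have d: "(LINT x|M. \<bar>d k x\<bar>) \<le> (1/2)^k" for k
    unfolding d_def by (rule less_imp_le, rule N)
      (use rN[of k] strict_mono_less_eq[OF r, of k "Suc k"] in auto)
  have "(\<integral>\<^sup>+x. (\<Sum>k. ennreal \<bar>d k x\<bar>) \<partial>M) = (\<Sum>k. \<integral>\<^sup>+x. ennreal \<bar>d k x\<bar> \<partial>M)"
    by (rule nn_integral_suminf) (use id in measurable)
  also have "\<dots> = (\<Sum>k. ennreal (LINT x|M. \<bar>d k x\<bar>))"
    using id by (intro suminf_cong nn_integral_eq_integral) auto
  also have "\<dots> \<le> (\<Sum>k. ennreal ((1/2)^k))" by (intro suminf_le ennreal_leI d) auto
  also have "\<dots> = ennreal (\<Sum>k. (1/2)^k)" by (rule suminf_ennreal2) (auto intro: summable_geometric)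
  finally have fin: "(\<integral>\<^sup>+x. (\<Sum>k. ennreal \<bar>d k x\<bar>) \<partial>M) < \<infinity>" by (rule le_less_trans) simp
  have "AE x in M. (\<Sum>k. ennreal \<bar>d k x\<bar>) \<noteq> \<infinity>"
    by (rule nn_integral_PInf_AE) (use fin id in \<open>auto simp: less_top\<close>)
  then have sm: "AE x in M. summable (\<lambda>k. \<bar>d k x\<bar>)"
    by eventually_elim (rule summable_suminf_not_top, auto)
  define v where "v x = w (r 0) x + (\<Sum>k. d k x)" for x
  define H where "H x = (\<Sum>k. \<bar>d k x\<bar>)" for x
  have mv: "v \<in> borel_measurable M" unfolding v_def[abs_def] using i id by measurable
  have mH: "H \<in> borel_measurable M" unfolding H_def[abs_def] using id by measurable
  have iH: "integrable M H"
  proof (rule integrableI_nonneg[OF mH])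
    show "AE x in M. 0 \<le> H x" using sm by eventually_elim (auto simp: H_def intro: suminf_nonneg)
    have "(\<integral>\<^sup>+x. ennreal (H x) \<partial>M) = (\<integral>\<^sup>+x. (\<Sum>k. ennreal \<bar>d k x\<bar>) \<partial>M)"
      by (rule nn_integral_cong_AE) (use sm in eventually_elim, simp add: H_def suminf_ennreal2)
    then show "(\<integral>\<^sup>+x. ennreal (H x) \<partial>M) < \<infinity>" using fin by simp
  qed
  have tel: "(\<Sum>k<n. d k x) = w (r n) x - w (r 0) x" for n x
    unfolding d_def by (rule sum_lessThan_telescope)
  have lim: "AE x in M. (\<lambda>n. w (r n) x) \<longlonglongrightarrow> v x"
    using sm
  proof eventually_elim
    fix x assume "summable (\<lambda>k. \<bar>d k x\<bar>)"
    then have "summable (\<lambda>k. d k x)" by (rule summable_rabs_cancel)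
    from tendsto_add[OF tendsto_const[of "w (r 0) x"] summable_LIMSEQ[OF this]]
    have "(\<lambda>n. w (r 0) x + (\<Sum>k<n. d k x)) \<longlonglongrightarrow> v x" unfolding v_def .
    then show "(\<lambda>n. w (r n) x) \<longlonglongrightarrow> v x" by (simp add: tel)
  qed
  have bd: "AE x in M. norm (w (r n) x) \<le> \<bar>w (r 0) x\<bar> + H x" for n
    using sm
  proof eventually_elim
    fix x assume s: "summable (\<lambda>k. \<bar>d k x\<bar>)"
    have "\<bar>\<Sum>k<n. d k x\<bar> \<le> (\<Sum>k<n. \<bar>d k x\<bar>)" by (rule sum_abs)
    also have "\<dots> \<le> H x" unfolding H_def by (rule sum_le_suminf[OF s]) auto
    finally show "norm (w (r n) x) \<le> \<bar>w (r 0) x\<bar> + H x" unfolding tel by simp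
  qed
  have idom: "integrable M (\<lambda>x. \<bar>w (r 0) x\<bar> + H x)" using i iH by simp
  have iv: "integrable M v"
    by (rule integrable_dominated_convergence[OF mv _ idom lim bd]) (use i in auto)
  have "(\<lambda>n. LINT x|M. \<bar>w (r n) x - v x\<bar>) \<longlonglongrightarrow> (LINT x|M. 0)"
  proof (rule integral_dominated_convergence[where w = "\<lambda>x. \<bar>w (r 0) x\<bar> + H x + \<bar>v x\<bar>"])
    show "integrable M (\<lambda>x. \<bar>w (r 0) x\<bar> + H x + \<bar>v x\<bar>)" using idom iv by simp
    show "AE x in M. (\<lambda>n. \<bar>w (r n) x - v x\<bar>) \<longlonglongrightarrow> 0"
      using lim by eventually_elim (rule tendsto_rabs_zero, rule LIM_zero)
    show "AE x in M. norm \<bar>w (r n) x - v x\<bar> \<le> \<bar>w (r 0) x\<bar> + H x + \<bar>v x\<bar>" for n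
      using bd[of n] by eventually_elim auto
  qed (use i iv in auto)
  then show thesis using that[OF r iv] by simp
qed

lemma integrable_test_function_product:
  assumes "test_function \<Omega> f" "test_function \<Omega>' g"
  shows "integrable lebesgue (\<lambda>x. f x * g x)"
  by (rule integrable_test_function[OF test_function_smooth_mult[OF assms(1) test_function_smooth[OF assms(2)]]])

text \<open>Expanding the squares, the cross terms add up to twice the Jacobian \<open>P\<^sub>1 Q\<^sub>2 - P\<^sub>2 Q\<^sub>1\<close>, whose
integral vanishes by integration by parts.\<close>

lemma gradient_le_div_curl:
  fixes P Q :: "real^2 \<Rightarrow> real"
  assumes P: "test_function UNIV P" and Q: "test_function UNIV Q"
  shows "(LINT x|lebesgue. (partial_deriv j P x)\<^sup>2) \<le> (LINT x|lebesgue. (partial_deriv 1 P x + partial_deriv 2 Q x)\<^sup>2)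
      + (LINT x|lebesgue. (partial_deriv 1 Q x - partial_deriv 2 P x)\<^sup>2)"
proof -
  let ?P1 = "partial_deriv 1 P" and ?P2 = "partial_deriv 2 P" and ?Q1 = "partial_deriv 1 Q" and ?Q2 = "partial_deriv 2 Q"
  note t = test_function_partial_deriv[OF P, of 1] test_function_partial_deriv[OF P, of 2]
    test_function_partial_deriv[OF Q, of 1] test_function_partial_deriv[OF Q, of 2]
  have i: "integrable lebesgue (\<lambda>x. ?P1 x * ?P1 x)" "integrable lebesgue (\<lambda>x. ?P2 x * ?P2 x)"
    "integrable lebesgue (\<lambda>x. ?Q1 x * ?Q1 x)" "integrable lebesgue (\<lambda>x. ?Q2 x * ?Q2 x)"
    "integrable lebesgue (\<lambda>x. ?P1 x * ?Q2 x)" "integrable lebesgue (\<lambda>x. ?P2 x * ?Q1 x)"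
    by (rule integrable_test_function_product[OF t(1) t(1)] integrable_test_function_product[OF t(2) t(2)]
        integrable_test_function_product[OF t(3) t(3)] integrable_test_function_product[OF t(4) t(4)]
        integrable_test_function_product[OF t(1) t(4)] integrable_test_function_product[OF t(2) t(3)])+
  have J: "(LINT x|lebesgue. ?P1 x * ?Q2 x) = (LINT x|lebesgue. ?P2 x * ?Q1 x)"
    using integration_by_parts_test_function[OF P test_function_smooth[OF t(4)], of 1]
      integration_by_parts_test_function[OF P test_function_smooth[OF t(3)], of 2]
      partial_deriv_commute[OF test_function_smooth[OF Q], of 1 2] by simp
  have "(LINT x|lebesgue. (?P1 x + ?Q2 x)\<^sup>2) = (LINT x|lebesgue. ?P1 x * ?P1 x + ?Q2 x * ?Q2 x + 2 * (?P1 x * ?Q2 x))"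
    by (rule Bochner_Integration.integral_cong) (auto simp: power2_eq_square algebra_simps)
  also have "\<dots> = (LINT x|lebesgue. ?P1 x * ?P1 x) + (LINT x|lebesgue. ?Q2 x * ?Q2 x) + 2 * (LINT x|lebesgue. ?P1 x * ?Q2 x)"
    using i by simp
  finally have 1: "(LINT x|lebesgue. (?P1 x + ?Q2 x)\<^sup>2)
    = (LINT x|lebesgue. ?P1 x * ?P1 x) + (LINT x|lebesgue. ?Q2 x * ?Q2 x) + 2 * (LINT x|lebesgue. ?P1 x * ?Q2 x)" .
  have "(LINT x|lebesgue. (?Q1 x - ?P2 x)\<^sup>2) = (LINT x|lebesgue. ?Q1 x * ?Q1 x + ?P2 x * ?P2 x - 2 * (?P2 x * ?Q1 x))"
    by (rule Bochner_Integration.integral_cong) (auto simp: power2_eq_square algebra_simps)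
  also have "\<dots> = (LINT x|lebesgue. ?Q1 x * ?Q1 x) + (LINT x|lebesgue. ?P2 x * ?P2 x) - 2 * (LINT x|lebesgue. ?P2 x * ?Q1 x)"
    using i by simp
  finally have 2: "(LINT x|lebesgue. (?Q1 x - ?P2 x)\<^sup>2)
    = (LINT x|lebesgue. ?Q1 x * ?Q1 x) + (LINT x|lebesgue. ?P2 x * ?P2 x) - 2 * (LINT x|lebesgue. ?P2 x * ?Q1 x)" .
  have nn: "(LINT x|lebesgue. f x * f x) \<ge> 0" for f :: "real^2 \<Rightarrow> real" by (rule integral_nonneg_AE) simp
  have "(LINT x|lebesgue. (partial_deriv j P x)\<^sup>2) \<le> (LINT x|lebesgue. ?P1 x * ?P1 x) + (LINT x|lebesgue. ?P2 x * ?P2 x)"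
    using exhaust_2[of j] nn[of ?P1] nn[of ?P2] by (auto simp: power2_eq_square)
  then show ?thesis using 1 2 J nn[of ?Q1] nn[of ?Q2] by linarith
qed

text \<open>First order equations with constant coefficients survive mollification. The coefficient \<open>c\<close> is \<open>1\<close> for
the divergence and \<open>-1\<close> for the curl.\<close>

lemma mollify_weak_relation:
  fixes P Q A :: "real^'n::finite \<Rightarrow> real" and c :: real
  assumes i: "integrable lebesgue P" "integrable lebesgue Q" "integrable lebesgue A"
    and w: "\<And>\<phi>. test_function UNIV \<phi> \<Longrightarrow> (LINT x|lebesgue. partial_deriv i \<phi> x * P x + c * (partial_deriv j \<phi> x * Q x)) = - (LINT x|lebesgue. \<phi> x * A x)"
  shows "partial_deriv i (mollify n P) x + c * partial_deriv j (mollify n Q) x = mollify n A x"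
proof -
  let ?k = "mollifier n :: real^'n \<Rightarrow> real"
  have k: "test_function UNIV (\<lambda>y. ?k (x - y))" by (rule test_function_reflect_UNIV[OF test_function_mollifier])
  have d: "partial_deriv i (\<lambda>y. ?k (x - y)) = (\<lambda>y. - partial_deriv i ?k (x - y))" for i
    by (rule partial_deriv_reflect[OF smooth_differentiable[OF test_function_smooth[OF test_function_mollifier]]])
  have m: "partial_deriv i (mollify n P) x = - (LINT y|lebesgue. partial_deriv i (\<lambda>y. ?k (x - y)) y * P y)"
    if "integrable lebesgue P" for P i
    unfolding d mollify_def partial_deriv_convolution[OF test_function_mollifier that] convolution_def by simp
  note j = integrable_mult_test_function[OF test_function_partial_deriv[OF k] i(1), of i]
    integrable_mult_test_function[OF test_function_partial_deriv[OF k] i(2), of j]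
  have "partial_deriv i (mollify n P) x + c * partial_deriv j (mollify n Q) x
     = - (LINT y|lebesgue. partial_deriv i (\<lambda>y. ?k (x - y)) y * P y + c * (partial_deriv j (\<lambda>y. ?k (x - y)) y * Q y))"
    using j by (simp add: m i)
  also have "\<dots> = mollify n A x" unfolding w[OF k] by (simp add: mollify_def convolution_def)
  finally show ?thesis .
qed

text \<open>By \<open>gradient_le_div_curl\<close> the gradients of the mollified fields form a Cauchy sequence in \<open>L\<^sup>2\<close>. Their
supports lie in a fixed compact set, so the sequence is Cauchy in \<open>L\<^sup>1\<close> as well, and its limit is the weak derivative.\<close>

lemma div_curl_weak_partial_UNIV:
  fixes P Q A B :: "real^2 \<Rightarrow> real"
  assumes i: "integrable lebesgue P" "integrable lebesgue Q" "integrable lebesgue A" "integrable lebesgue B"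
    and i2: "integrable lebesgue (\<lambda>x. (A x)\<^sup>2)" "integrable lebesgue (\<lambda>x. (B x)\<^sup>2)"
    and K: "compact K" "\<And>x. x \<notin> K \<Longrightarrow> P x = 0" "\<And>x. x \<notin> K \<Longrightarrow> Q x = 0"
    and div: "\<And>\<phi>. test_function UNIV \<phi> \<Longrightarrow> (LINT x|lebesgue. partial_deriv 1 \<phi> x * P x + 1 * (partial_deriv 2 \<phi> x * Q x)) = - (LINT x|lebesgue. \<phi> x * A x)"
    and curl: "\<And>\<phi>. test_function UNIV \<phi> \<Longrightarrow> (LINT x|lebesgue. partial_deriv 1 \<phi> x * Q x + (-1) * (partial_deriv 2 \<phi> x * P x)) = - (LINT x|lebesgue. \<phi> x * B x)"
  shows "\<exists>w. has_weak_partial UNIV j P w"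
proof -
  obtain KP NP where KP: "compact KP" "\<And>n x. n \<ge> NP \<Longrightarrow> x \<notin> KP \<Longrightarrow> mollify n P x = 0" "\<And>n. n \<ge> NP \<Longrightarrow> test_function UNIV (mollify n P)"
    by (rule mollify_eventually_test_function[OF i(1) K(1) subset_UNIV K(2) open_UNIV]) (assumption, rule that)
  obtain KQ NQ where KQ: "\<And>n. n \<ge> NQ \<Longrightarrow> test_function UNIV (mollify n Q)"
    by (rule mollify_eventually_test_function[OF i(2) K(1) subset_UNIV K(3) open_UNIV]) (assumption, rule that)
  \<comment> \<open>the index is shifted so that all members of the sequences are test functions\<close>
  define p where "p n = mollify (n + (NP + NQ)) P" for n
  define q where "q n = mollify (n + (NP + NQ)) Q" for n
  define a where "a n = mollify (n + (NP + NQ)) A" for n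
  define b where "b n = mollify (n + (NP + NQ)) B" for n
  have tp: "test_function UNIV (p n)" and tq: "test_function UNIV (q n)" for n
    unfolding p_def q_def by (rule KP(3) KQ; simp)+
  have dtp: "p n differentiable (at x)" and dtq: "q n differentiable (at x)" for n x
    by (rule smooth_differentiable[OF test_function_smooth[OF tp]] smooth_differentiable[OF test_function_smooth[OF tq]])+
  note dp = test_function_partial_deriv[OF tp] and dq = test_function_partial_deriv[OF tq]
  have ab: "a n x = partial_deriv 1 (p n) x + partial_deriv 2 (q n) x"
    "b n x = partial_deriv 1 (q n) x - partial_deriv 2 (p n) x" for n x
    using mollify_weak_relation[OF i(1,2,3) div] mollify_weak_relation[OF i(2,1,4) curl]
    unfolding a_def b_def p_def q_def by simp_all
  have L2: "(\<lambda>n. LINT x|lebesgue. (a n x - A x)\<^sup>2) \<longlonglongrightarrow> 0" "(\<lambda>n. LINT x|lebesgue. (b n x - B x)\<^sup>2) \<longlonglongrightarrow> 0"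
    unfolding a_def b_def
    by (rule LIMSEQ_ignore_initial_segment[OF mollify_L2[OF i(3) i2(1)]], rule LIMSEQ_ignore_initial_segment[OF mollify_L2[OF i(4) i2(2)]])
  have sq: "integrable lebesgue (\<lambda>x. (f x - F x)\<^sup>2)"
    if f: "integrable lebesgue (\<lambda>x. (f x)\<^sup>2)" "f \<in> borel_measurable lebesgue"
     and F: "integrable lebesgue (\<lambda>x. (F x)\<^sup>2)" "F \<in> borel_measurable lebesgue" for f F :: "real^2 \<Rightarrow> real"
  proof (rule Bochner_Integration.integrable_bound)
    show "integrable lebesgue (\<lambda>x. 2 * (f x)\<^sup>2 + 2 * (F x)\<^sup>2)" using f F by simp
    show "(\<lambda>x. (f x - F x)\<^sup>2) \<in> borel_measurable lebesgue" using f(2) F(2) by measurable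
    have "(s - t)\<^sup>2 \<le> 2 * s\<^sup>2 + 2 * t\<^sup>2" for s t :: real
      using zero_le_power2[of "s + t"] by (simp add: power2_eq_square algebra_simps)
    then show "AE x in lebesgue. norm ((f x - F x)\<^sup>2) \<le> norm (2 * (f x)\<^sup>2 + 2 * (F x)\<^sup>2)" by simp
  qed
  have tsq: "integrable lebesgue (\<lambda>x. (s x + c * t x)\<^sup>2)" if "test_function UNIV s" "test_function UNIV t" for s t :: "real^2 \<Rightarrow> real" and c
  proof -
    have "integrable lebesgue (\<lambda>x. s x * s x + 2 * c * (s x * t x) + c * c * (t x * t x))"
      using integrable_test_function_product[OF that(1) that(1)] integrable_test_function_product[OF that(1) that(2)]
        integrable_test_function_product[OF that(2) that(2)]
      by (intro Bochner_Integration.integrable_add integrable_mult_right)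
    also have "(\<lambda>x. s x * s x + 2 * c * (s x * t x) + c * c * (t x * t x)) = (\<lambda>x. (s x + c * t x)\<^sup>2)"
      by (auto simp: power2_eq_square algebra_simps)
    finally show ?thesis .
  qed
  have a2: "integrable lebesgue (\<lambda>x. (a n x)\<^sup>2)" and b2: "integrable lebesgue (\<lambda>x. (b n x)\<^sup>2)" for n
    unfolding ab using tsq[OF dp[of 1 n] dq[of 2 n], of 1] tsq[OF dq[of 1 n] dp[of 2 n], of "-1"] by simp_all
  have am: "a n \<in> borel_measurable lebesgue" "b n \<in> borel_measurable lebesgue" for n
    unfolding a_def b_def by (intro mollify_measurable i)+
  have Am: "A \<in> borel_measurable lebesgue" "B \<in> borel_measurable lebesgue" using i(3,4) by auto
  have tri: "(LINT x|lebesgue. (f m x - f n x)\<^sup>2) \<le> 2 * (LINT x|lebesgue. (f m x - F x)\<^sup>2) + 2 * (LINT x|lebesgue. (f n x - F x)\<^sup>2)"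
    if f: "\<And>n. integrable lebesgue (\<lambda>x. (f n x)\<^sup>2)" "\<And>n. f n \<in> borel_measurable lebesgue"
     and F: "integrable lebesgue (\<lambda>x. (F x)\<^sup>2)" "F \<in> borel_measurable lebesgue" for f :: "nat \<Rightarrow> real^2 \<Rightarrow> real" and F m n
  proof -
    have "(LINT x|lebesgue. (f m x - f n x)\<^sup>2) \<le> (LINT x|lebesgue. 2 * (f m x - F x)\<^sup>2 + 2 * (f n x - F x)\<^sup>2)"
    proof (rule integral_mono)
      show "integrable lebesgue (\<lambda>x. (f m x - f n x)\<^sup>2)" by (rule sq[OF f f])
      show "integrable lebesgue (\<lambda>x. 2 * (f m x - F x)\<^sup>2 + 2 * (f n x - F x)\<^sup>2)"
        using sq[OF f F, of m] sq[OF f F, of n] by simp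
      have *: "(s - t)\<^sup>2 \<le> 2 * (s - y)\<^sup>2 + 2 * (t - y)\<^sup>2" for s t y :: real
        using zero_le_power2[of "s + t - 2 * y"] by (simp add: power2_eq_square algebra_simps)
      show "(f m x - f n x)\<^sup>2 \<le> 2 * (f m x - F x)\<^sup>2 + 2 * (f n x - F x)\<^sup>2" for x by (rule *)
    qed
    then show ?thesis using sq[OF f F, of m] sq[OF f F, of n] by simp
  qed
  let ?D = "\<lambda>n. partial_deriv j (p n)"
  have D: "(LINT x|lebesgue. (?D m x - ?D n x)\<^sup>2)
     \<le> (LINT x|lebesgue. (a m x - a n x)\<^sup>2) + (LINT x|lebesgue. (b m x - b n x)\<^sup>2)" for m n
  proof -
    show ?thesis
      using gradient_le_div_curl[OF test_function_diff[OF tp tp, of m n] test_function_diff[OF tq tq, of m n], of j]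
      unfolding partial_deriv_diff[OF dtp dtp] partial_deriv_diff[OF dtq dtq] ab by (simp add: algebra_simps)
  qed
  have D0: "?D n x = 0" if "x \<notin> KP" for n x
    by (rule partial_deriv_eq_0_outside[OF compact_imp_closed[OF KP(1)] _ that]) (auto simp: p_def intro!: KP(2))
  have iD: "integrable lebesgue (?D n)" for n by (rule integrable_test_function[OF dp])
  have Cauchy: "\<exists>N. \<forall>m\<ge>N. \<forall>n\<ge>N. (LINT x|lebesgue. \<bar>?D m x - ?D n x\<bar>) < e" if e: "e > 0" for e
  proof -
    let ?\<mu> = "measure lebesgue KP"
    \<comment> \<open>\<open>|s| \<le> \<delta> + s\<^sup>2 / \<delta>\<close> bounds the \<open>L\<^sup>1\<close> norm by the measure of the support and the \<open>L\<^sup>2\<close> norm\<close>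
    define \<delta> where "\<delta> = e / (2 * (?\<mu> + 1))"
    have \<mu>: "?\<mu> \<ge> 0" by simp
    have \<delta>: "\<delta> > 0" "\<delta> * ?\<mu> < e / 2" unfolding \<delta>_def using e \<mu> by (auto simp: divide_simps add_nonneg_pos)
    have iK: "integrable lebesgue (indicator KP :: real^2 \<Rightarrow> real)"
      using lmeasurable_compact[OF KP(1)] by (auto simp: fmeasurable_def)
    have le1: "(LINT x|lebesgue. \<bar>?D m x - ?D n x\<bar>) \<le> \<delta> * ?\<mu> + (LINT x|lebesgue. (?D m x - ?D n x)\<^sup>2) / \<delta>" for m n
    proof -
      have iDD: "integrable lebesgue (\<lambda>x. (?D m x - ?D n x)\<^sup>2)"
        using tsq[OF dp[of j m] dp[of j n], of "-1"] by simp
      have "(LINT x|lebesgue. \<bar>?D m x - ?D n x\<bar>) \<le> (LINT x|lebesgue. \<delta> * indicator KP x + (?D m x - ?D n x)\<^sup>2 / \<delta>)"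
      proof (rule integral_mono)
        show "integrable lebesgue (\<lambda>x. \<bar>?D m x - ?D n x\<bar>)" using iD by auto
        show "integrable lebesgue (\<lambda>x. \<delta> * indicator KP x + (?D m x - ?D n x)\<^sup>2 / \<delta>)" using iK iDD by simp
        have *: "\<bar>s\<bar> \<le> \<delta> + s\<^sup>2 / \<delta>" for s :: real
        proof (cases "\<bar>s\<bar> \<le> \<delta>")
          case True
          then show ?thesis using \<delta>(1) by (simp add: add_increasing2)
        next
          case False
          then have "\<bar>s\<bar> * \<delta> \<le> \<bar>s\<bar> * \<bar>s\<bar>" by (intro mult_left_mono) auto
          then have "\<bar>s\<bar> \<le> s\<^sup>2 / \<delta>" using \<delta>(1) by (simp add: power2_eq_square pos_le_divide_eq)
          then show ?thesis using \<delta>(1) by simp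
        qed
        show "\<bar>?D m x - ?D n x\<bar> \<le> \<delta> * indicator KP x + (?D m x - ?D n x)\<^sup>2 / \<delta>" for x
          using *[of "?D m x - ?D n x"] D0[of x] by (cases "x \<in> KP") auto
      qed
      then show ?thesis using iK iDD by simp
    qed
    have "(\<lambda>n. (LINT x|lebesgue. (a n x - A x)\<^sup>2) + (LINT x|lebesgue. (b n x - B x)\<^sup>2)) \<longlonglongrightarrow> 0"
      using tendsto_add[OF L2] by simp
    from LIMSEQ_D[OF this, of "e * \<delta> / 8"] obtain N where
      N: "\<And>n. n \<ge> N \<Longrightarrow> \<bar>(LINT x|lebesgue. (a n x - A x)\<^sup>2) + (LINT x|lebesgue. (b n x - B x)\<^sup>2)\<bar> < e * \<delta> / 8"
      using e \<delta>(1) by auto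
    show ?thesis
    proof (intro exI[of _ N] allI impI)
      fix m n assume mn: "m \<ge> N" "n \<ge> N"
      have "(LINT x|lebesgue. (?D m x - ?D n x)\<^sup>2) < e * \<delta> / 2"
        using D[of m n] tri[of a A m n, OF a2 am(1) i2(1) Am(1)] tri[of b B m n, OF b2 am(2) i2(2) Am(2)] N[OF mn(1)] N[OF mn(2)]
        by linarith
      then have "(LINT x|lebesgue. (?D m x - ?D n x)\<^sup>2) / \<delta> < e / 2" using \<delta>(1) by (simp add: pos_divide_less_eq)
      then show "(LINT x|lebesgue. \<bar>?D m x - ?D n x\<bar>) < e" using le1[of m n] \<delta>(2) by linarith
    qed
  qed
  obtain r w where r: "strict_mono (r :: nat \<Rightarrow> nat)" and w: "integrable lebesgue w" "(\<lambda>n. LINT x|lebesgue. \<bar>?D (r n) x - w x\<bar>) \<longlonglongrightarrow> 0"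
    by (rule L1_Cauchy_subseq_limit[OF iD Cauchy]) (assumption, rule that)
  have P_lim: "(\<lambda>n. LINT x|lebesgue. \<bar>p (r n) x - P x\<bar>) \<longlonglongrightarrow> 0"
    using LIMSEQ_subseq_LIMSEQ[OF LIMSEQ_ignore_initial_segment[OF mollify_L1[OF i(1)], of "NP + NQ"] r]
    by (simp add: p_def o_def)
  have "has_weak_partial UNIV j P w"
    unfolding has_weak_partial_iff[OF open_UNIV]
  proof (intro conjI allI impI locally_integrable_integrable i w)
    fix \<phi> :: "real^2 \<Rightarrow> real" assume \<phi>: "test_function UNIV \<phi>"
    have lim: "(\<lambda>n. LINT x|lebesgue. u' n x * \<psi> x) \<longlonglongrightarrow> (LINT x|lebesgue. u x * \<psi> x)"
      if "\<And>n. integrable lebesgue (u' n)" "integrable lebesgue u" "(\<lambda>n. LINT x|lebesgue. \<bar>u' n x - u x\<bar>) \<longlonglongrightarrow> 0" and \<psi>: "test_function UNIV \<psi>" for u' u \<psi>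
    proof -
      obtain B where "\<And>x. \<bar>\<psi> x\<bar> \<le> B" by (rule test_function_bounded[OF \<psi>]) (rule that)
      then show ?thesis
        by (intro tendsto_integral_mult_bounded[OF that(1-3) test_function_measurable_lebesgue[OF \<psi>], of B]) simp
    qed
    have 1: "(\<lambda>n. LINT x|lebesgue. p (r n) x * partial_deriv j \<phi> x) \<longlonglongrightarrow> (LINT x|lebesgue. P x * partial_deriv j \<phi> x)"
      by (rule lim[OF integrable_test_function[OF tp] i(1) P_lim test_function_partial_deriv[OF \<phi>]])
    have 2: "(\<lambda>n. LINT x|lebesgue. ?D (r n) x * \<phi> x) \<longlonglongrightarrow> (LINT x|lebesgue. w x * \<phi> x)"
      by (rule lim[OF iD w \<phi>])
    have "(LINT x|lebesgue. p (r n) x * partial_deriv j \<phi> x) = - (LINT x|lebesgue. ?D (r n) x * \<phi> x)" for n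
      using integration_by_parts_test_function[OF \<phi> test_function_smooth[OF tp], of j "r n"] by (simp add: mult.commute)
    then have "(LINT x|lebesgue. P x * partial_deriv j \<phi> x) = - (LINT x|lebesgue. w x * \<phi> x)"
      using LIMSEQ_unique[OF 1] tendsto_minus[OF 2] by simp
    then show "(LINT x|lebesgue. partial_deriv j \<phi> x *\<^sub>R P x) = - (LINT x|lebesgue. \<phi> x *\<^sub>R w x)"
      by (simp add: mult.commute)
  qed
  then show ?thesis by blast
qed

text \<open>A cutoff \<open>\<eta>\<close> changes divergence and curl only by terms without derivatives of the field. The
second component follows from the first by the rotation \<open>(P, Q) \<mapsto> (Q, - P)\<close>, which exchanges divergence and curl up to sign.
The curl of \<open>(p, q)\<close> vanishes because this field is the gradient of \<open>u\<close>.\<close>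

lemma div_curl_weak_partial:
  fixes u p q F :: "real^2 \<Rightarrow> real"
  assumes \<Omega>: "open \<Omega>" and u: "has_weak_partial \<Omega> 1 u p" "has_weak_partial \<Omega> 2 u q"
    and sq: "locally_integrable \<Omega> (\<lambda>x. (p x)\<^sup>2)" "locally_integrable \<Omega> (\<lambda>x. (q x)\<^sup>2)"
    and F: "locally_integrable \<Omega> F" "locally_integrable \<Omega> (\<lambda>x. (F x)\<^sup>2)"
    and div: "\<And>\<phi>. test_function \<Omega> \<phi> \<Longrightarrow>
      (LINT x|lebesgue. partial_deriv 1 \<phi> x * p x) + (LINT x|lebesgue. partial_deriv 2 \<phi> x * q x) = - (LINT x|lebesgue. \<phi> x * F x)"
  shows "(\<exists>w. has_weak_partial \<Omega> j p w) \<and> (\<exists>w. has_weak_partial \<Omega> j q w)"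
proof -
  have l: "locally_integrable \<Omega> p" "locally_integrable \<Omega> q" using u by (auto simp: has_weak_partial_def)
  have curl: "(LINT x|lebesgue. partial_deriv 1 \<psi> x * q x) = (LINT x|lebesgue. partial_deriv 2 \<psi> x * p x)"
    if \<psi>: "test_function \<Omega> \<psi>" for \<psi>
  proof -
    have "(LINT x|lebesgue. partial_deriv 1 (partial_deriv 2 \<psi>) x * u x) = - (LINT x|lebesgue. partial_deriv 2 \<psi> x * p x)"
      "(LINT x|lebesgue. partial_deriv 2 (partial_deriv 1 \<psi>) x * u x) = - (LINT x|lebesgue. partial_deriv 1 \<psi> x * q x)"
      using u test_function_partial_deriv[OF \<psi>] by (auto simp: has_weak_partial_iff[OF \<Omega>])
    then show ?thesis using partial_deriv_commute[OF test_function_smooth[OF \<psi>], of 1 2] by simp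
  qed
  have loc: "(\<exists>w. has_weak_partial UNIV j (\<lambda>x. \<eta> x * p x) w) \<and> (\<exists>w. has_weak_partial UNIV j (\<lambda>x. \<eta> x * q x) w)"
    if \<eta>: "test_function \<Omega> \<eta>" for \<eta>
  proof -
    define P where "P x = \<eta> x * p x" for x
    define Q where "Q x = \<eta> x * q x" for x
    define A where "A x = \<eta> x * F x + partial_deriv 1 \<eta> x * p x + partial_deriv 2 \<eta> x * q x" for x
    define B where "B x = partial_deriv 1 \<eta> x * q x - partial_deriv 2 \<eta> x * p x" for x
    note d\<eta> = test_function_partial_deriv[OF \<eta>]
    note it = integrable_test_function_mult[OF \<eta>] integrable_test_function_mult[OF d\<eta>]
    have i: "integrable lebesgue P" "integrable lebesgue Q" "integrable lebesgue A" "integrable lebesgue B"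
      unfolding P_def[abs_def] Q_def[abs_def] A_def[abs_def] B_def[abs_def]
      by (intro Bochner_Integration.integrable_add Bochner_Integration.integrable_diff it l F)+
    have sqi: "integrable lebesgue (\<lambda>x. (\<tau> x * f x)\<^sup>2)"
      if "test_function \<Omega> \<tau>" "locally_integrable \<Omega> (\<lambda>x. (f x)\<^sup>2)" for \<tau> f :: "real^2 \<Rightarrow> real"
    proof -
      have "integrable lebesgue (\<lambda>x. (\<tau> x * \<tau> x) * (f x)\<^sup>2)"
        by (rule integrable_test_function_mult[OF test_function_smooth_mult[OF that(1) test_function_smooth[OF that(1)]] that(2)])
      then show ?thesis by (simp add: power2_eq_square mult_ac)
    qed
    note s = sqi[OF \<eta> F(2)] sqi[OF d\<eta>[of 1] sq(1)] sqi[OF d\<eta>[of 2] sq(2)] sqi[OF d\<eta>[of 1] sq(2)] sqi[OF d\<eta>[of 2] sq(1)]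
    have A2: "integrable lebesgue (\<lambda>x. (A x)\<^sup>2)"
    proof (rule Bochner_Integration.integrable_bound)
      show "integrable lebesgue (\<lambda>x. 3 * ((\<eta> x * F x)\<^sup>2 + (partial_deriv 1 \<eta> x * p x)\<^sup>2 + (partial_deriv 2 \<eta> x * q x)\<^sup>2))"
        by (intro integrable_mult_right Bochner_Integration.integrable_add s)
      have "(a + b + c)\<^sup>2 \<le> 3 * (a\<^sup>2 + b\<^sup>2 + c\<^sup>2)" for a b c :: real
        using zero_le_power2[of "a - b"] zero_le_power2[of "a - c"] zero_le_power2[of "b - c"]
        by (simp add: power2_eq_square algebra_simps)
      then show "AE x in lebesgue. norm ((A x)\<^sup>2) \<le> norm (3 * ((\<eta> x * F x)\<^sup>2 + (partial_deriv 1 \<eta> x * p x)\<^sup>2 + (partial_deriv 2 \<eta> x * q x)\<^sup>2))"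
        by (simp add: A_def)
    qed (use i(3) in auto)
    have B2: "integrable lebesgue (\<lambda>x. (B x)\<^sup>2)"
    proof (rule Bochner_Integration.integrable_bound)
      show "integrable lebesgue (\<lambda>x. 2 * ((partial_deriv 1 \<eta> x * q x)\<^sup>2 + (partial_deriv 2 \<eta> x * p x)\<^sup>2))"
        by (intro integrable_mult_right Bochner_Integration.integrable_add s)
      have "(a - b)\<^sup>2 \<le> 2 * (a\<^sup>2 + b\<^sup>2)" for a b :: real
        using zero_le_power2[of "a + b"] by (simp add: power2_eq_square algebra_simps)
      then show "AE x in lebesgue. norm ((B x)\<^sup>2) \<le> norm (2 * ((partial_deriv 1 \<eta> x * q x)\<^sup>2 + (partial_deriv 2 \<eta> x * p x)\<^sup>2))"
        by (simp add: B_def)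
    qed (use i(4) in auto)
    obtain K where K: "compact K" "\<And>x. x \<notin> K \<Longrightarrow> \<eta> x = 0" using \<eta> by (auto simp: test_function_def)
    have P0: "P x = 0" "Q x = 0" if "x \<notin> K" for x using K(2)[OF that] by (auto simp: P_def Q_def)
    \<comment> \<open>the Leibniz rule for \<open>\<eta> \<phi>\<close>, which moves the cutoff from the field to the test function\<close>
    have lb: "(LINT x|lebesgue. partial_deriv k \<phi> x * (\<eta> x * f x))
       = (LINT x|lebesgue. partial_deriv k (\<lambda>x. \<eta> x * \<phi> x) x * f x) - (LINT x|lebesgue. \<phi> x * (partial_deriv k \<eta> x * f x))"
      and ii: "integrable lebesgue (\<lambda>x. partial_deriv k \<phi> x * (\<eta> x * f x))" "integrable lebesgue (\<lambda>x. \<phi> x * (partial_deriv k \<eta> x * f x))"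
      if f: "locally_integrable \<Omega> f" and \<phi>: "test_function UNIV \<phi>" for k f \<phi>
    proof -
      note d = smooth_differentiable[OF test_function_smooth[OF \<eta>]] smooth_differentiable[OF test_function_smooth[OF \<phi>]]
      show 1: "integrable lebesgue (\<lambda>x. partial_deriv k \<phi> x * (\<eta> x * f x))"
        by (rule integrable_mult_test_function[OF test_function_partial_deriv[OF \<phi>] it(1)[OF f]])
      show 2: "integrable lebesgue (\<lambda>x. \<phi> x * (partial_deriv k \<eta> x * f x))"
        by (rule integrable_mult_test_function[OF \<phi> it(2)[OF f]])
      have "(LINT x|lebesgue. partial_deriv k (\<lambda>x. \<eta> x * \<phi> x) x * f x)
         = (LINT x|lebesgue. partial_deriv k \<phi> x * (\<eta> x * f x) + \<phi> x * (partial_deriv k \<eta> x * f x))"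
        unfolding partial_deriv_mult[OF d] by (rule Bochner_Integration.integral_cong) (auto simp: algebra_simps)
      also have "\<dots> = (LINT x|lebesgue. partial_deriv k \<phi> x * (\<eta> x * f x)) + (LINT x|lebesgue. \<phi> x * (partial_deriv k \<eta> x * f x))"
        by (rule Bochner_Integration.integral_add[OF 1 2])
      finally show "(LINT x|lebesgue. partial_deriv k \<phi> x * (\<eta> x * f x))
       = (LINT x|lebesgue. partial_deriv k (\<lambda>x. \<eta> x * \<phi> x) x * f x) - (LINT x|lebesgue. \<phi> x * (partial_deriv k \<eta> x * f x))"
        by simp
    qed
    have divPQ: "(LINT x|lebesgue. partial_deriv 1 \<phi> x * P x) + (LINT x|lebesgue. partial_deriv 2 \<phi> x * Q x) = - (LINT x|lebesgue. \<phi> x * A x)"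
      if \<phi>: "test_function UNIV \<phi>" for \<phi>
    proof -
      have t: "test_function \<Omega> (\<lambda>x. \<eta> x * \<phi> x)" by (rule test_function_smooth_mult[OF \<eta> test_function_smooth[OF \<phi>]])
      have iF: "integrable lebesgue (\<lambda>x. (\<eta> x * \<phi> x) * F x)" by (rule integrable_test_function_mult[OF t F(1)])
      have "(LINT x|lebesgue. \<phi> x * A x) = (LINT x|lebesgue. (\<eta> x * \<phi> x) * F x + \<phi> x * (partial_deriv 1 \<eta> x * p x) + \<phi> x * (partial_deriv 2 \<eta> x * q x))"
        by (rule Bochner_Integration.integral_cong) (auto simp: A_def algebra_simps)
      also have "\<dots> = (LINT x|lebesgue. (\<eta> x * \<phi> x) * F x) + (LINT x|lebesgue. \<phi> x * (partial_deriv 1 \<eta> x * p x)) + (LINT x|lebesgue. \<phi> x * (partial_deriv 2 \<eta> x * q x))"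
        using iF ii(2)[OF l(1) \<phi>, of 1] ii(2)[OF l(2) \<phi>, of 2] by simp
      finally show ?thesis using div[OF t] unfolding P_def Q_def lb[OF l(1) \<phi>] lb[OF l(2) \<phi>] by linarith
    qed
    have curlPQ: "(LINT x|lebesgue. partial_deriv 1 \<phi> x * Q x) - (LINT x|lebesgue. partial_deriv 2 \<phi> x * P x) = - (LINT x|lebesgue. \<phi> x * B x)"
      if \<phi>: "test_function UNIV \<phi>" for \<phi>
    proof -
      have t: "test_function \<Omega> (\<lambda>x. \<eta> x * \<phi> x)" by (rule test_function_smooth_mult[OF \<eta> test_function_smooth[OF \<phi>]])
      have "(LINT x|lebesgue. \<phi> x * B x) = (LINT x|lebesgue. \<phi> x * (partial_deriv 1 \<eta> x * q x) - \<phi> x * (partial_deriv 2 \<eta> x * p x))"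
        by (rule Bochner_Integration.integral_cong) (auto simp: B_def algebra_simps)
      also have "\<dots> = (LINT x|lebesgue. \<phi> x * (partial_deriv 1 \<eta> x * q x)) - (LINT x|lebesgue. \<phi> x * (partial_deriv 2 \<eta> x * p x))"
        by (rule Bochner_Integration.integral_diff[OF ii(2)[OF l(2) \<phi>] ii(2)[OF l(1) \<phi>]])
      finally show ?thesis using curl[OF t] unfolding P_def Q_def lb[OF l(1) \<phi>] lb[OF l(2) \<phi>] by linarith
    qed
    have iPQ: "integrable lebesgue (\<lambda>x. partial_deriv k \<phi> x * P x)" "integrable lebesgue (\<lambda>x. partial_deriv k \<phi> x * Q x)"
      if \<phi>: "test_function UNIV \<phi>" for \<phi> k
      unfolding P_def Q_def by (rule ii(1)[OF l(1) \<phi>], rule ii(1)[OF l(2) \<phi>])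
    have "\<exists>w. has_weak_partial UNIV j P w"
    proof (rule div_curl_weak_partial_UNIV[OF i A2 B2 K(1) P0])
      fix \<phi> :: "real^2 \<Rightarrow> real" assume \<phi>: "test_function UNIV \<phi>"
      show "(LINT x|lebesgue. partial_deriv 1 \<phi> x * P x + 1 * (partial_deriv 2 \<phi> x * Q x)) = - (LINT x|lebesgue. \<phi> x * A x)"
        using divPQ[OF \<phi>] iPQ[OF \<phi>] by simp
      show "(LINT x|lebesgue. partial_deriv 1 \<phi> x * Q x + - 1 * (partial_deriv 2 \<phi> x * P x)) = - (LINT x|lebesgue. \<phi> x * B x)"
        using curlPQ[OF \<phi>] iPQ[OF \<phi>] by simp
    qed
    moreover have "\<exists>w. has_weak_partial UNIV j Q w"
    proof (rule div_curl_weak_partial_UNIV[where Q = "\<lambda>x. - P x" and A = B and B = "\<lambda>x. - A x" and K = K])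
      fix \<phi> :: "real^2 \<Rightarrow> real" assume \<phi>: "test_function UNIV \<phi>"
      show "(LINT x|lebesgue. partial_deriv 1 \<phi> x * Q x + 1 * (partial_deriv 2 \<phi> x * - P x)) = - (LINT x|lebesgue. \<phi> x * B x)"
        using curlPQ[OF \<phi>] iPQ[OF \<phi>] by simp
      have "(LINT x|lebesgue. partial_deriv 1 \<phi> x * - P x + - 1 * (partial_deriv 2 \<phi> x * Q x))
          = (LINT x|lebesgue. - (partial_deriv 1 \<phi> x * P x) - partial_deriv 2 \<phi> x * Q x)"
        by (rule Bochner_Integration.integral_cong) auto
      also have "\<dots> = - (LINT x|lebesgue. \<phi> x * - A x)"
        using divPQ[OF \<phi>] iPQ[OF \<phi>] by simp
      finally show "(LINT x|lebesgue. partial_deriv 1 \<phi> x * - P x + - 1 * (partial_deriv 2 \<phi> x * Q x)) = - (LINT x|lebesgue. \<phi> x * - A x)" .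
    qed (use i A2 B2 K(1) P0 in auto)
    ultimately show ?thesis by (simp add: P_def[abs_def] Q_def[abs_def])
  qed
  show ?thesis using has_weak_partial_locally[OF l(1) \<Omega>] has_weak_partial_locally[OF l(2) \<Omega>] loc by blast
qed

section \<open>Linear algebra of a conformal frame\<close>

lemma has_weak_partial_wpd:
  "has_weak_partial disc i f g \<Longrightarrow> has_weak_partial disc i f (wpd i f)"
  unfolding weak_partial_def by (rule someI[of "has_weak_partial disc i f" g])

lemma wpd_unique:
  assumes "has_weak_partial disc i f g"
  shows "AE x in lebesgue_on disc. wpd i f x = g x"
  by (rule weak_partial_unique[OF has_weak_partial_wpd[OF assms] assms open_ball])

text \<open>The isomorphism of \<open>\<real>\<^sup>3\<close> with the skew-symmetric matrices that takes cross products to wedge products.\<close>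

definition bivector :: "real^3 \<Rightarrow> real^3^3" where
  "bivector w = vector [vector [0, w $ 3, - (w $ 2)], vector [- (w $ 3), 0, w $ 1], vector [w $ 2, - (w $ 1), 0]]"

lemma wedge_eq_bivector: "wedge u v = bivector (cross3 u v)"
  by (simp add: vec_eq_iff forall_3 wedge_def bivector_def cross_components)

lemma linear_bivector: "linear bivector"
  by (rule linearI) (simp_all add: vec_eq_iff forall_3 bivector_def)

lemma bivector_in_Lambda2: "bivector w \<in> Lambda2"
  by (simp add: Lambda2_def vec_eq_iff forall_3 bivector_def transpose_def)

lemma wedge_simps:
  "wedge (u + u') v = wedge u v + wedge u' v" "wedge u (v + v') = wedge u v + wedge u v'"
  "wedge (c *\<^sub>R u) v = c *\<^sub>R wedge u v" "wedge u (c *\<^sub>R v) = c *\<^sub>R wedge u v"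
  "wedge (- u) v = - wedge u v" "wedge u (- v) = - wedge u v" "wedge u u = 0"
  by (simp_all add: vec_eq_iff wedge_def algebra_simps)

lemma wedge_swap: "wedge u v = - wedge v u"
  by (simp add: vec_eq_iff wedge_def)

lemma hodge_1 [simp]: "hodge \<beta> 1 = - \<beta> 2" and hodge_2 [simp]: "hodge \<beta> 2 = \<beta> 1"
  by (simp_all add: hodge_def)

lemma cross_lagrange: "cross3 x (cross3 y z) = (x \<bullet> z) *\<^sub>R y - (x \<bullet> y) *\<^sub>R z"
  by (simp add: vec_eq_iff forall_3 cross_components inner_vec_def sum_3 algebra_simps)

text \<open>The situation at a single point: \<open>a\<close> and \<open>b\<close> are the values of \<open>\<Phi>\<^sub>1\<close> and \<open>\<Phi>\<^sub>2\<close>, and \<open>s = e\<^bsup>2\<lambda>\<^esup>\<close>.\<close>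

locale conformal_frame =
  fixes a b n :: "real^3" and s :: real
  assumes len: "a \<bullet> a = s" "b \<bullet> b = s" and orth: "a \<bullet> b = 0" and s_pos: "s > 0"
    and n_eq: "n = cross3 a b /\<^sub>R norm (cross3 a b)"
begin

lemma norm_cross: "norm (cross3 a b) = s"
proof -
  have "(norm a)\<^sup>2 = s" "(norm b)\<^sup>2 = s" using len by (simp_all add: power2_norm_eq_inner)
  moreover have "(norm (cross3 a b))\<^sup>2 = (norm a)\<^sup>2 * (norm b)\<^sup>2"
    using norm_cross_dot[of a b] orth by (simp add: power_mult_distrib)
  ultimately have "(norm (cross3 a b))\<^sup>2 = s\<^sup>2" by (simp add: power2_eq_square[of s])
  then show ?thesis using s_pos by (simp add: power2_eq_iff_nonneg)
qed

lemma n_orth: "n \<bullet> a = 0" "n \<bullet> b = 0" "a \<bullet> n = 0" "b \<bullet> n = 0"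
  by (simp_all add: n_eq dot_cross_self)

lemma n_unit: "n \<bullet> n = 1"
proof -
  have "cross3 a b \<bullet> cross3 a b = s * s" using norm_cross by (metis dot_square_norm power2_eq_square)
  then show ?thesis using s_pos by (simp add: n_eq norm_cross field_simps)
qed

lemma cross_b_n: "cross3 b n = a"
  using s_pos by (simp add: n_eq norm_cross cross_mult_right cross_lagrange len orth inner_commute[of b a])

lemma cross_a_n: "cross3 a n = - b"
  using s_pos by (simp add: n_eq norm_cross cross_mult_right cross_lagrange len orth)

text \<open>Since \<open>v\<close> is orthogonal to \<open>n\<close>, it equals \<open>n \<times> (v \<times> n)\<close>, and both products are given by Lagrange's
identity and the action of \<open>n\<close> on the frame.\<close>

lemma tangential_decomposition:
  assumes "v \<bullet> n = 0"
  shows "v = ((v \<bullet> a) / s) *\<^sub>R a + ((v \<bullet> b) / s) *\<^sub>R b"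
proof -
  have vn: "cross3 v n = ((v \<bullet> b) / s) *\<^sub>R a - ((v \<bullet> a) / s) *\<^sub>R b"
    by (simp add: n_eq norm_cross cross_mult_right cross_lagrange divide_inverse scaleR_diff_right mult.commute)
  have na: "cross3 n a = b" "cross3 n b = - a" using cross_a_n cross_b_n cross_skew[of n a] cross_skew[of n b] by auto
  have "v = cross3 n (cross3 v n)" by (simp add: cross_lagrange n_unit assms inner_commute[of n v])
  also have "\<dots> = ((v \<bullet> a) / s) *\<^sub>R a + ((v \<bullet> b) / s) *\<^sub>R b"
    unfolding vn by (simp add: cross_mult_right na Cross3.right_diff_distrib)
  finally show ?thesis .
qed

end

lemma exp_conformal_factor:
  assumes "wpd 1 \<Phi> x \<bullet> wpd 1 \<Phi> x = s" "s > 0"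
  shows "exp (- (2 * conformal_factor \<Phi> x)) = 1 / s"
proof -
  have "norm (wpd 1 \<Phi> x) > 0" using assms by auto
  then have "exp (2 * conformal_factor \<Phi> x) = (norm (wpd 1 \<Phi> x))\<^sup>2"
    unfolding conformal_factor_def by (simp add: exp_double)
  also have "\<dots> = s" using assms by (simp add: power2_norm_eq_inner)
  finally show ?thesis by (simp add: exp_minus field_simps)
qed

text \<open>Only the trace of the stress tensor survives; it is \<open>0\<close> because \<open>g\<close> has trace \<open>2\<close>.\<close>

lemma dot_bracket_eq_0:
  assumes "conformal_frame (wpd 1 \<Phi> x) (wpd 2 \<Phi> x) (unit_normal \<Phi> x) s"
  shows "dot_forms (conformal_factor \<Phi> x) (hodge (differential \<Phi> x)) (bracket \<Phi> x) = 0"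
proof -
  interpret conformal_frame "wpd 1 \<Phi> x" "wpd 2 \<Phi> x" "unit_normal \<Phi> x" s by fact
  note e = exp_conformal_factor[OF len(1) s_pos]
  show ?thesis
    using s_pos
    by (simp add: power2_eq_square dot_forms_def UNIV_2 bracket_def vec_contract_def contract_def differential_def e
        vec_second_form_def stress_def norm_sq_form_def metric_def inner_add_right n_orth len orth
        inner_commute[of "wpd 2 \<Phi> x" "wpd 1 \<Phi> x"])
       (simp add: field_simps)
qed

text \<open>The stress tensor drops out by symmetry. In what remains, the symmetry of the second fundamental form
exchanges the index contracted with \<open>\<alpha>\<close> and the index contracted with \<open>*d\<Phi>\<close>.\<close>

lemma wedge_bracket_eq:
  assumes "conformal_frame (wpd 1 \<Phi> x) (wpd 2 \<Phi> x) (unit_normal \<Phi> x) s"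
    and symm: "second_form \<Phi> x 1 2 = second_form \<Phi> x 2 1"
    and alpha: "connection_form \<Phi> x 1 = - wpd 2 (conformal_factor \<Phi>) x" "connection_form \<Phi> x 2 = wpd 1 (conformal_factor \<Phi>) x"
    and D: "\<And>j. wpd j D x = - contract (conformal_factor \<Phi> x) (second_form \<Phi> x)
                (\<lambda>i. wedge (hodge (differential \<Phi> x) i) (unit_normal \<Phi> x)) j"
  shows "wedge_forms (conformal_factor \<Phi> x) (hodge (differential \<Phi> x)) (bracket \<Phi> x) =
               - pair_forms (conformal_factor \<Phi> x)
                   (hodge (differential (conformal_factor \<Phi>) x)) (differential D x)"
proof -
  interpret conformal_frame "wpd 1 \<Phi> x" "wpd 2 \<Phi> x" "unit_normal \<Phi> x" s by fact
  let ?a = "wpd 1 \<Phi> x" and ?b = "wpd 2 \<Phi> x" and ?n = "unit_normal \<Phi> x"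
  define l where "l = exp (- 2 * conformal_factor \<Phi> x)"
  have l: "exp (- (2 * conformal_factor \<Phi> x)) = l" by (simp add: l_def)
  define I where "I = second_form \<Phi> x"
  define T where "T = stress \<Phi> x"
  define \<alpha> where "\<alpha> = connection_form \<Phi> x"
  have vI: "vec_second_form \<Phi> x i j = I i j *\<^sub>R ?n" for i j by (simp add: vec_second_form_def I_def second_form_def)
  have T: "T 2 1 = T 1 2" by (simp add: T_def stress_def metric_def inner_commute)
  have I: "I 1 2 = I 2 1" using symm by (simp add: I_def)
  have B: "bracket \<Phi> x 1 = (l * (\<alpha> 1 * I 1 1 + \<alpha> 2 * I 1 2)) *\<^sub>R ?n - l *\<^sub>R (T 2 1 *\<^sub>R ?a + T 2 2 *\<^sub>R ?b)"
    "bracket \<Phi> x 2 = (l * (\<alpha> 1 * I 2 1 + \<alpha> 2 * I 2 2)) *\<^sub>R ?n + l *\<^sub>R (T 1 1 *\<^sub>R ?a + T 1 2 *\<^sub>R ?b)"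
    by (simp_all add: bracket_def vec_contract_def contract_def UNIV_2 vI differential_def
        l T_def[symmetric] \<alpha>_def[symmetric] scaleR_add_left scaleR_add_right distrib_left mult.assoc)
  have dl: "wpd 2 (conformal_factor \<Phi>) x = - \<alpha> 1" "wpd 1 (conformal_factor \<Phi>) x = \<alpha> 2"
    using alpha by (simp_all add: \<alpha>_def)
  have D': "wpd j D x = - (l *\<^sub>R (I j 2 *\<^sub>R wedge ?a ?n - I j 1 *\<^sub>R wedge ?b ?n))" for j
    unfolding D by (simp add: contract_def UNIV_2 differential_def wedge_simps I_def l)
  define X where "X = wedge ?a ?n"
  define Y where "Y = wedge ?b ?n"
  define Z where "Z = wedge ?a ?b"
  have ba: "wedge ?b ?a = - Z" unfolding Z_def by (rule wedge_swap)
  \<comment> \<open>the two coefficients of \<open>Z\<close> come from the stress tensor and cancel by its symmetry\<close>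
  have wB: "wedge ?b (bracket \<Phi> x 1) = (l * (\<alpha> 1 * I 1 1 + \<alpha> 2 * I 1 2)) *\<^sub>R Y + (l * T 2 1) *\<^sub>R Z"
    "wedge ?a (bracket \<Phi> x 2) = (l * (\<alpha> 1 * I 2 1 + \<alpha> 2 * I 2 2)) *\<^sub>R X + (l * T 1 2) *\<^sub>R Z"
    unfolding B diff_conv_add_uminus by (simp_all only: wedge_simps ba X_def[symmetric] Y_def[symmetric] Z_def[symmetric] scaleR_scaleR)
       (simp_all add: vec_eq_iff)
  have "wedge_forms (conformal_factor \<Phi> x) (hodge (differential \<Phi> x)) (bracket \<Phi> x)
      = l *\<^sub>R (- wedge ?b (bracket \<Phi> x 1) + wedge ?a (bracket \<Phi> x 2))"
    by (simp add: wedge_forms_def UNIV_2 differential_def wedge_simps l)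
  also have "\<dots> = l *\<^sub>R ((l * (\<alpha> 1 * I 2 1 + \<alpha> 2 * I 2 2)) *\<^sub>R X - (l * (\<alpha> 1 * I 1 1 + \<alpha> 2 * I 1 2)) *\<^sub>R Y)"
    unfolding wB by (simp add: T)
  also have "\<dots> = - (l *\<^sub>R (\<alpha> 1 *\<^sub>R - (l *\<^sub>R (I 1 2 *\<^sub>R X - I 1 1 *\<^sub>R Y)) + \<alpha> 2 *\<^sub>R - (l *\<^sub>R (I 2 2 *\<^sub>R X - I 2 1 *\<^sub>R Y))))"
    unfolding I by (simp add: vec_eq_iff algebra_simps)
  also have "\<dots> = - pair_forms (conformal_factor \<Phi> x) (hodge (differential (conformal_factor \<Phi>) x)) (differential D x)"
    by (simp add: pair_forms_def UNIV_2 differential_def dl D' l X_def Y_def)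
  finally show ?thesis .
qed

text \<open>With \<open>N = \<partial>\<^sub>jn\<close> the second assumption is the Weingarten equation. The quarter turns
\<open>b \<times> n = a\<close> and \<open>a \<times> n = - b\<close> undo the Hodge operator up to sign, so the contraction is the tangential decomposition of \<open>N\<close>.\<close>

lemma potential_gradient_eq:
  assumes "conformal_frame (wpd 1 \<Phi> x) (wpd 2 \<Phi> x) (unit_normal \<Phi> x) s"
    and N: "N \<bullet> unit_normal \<Phi> x = 0" "\<And>i. second_form \<Phi> x j i = - (N \<bullet> wpd i \<Phi> x)"
  shows "- contract (conformal_factor \<Phi> x) (second_form \<Phi> x)
            (\<lambda>i. wedge (hodge (differential \<Phi> x) i) (unit_normal \<Phi> x)) j = - bivector N"
proof -
  interpret conformal_frame "wpd 1 \<Phi> x" "wpd 2 \<Phi> x" "unit_normal \<Phi> x" s by fact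
  interpret bv: linear bivector by (rule linear_bivector)
  have "contract (conformal_factor \<Phi> x) (second_form \<Phi> x)
            (\<lambda>i. wedge (hodge (differential \<Phi> x) i) (unit_normal \<Phi> x)) j
      = bivector (((N \<bullet> wpd 1 \<Phi> x) / s) *\<^sub>R wpd 1 \<Phi> x + ((N \<bullet> wpd 2 \<Phi> x) / s) *\<^sub>R wpd 2 \<Phi> x)"
    by (simp add: contract_def UNIV_2 differential_def wedge_eq_bivector cross_b_n cross_a_n exp_conformal_factor[OF len(1) s_pos]
        N(2) bv.add bv.scale bv.neg scaleR_add_right)
  then show ?thesis using tangential_decomposition[OF N(1)] by simp
qed

section \<open>Locally square integrable functions\<close>

lemma locally_integrable_bound:
  fixes f h :: "real^'n::finite \<Rightarrow> real"
  assumes "locally_integrable \<Omega> h" "f \<in> borel_measurable (lebesgue_on \<Omega>)" "\<And>x. \<bar>f x\<bar> \<le> h x"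
  shows "locally_integrable \<Omega> f"
  unfolding locally_integrable_def
proof (intro allI impI)
  fix K assume K: "compact K \<and> K \<subseteq> \<Omega>"
  have "integrable (lebesgue_on K) h" using assms(1) K by (auto simp: locally_integrable_def)
  then show "integrable (lebesgue_on K) f"
  proof (rule Bochner_Integration.integrable_bound)
    show "f \<in> borel_measurable (lebesgue_on K)" using measurable_restrict_mono[OF assms(2)] K by blast
    show "AE x in lebesgue_on K. norm (f x) \<le> norm (h x)"
      by (rule AE_I2) (use assms(3) in \<open>auto intro: order_trans[OF _ abs_ge_self]\<close>)
  qed
qed

text \<open>Measurability is included because the square of a function does not determine it.\<close>

definition locally_L2 :: "(real^'n::finite) set \<Rightarrow> (real^'n \<Rightarrow> real) \<Rightarrow> bool" where
  "locally_L2 \<Omega> f \<longleftrightarrow> f \<in> borel_measurable (lebesgue_on \<Omega>) \<and> locally_integrable \<Omega> (\<lambda>x. (f x)\<^sup>2)"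

lemma locally_L2_imp_locally_integrable:
  assumes "locally_L2 \<Omega> f" shows "locally_integrable \<Omega> f"
proof (rule locally_integrable_bound)
  show "locally_integrable \<Omega> (\<lambda>x. 1 + (f x)\<^sup>2)"
    using assms by (intro locally_integrable_add locally_integrable_const) (simp add: locally_L2_def)
  show "\<bar>f x\<bar> \<le> 1 + (f x)\<^sup>2" for x
  proof -
    have "0 \<le> (\<bar>f x\<bar> - 1)\<^sup>2" by simp
    then show ?thesis by (simp add: power2_diff)
  qed
qed (use assms in \<open>simp add: locally_L2_def\<close>)

lemma locally_L2_bounded:
  fixes f :: "real^'n::finite \<Rightarrow> real"
  assumes "f \<in> borel_measurable (lebesgue_on \<Omega>)" "AE x in lebesgue_on \<Omega>. \<bar>f x\<bar> \<le> M" "open \<Omega>"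
  shows "locally_L2 \<Omega> f"
proof -
  have "locally_integrable \<Omega> (\<lambda>x. f x * 1)" by (rule locally_integrable_mult_bounded[OF assms(1,2) locally_integrable_const assms(3)])
  then have "locally_integrable \<Omega> (\<lambda>x. f x * f x)" using locally_integrable_mult_bounded[OF assms(1,2) _ assms(3), of f] by simp
  then show ?thesis using assms(1) by (simp add: locally_L2_def power2_eq_square)
qed

lemma locally_L2_mult_bounded:
  fixes f g :: "real^'n::finite \<Rightarrow> real"
  assumes "f \<in> borel_measurable (lebesgue_on \<Omega>)" "AE x in lebesgue_on \<Omega>. \<bar>f x\<bar> \<le> M" "locally_L2 \<Omega> g" "open \<Omega>"
  shows "locally_L2 \<Omega> (\<lambda>x. f x * g x)"
proof -
  have "locally_integrable \<Omega> (\<lambda>x. f x * (f x * (g x)\<^sup>2))"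
    using assms(3) by (intro locally_integrable_mult_bounded[OF assms(1,2) _ assms(4)]) (simp add: locally_L2_def)
  then show ?thesis using assms by (simp add: locally_L2_def power2_eq_square mult_ac borel_measurable_times)
qed

lemma locally_L2_diff:
  fixes f g :: "real^'n::finite \<Rightarrow> real"
  assumes "locally_L2 \<Omega> f" "locally_L2 \<Omega> g"
  shows "locally_L2 \<Omega> (\<lambda>x. f x - g x)"
proof -
  have m: "f \<in> borel_measurable (lebesgue_on \<Omega>)" "g \<in> borel_measurable (lebesgue_on \<Omega>)" using assms by (auto simp: locally_L2_def)
  have le: "(a - b)\<^sup>2 \<le> (a\<^sup>2 + b\<^sup>2) + (a\<^sup>2 + b\<^sup>2)" for a b :: real
    using zero_le_power2[of "a + b"] by (simp add: power2_eq_square algebra_simps)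
  have "locally_integrable \<Omega> (\<lambda>x. ((f x)\<^sup>2 + (g x)\<^sup>2) + ((f x)\<^sup>2 + (g x)\<^sup>2))"
    using assms by (intro locally_integrable_add) (auto simp: locally_L2_def)
  then have "locally_integrable \<Omega> (\<lambda>x. (f x - g x)\<^sup>2)"
    by (rule locally_integrable_bound) (use m le in auto)
  then show ?thesis using m by (simp add: locally_L2_def)
qed

lemma L_two_imp_locally_L2_nth:
  fixes g :: "real^'n::finite \<Rightarrow> real^'m::finite"
  assumes "L_two \<Omega> g" "open \<Omega>"
  shows "locally_L2 \<Omega> (\<lambda>x. g x $ b)"
proof -
  have m: "g \<in> borel_measurable (lebesgue_on \<Omega>)" "integrable (lebesgue_on \<Omega>) (\<lambda>x. (norm (g x))\<^sup>2)"
    using assms(1) by (auto simp: L_two_def)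
  have mb: "(\<lambda>x. g x $ b) \<in> borel_measurable (lebesgue_on \<Omega>)"
    using borel_measurable_continuous_onI[OF linear_continuous_on[OF bounded_linear_vec_nth[of b]]] m(1)
    by (rule measurable_compose_rev)
  have "locally_integrable \<Omega> (\<lambda>x. (g x $ b)\<^sup>2)"
  proof (rule locally_integrable_bound[OF locally_integrable_if_integrable_on[OF m(2) assms(2)]])
    show "\<bar>(g x $ b)\<^sup>2\<bar> \<le> (norm (g x))\<^sup>2" for x
      using power_mono[OF component_le_norm_cart[of "g x" b], of 2] by simp
  qed (use mb in simp)
  then show ?thesis using mb by (simp add: locally_L2_def)
qed

section \<open>Weak conformal immersions\<close>

text \<open>The three components of a cross product, treated uniformly.\<close>

lemma cross3_nth:
  obtains a b :: 3 where "\<And>u v. cross3 u v $ k = u $ a * v $ b - u $ b * v $ a"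
proof -
  have "k = 1 \<or> k = 2 \<or> k = 3" by (rule exhaust_3)
  then show thesis
    using that[of 2 3] that[of 3 1] that[of 1 2] by (auto simp: cross_components)
qed

lemma has_weak_partial_nth:
  fixes f :: "real^'n::finite \<Rightarrow> real^'m::finite"
  shows "has_weak_partial \<Omega> i f g \<Longrightarrow> open \<Omega> \<Longrightarrow> has_weak_partial \<Omega> i (\<lambda>x. f x $ b) (\<lambda>x. g x $ b)"
  by (rule has_weak_partial_linear[OF bounded_linear_vec_nth])

lemma has_weak_partial_vecI:
  fixes f :: "real^'n::finite \<Rightarrow> real^'m::finite"
  assumes "\<And>k. \<exists>w. has_weak_partial \<Omega> i (\<lambda>x. f x $ k) w" "open \<Omega>"
  shows "\<exists>w. has_weak_partial \<Omega> i f w"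
proof -
  obtain w where w: "\<And>k. has_weak_partial \<Omega> i (\<lambda>x. f x $ k) (w k)" using assms(1) by metis
  have "has_weak_partial \<Omega> i f (\<lambda>x. \<chi> k. w k x)"
  proof (rule has_weak_partial_componentwise[OF _ assms(2)])
    fix b :: "real^'m" assume "b \<in> Basis"
    then obtain k where b: "b = axis k 1" by (auto simp: Basis_vec_def)
    show "has_weak_partial \<Omega> i (\<lambda>x. f x \<bullet> b) (\<lambda>x. (\<chi> k. w k x) \<bullet> b)"
      using w[of k] by (simp add: b inner_axis)
  qed
  then show ?thesis by blast
qed

lemma abs_nth_le: "norm (v :: real^'m::finite) \<le> M \<Longrightarrow> \<bar>v $ k\<bar> \<le> M"
  using component_le_norm_cart[of v k] by simp

locale weak_conformal_immersion =
  fixes \<Phi> :: "real^2 \<Rightarrow> real^3"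
  assumes immersion: "\<Phi> \<in> weak_immersions" and conformal: "weakly_conformal \<Phi>"
begin

abbreviation "n \<equiv> unit_normal \<Phi>"

lemma weak_partial_immersion: "has_weak_partial disc i \<Phi> (wpd i \<Phi>)"
  using immersion has_weak_partial_wpd unfolding weak_immersions_def W_1_infinity_def by blast

lemma normal_W12: "\<exists>g. has_weak_partial disc i n g \<and> L_two disc g"
  using immersion unfolding weak_immersions_def W_1_two_def by blast

lemma weak_partial_normal: "has_weak_partial disc i n (wpd i n)"
  using normal_W12 has_weak_partial_wpd by blast

lemma metric_bounds:
  obtains C where "C > 0" "AE x in lebesgue_on disc. \<forall>i. 1 / C \<le> wpd i \<Phi> x \<bullet> wpd i \<Phi> x \<and> wpd i \<Phi> x \<bullet> wpd i \<Phi> x \<le> C"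
proof -
  obtain C where C: "C > 0" "AE x in lebesgue_on disc. \<forall>v::real^2.
        (norm v)\<^sup>2 / C \<le> (\<Sum>i\<in>UNIV. \<Sum>j\<in>UNIV. metric \<Phi> x i j * v $ i * v $ j) \<and>
        (\<Sum>i\<in>UNIV. \<Sum>j\<in>UNIV. metric \<Phi> x i j * v $ i * v $ j) \<le> C * (norm v)\<^sup>2"
    using immersion unfolding weak_immersions_def by blast
  \<comment> \<open>evaluate the quadratic form on the coordinate vectors\<close>
  have s: "(\<Sum>i\<in>UNIV. \<Sum>j\<in>UNIV. metric \<Phi> x i j * axis k 1 $ i * axis k 1 $ j) = wpd k \<Phi> x \<bullet> wpd k \<Phi> x" for x and k :: 2
    using exhaust_2[of k] by (auto simp: UNIV_2 axis_def metric_def)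
  have "AE x in lebesgue_on disc. \<forall>i. 1 / C \<le> wpd i \<Phi> x \<bullet> wpd i \<Phi> x \<and> wpd i \<Phi> x \<bullet> wpd i \<Phi> x \<le> C"
    using C(2)
  proof eventually_elim
    fix x assume *: "\<forall>v::real^2.
        (norm v)\<^sup>2 / C \<le> (\<Sum>i\<in>UNIV. \<Sum>j\<in>UNIV. metric \<Phi> x i j * v $ i * v $ j) \<and>
        (\<Sum>i\<in>UNIV. \<Sum>j\<in>UNIV. metric \<Phi> x i j * v $ i * v $ j) \<le> C * (norm v)\<^sup>2"
    show "\<forall>i. 1 / C \<le> wpd i \<Phi> x \<bullet> wpd i \<Phi> x \<and> wpd i \<Phi> x \<bullet> wpd i \<Phi> x \<le> C"
      using *[rule_format, of "axis _ 1"] by (simp only: s) simp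
  qed
  with C(1) that show thesis by blast
qed

text \<open>The lower metric bound excludes the degenerate case, so that the algebra of \<open>conformal_frame\<close> is available at almost
every point.\<close>

lemma AE_conformal_frame:
  "AE x in lebesgue_on disc. conformal_frame (wpd 1 \<Phi> x) (wpd 2 \<Phi> x) (n x) (wpd 1 \<Phi> x \<bullet> wpd 1 \<Phi> x)"
proof -
  obtain C where C: "C > 0" "AE x in lebesgue_on disc. \<forall>i. 1 / C \<le> wpd i \<Phi> x \<bullet> wpd i \<Phi> x \<and> wpd i \<Phi> x \<bullet> wpd i \<Phi> x \<le> C"
    by (rule metric_bounds) (rule that)
  have c: "AE x in lebesgue_on disc. norm (wpd 1 \<Phi> x) = norm (wpd 2 \<Phi> x) \<and> wpd 1 \<Phi> x \<bullet> wpd 2 \<Phi> x = 0"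
    using conformal by (simp only: weakly_conformal_def)
  from C(2) c show ?thesis
  proof eventually_elim
    fix x assume 1: "\<forall>i. 1 / C \<le> wpd i \<Phi> x \<bullet> wpd i \<Phi> x \<and> wpd i \<Phi> x \<bullet> wpd i \<Phi> x \<le> C"
      and 2: "norm (wpd 1 \<Phi> x) = norm (wpd 2 \<Phi> x) \<and> wpd 1 \<Phi> x \<bullet> wpd 2 \<Phi> x = 0"
    have "0 < 1 / C" using C(1) by simp
    also have "\<dots> \<le> wpd 1 \<Phi> x \<bullet> wpd 1 \<Phi> x" using 1 by blast
    finally show "conformal_frame (wpd 1 \<Phi> x) (wpd 2 \<Phi> x) (n x) (wpd 1 \<Phi> x \<bullet> wpd 1 \<Phi> x)"
      using 2 by unfold_locales (auto simp: dot_square_norm unit_normal_def)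
  qed
qed

lemma bounded_partials:
  obtains M where "\<And>i. AE x in lebesgue_on disc. norm (wpd i \<Phi> x) \<le> M"
proof -
  obtain C where C: "C > 0" "AE x in lebesgue_on disc. \<forall>i. 1 / C \<le> wpd i \<Phi> x \<bullet> wpd i \<Phi> x \<and> wpd i \<Phi> x \<bullet> wpd i \<Phi> x \<le> C"
    by (rule metric_bounds) (rule that)
  have "AE x in lebesgue_on disc. norm (wpd i \<Phi> x) \<le> sqrt C" for i
    using C(2) by eventually_elim (simp add: norm_eq_sqrt_inner)
  then show thesis by (rule that)
qed

lemma norm_normal_le: "norm (n x) \<le> 1"
  by (cases "cross3 (wpd 1 \<Phi> x) (wpd 2 \<Phi> x) = 0") (simp_all add: unit_normal_def)

text \<open>Componentwise, \<open>\<Phi>\<^sub>1 = \<Phi>\<^sub>2 \<times> n\<close> and \<open>\<Phi>\<^sub>2 = - \<Phi>\<^sub>1 \<times> n\<close> are differences of products of a first derivative of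
\<open>\<Phi>\<close> and a component of \<open>n\<close>. The null Lagrangian identity computes their divergence without second
derivatives of \<open>\<Phi>\<close>.\<close>

lemma second_weak_partial_ex:
  "\<exists>w. has_weak_partial disc j (wpd i \<Phi>) w"
proof (rule has_weak_partial_vecI[OF _ open_ball])
  fix k :: 3
  obtain a b :: 3 where ab: "\<And>u v. cross3 u v $ k = u $ a * v $ b - u $ b * v $ a" by (rule cross3_nth) (rule that)
  obtain M where M: "\<And>i. AE x in lebesgue_on disc. norm (wpd i \<Phi> x) \<le> M" by (rule bounded_partials) (rule that)
  obtain g where g: "\<And>i. has_weak_partial disc i n (g i)" "\<And>i. L_two disc (g i)" using normal_W12 by metis
  have bd: "AE x in lebesgue_on disc. \<bar>wpd i \<Phi> x $ c\<bar> \<le> M" for i c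
    using M[of i] by eventually_elim (rule abs_nth_le)
  have w\<Phi>: "has_weak_partial disc i (\<lambda>x. \<Phi> x $ c) (\<lambda>x. wpd i \<Phi> x $ c)" for i c
    by (rule has_weak_partial_nth[OF weak_partial_immersion open_ball])
  have wn: "has_weak_partial disc i (\<lambda>x. n x $ c) (\<lambda>x. g i x $ c)" for i c
    by (rule has_weak_partial_nth[OF g(1) open_ball])
  have ld: "locally_integrable disc (\<lambda>x. wpd i \<Phi> x $ c)" "locally_integrable disc (\<lambda>x. n x $ c)" "locally_integrable disc (\<lambda>x. g i x $ c)" for i c
    using w\<Phi>[of i c] wn[of i c] by (auto simp: has_weak_partial_def)
  have md: "(\<lambda>x. wpd i \<Phi> x $ c) \<in> borel_measurable (lebesgue_on disc)" for i c
    by (rule locally_integrable_measurable_on[OF ld(1) open_ball])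
  have lm: "locally_integrable disc (\<lambda>x. wpd i \<Phi> x $ c * h x)" if "locally_integrable disc h" for i c h
    by (rule locally_integrable_mult_bounded[OF md bd that open_ball])
  \<comment> \<open>the divergence of \<open>(\<Phi>\<^sub>2 n, - \<Phi>\<^sub>1 n)\<close> for component \<open>c\<close> of \<open>\<Phi>\<close> and component \<open>d\<close> of \<open>n\<close>\<close>
  define G where "G c d x = wpd 2 \<Phi> x $ c * g 1 x $ d - wpd 1 \<Phi> x $ c * g 2 x $ d" for c d x
  have G2: "locally_L2 disc (G c d)" for c d
    unfolding G_def[abs_def]
    by (intro locally_L2_diff locally_L2_mult_bounded[OF md bd _ open_ball] L_two_imp_locally_L2_nth[OF g(2) open_ball])
  define F where "F x = G a b x - G b a x" for x
  have F2: "locally_L2 disc F" unfolding F_def[abs_def] by (intro locally_L2_diff G2)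
  have divG: "(LINT x|lebesgue. partial_deriv 1 \<phi> x * (wpd 2 \<Phi> x $ c * n x $ d)) - (LINT x|lebesgue. partial_deriv 2 \<phi> x * (wpd 1 \<Phi> x $ c * n x $ d))
      = - (LINT x|lebesgue. \<phi> x * G c d x)" if \<phi>: "test_function disc \<phi>" for \<phi> c d
  proof -
    note d\<phi> = test_function_partial_deriv[OF \<phi>]
    have i: "integrable lebesgue (\<lambda>x. \<phi> x * (wpd 2 \<Phi> x $ c * g 1 x $ d))" "integrable lebesgue (\<lambda>x. \<phi> x * (wpd 1 \<Phi> x $ c * g 2 x $ d))"
      "integrable lebesgue (\<lambda>x. partial_deriv 1 \<phi> x * (wpd 2 \<Phi> x $ c * n x $ d))" "integrable lebesgue (\<lambda>x. partial_deriv 2 \<phi> x * (wpd 1 \<Phi> x $ c * n x $ d))"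
      by (rule integrable_test_function_mult[OF \<phi> lm[OF ld(3)]] integrable_test_function_mult[OF d\<phi> lm[OF ld(2)]])+
    have "(LINT x|lebesgue. \<phi> x * (wpd 2 \<Phi> x $ c * g 1 x $ d) + partial_deriv 1 \<phi> x * (wpd 2 \<Phi> x $ c * n x $ d))
        = (LINT x|lebesgue. (\<phi> x * g 1 x $ d + partial_deriv 1 \<phi> x * n x $ d) * wpd 2 \<Phi> x $ c)"
      by (rule Bochner_Integration.integral_cong) (auto simp: algebra_simps)
    also have "\<dots> = (LINT x|lebesgue. (\<phi> x * g 2 x $ d + partial_deriv 2 \<phi> x * n x $ d) * wpd 1 \<Phi> x $ c)"
      by (rule weak_jacobian_null_lagrangian[OF w\<Phi> w\<Phi> bd bd wn wn open_ball \<phi>])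
    also have "\<dots> = (LINT x|lebesgue. \<phi> x * (wpd 1 \<Phi> x $ c * g 2 x $ d) + partial_deriv 2 \<phi> x * (wpd 1 \<Phi> x $ c * n x $ d))"
      by (rule Bochner_Integration.integral_cong) (auto simp: algebra_simps)
    finally have "(LINT x|lebesgue. \<phi> x * (wpd 2 \<Phi> x $ c * g 1 x $ d)) + (LINT x|lebesgue. partial_deriv 1 \<phi> x * (wpd 2 \<Phi> x $ c * n x $ d))
       = (LINT x|lebesgue. \<phi> x * (wpd 1 \<Phi> x $ c * g 2 x $ d)) + (LINT x|lebesgue. partial_deriv 2 \<phi> x * (wpd 1 \<Phi> x $ c * n x $ d))"
      unfolding Bochner_Integration.integral_add[OF i(1,3)] Bochner_Integration.integral_add[OF i(2,4)] .
    moreover have "(LINT x|lebesgue. \<phi> x * G c d x) = (LINT x|lebesgue. \<phi> x * (wpd 2 \<Phi> x $ c * g 1 x $ d)) - (LINT x|lebesgue. \<phi> x * (wpd 1 \<Phi> x $ c * g 2 x $ d))"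
      unfolding G_def right_diff_distrib by (rule Bochner_Integration.integral_diff[OF i(1,2)])
    ultimately show ?thesis by linarith
  qed
  have ae: "AE x in lebesgue_on disc. wpd 1 \<Phi> x $ k = wpd 2 \<Phi> x $ a * n x $ b - wpd 2 \<Phi> x $ b * n x $ a"
    "AE x in lebesgue_on disc. wpd 2 \<Phi> x $ k = wpd 1 \<Phi> x $ b * n x $ a - wpd 1 \<Phi> x $ a * n x $ b"
  proof -
    have *: "AE x in lebesgue_on disc. cross3 (wpd 2 \<Phi> x) (n x) = wpd 1 \<Phi> x \<and> cross3 (wpd 1 \<Phi> x) (n x) = - wpd 2 \<Phi> x"
      using AE_conformal_frame by eventually_elim (simp add: conformal_frame.cross_b_n conformal_frame.cross_a_n)
    show "AE x in lebesgue_on disc. wpd 1 \<Phi> x $ k = wpd 2 \<Phi> x $ a * n x $ b - wpd 2 \<Phi> x $ b * n x $ a"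
      using * by eventually_elim (metis ab)
    show "AE x in lebesgue_on disc. wpd 2 \<Phi> x $ k = wpd 1 \<Phi> x $ b * n x $ a - wpd 1 \<Phi> x $ a * n x $ b"
      using *
    proof eventually_elim
      fix x assume "cross3 (wpd 2 \<Phi> x) (n x) = wpd 1 \<Phi> x \<and> cross3 (wpd 1 \<Phi> x) (n x) = - wpd 2 \<Phi> x"
      then have "cross3 (wpd 1 \<Phi> x) (n x) $ k = - (wpd 2 \<Phi> x $ k)" by simp
      then show "wpd 2 \<Phi> x $ k = wpd 1 \<Phi> x $ b * n x $ a - wpd 1 \<Phi> x $ a * n x $ b" by (simp add: ab)
    qed
  qed
  \<comment> \<open>replaces a component of \<open>\<Phi>\<^sub>1\<close> or \<open>\<Phi>\<^sub>2\<close> by its expression as a cross product under the integral\<close>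
  have swap: "(LINT x|lebesgue. \<psi> x * (wpd i \<Phi> x $ k)) = (LINT x|lebesgue. \<psi> x * (wpd i' \<Phi> x $ c * n x $ d)) - (LINT x|lebesgue. \<psi> x * (wpd i' \<Phi> x $ d * n x $ c))"
    if \<psi>: "test_function disc \<psi>" and e: "AE x in lebesgue_on disc. wpd i \<Phi> x $ k = wpd i' \<Phi> x $ c * n x $ d - wpd i' \<Phi> x $ d * n x $ c" for \<psi> i i' c d
  proof -
    note ii = integrable_test_function_mult[OF \<psi> lm[OF ld(2)], of i' c d] integrable_test_function_mult[OF \<psi> lm[OF ld(2)], of i' d c]
    have "(LINT x|lebesgue. \<psi> x * (wpd i \<Phi> x $ k)) = (LINT x|lebesgue. \<psi> x * (wpd i' \<Phi> x $ c * n x $ d) - \<psi> x * (wpd i' \<Phi> x $ d * n x $ c))"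
    proof (rule integral_cong_AE)
      show "(\<lambda>x. \<psi> x * (wpd i \<Phi> x $ k)) \<in> borel_measurable lebesgue"
        by (rule borel_measurable_integrable[OF integrable_test_function_mult[OF \<psi> ld(1)]])
      show "(\<lambda>x. \<psi> x * (wpd i' \<Phi> x $ c * n x $ d) - \<psi> x * (wpd i' \<Phi> x $ d * n x $ c)) \<in> borel_measurable lebesgue"
        using ii by auto
      show "AE x in lebesgue. \<psi> x * (wpd i \<Phi> x $ k) = \<psi> x * (wpd i' \<Phi> x $ c * n x $ d) - \<psi> x * (wpd i' \<Phi> x $ d * n x $ c)"
        using e[unfolded AE_lebesgue_on_iff[OF open_sets_lebesgue[OF open_ball]]]
      proof eventually_elim
        fix x assume *: "x \<in> disc \<longrightarrow> wpd i \<Phi> x $ k = wpd i' \<Phi> x $ c * n x $ d - wpd i' \<Phi> x $ d * n x $ c"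
        show "\<psi> x * (wpd i \<Phi> x $ k) = \<psi> x * (wpd i' \<Phi> x $ c * n x $ d) - \<psi> x * (wpd i' \<Phi> x $ d * n x $ c)"
        proof (cases "x \<in> disc")
          case True
          then show ?thesis using * by (simp add: right_diff_distrib)
        next
          case False
          then have "\<psi> x = 0" by (rule test_function_outside[OF \<psi>])
          then show ?thesis by simp
        qed
      qed
    qed
    also have "\<dots> = (LINT x|lebesgue. \<psi> x * (wpd i' \<Phi> x $ c * n x $ d)) - (LINT x|lebesgue. \<psi> x * (wpd i' \<Phi> x $ d * n x $ c))"
      by (rule Bochner_Integration.integral_diff[OF ii])
    finally show ?thesis .
  qed
  have "(\<exists>w. has_weak_partial disc j (\<lambda>x. wpd 1 \<Phi> x $ k) w) \<and> (\<exists>w. has_weak_partial disc j (\<lambda>x. wpd 2 \<Phi> x $ k) w)"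
  proof (rule div_curl_weak_partial[OF open_ball w\<Phi> w\<Phi>])
    have "locally_L2 disc (\<lambda>x. wpd i \<Phi> x $ k)" for i by (rule locally_L2_bounded[OF md bd open_ball])
    then show "locally_integrable disc (\<lambda>x. (wpd 1 \<Phi> x $ k)\<^sup>2)" "locally_integrable disc (\<lambda>x. (wpd 2 \<Phi> x $ k)\<^sup>2)"
      by (auto simp: locally_L2_def)
    show "locally_integrable disc F" by (rule locally_L2_imp_locally_integrable[OF F2])
    show "locally_integrable disc (\<lambda>x. (F x)\<^sup>2)" using F2 by (simp add: locally_L2_def)
    fix \<phi> assume \<phi>: "test_function disc \<phi>"
    note iG = integrable_test_function_mult[OF \<phi> locally_L2_imp_locally_integrable[OF G2]]
    have "(LINT x|lebesgue. \<phi> x * F x) = (LINT x|lebesgue. \<phi> x * G a b x) - (LINT x|lebesgue. \<phi> x * G b a x)"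
      unfolding F_def right_diff_distrib by (rule Bochner_Integration.integral_diff[OF iG iG])
    then show "(LINT x|lebesgue. partial_deriv 1 \<phi> x * wpd 1 \<Phi> x $ k) + (LINT x|lebesgue. partial_deriv 2 \<phi> x * wpd 2 \<Phi> x $ k)
        = - (LINT x|lebesgue. \<phi> x * F x)"
      using swap[OF test_function_partial_deriv[OF \<phi>] ae(1), of 1] swap[OF test_function_partial_deriv[OF \<phi>] ae(2), of 2]
        divG[OF \<phi>, of a b] divG[OF \<phi>, of b a] by linarith
  qed
  then show "\<exists>w. has_weak_partial disc j (\<lambda>x. wpd i \<Phi> x $ k) w"
    using exhaust_2[of i] by auto
qed

lemma second_weak_partial: "has_weak_partial disc j (wpd i \<Phi>) (wpd j (wpd i \<Phi>))"
  using second_weak_partial_ex has_weak_partial_wpd by blast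

text \<open>This holds at every point, since \<open>ln 0 = 0\<close>.\<close>

lemma conformal_factor_eq: "conformal_factor \<Phi> x = ln (wpd 1 \<Phi> x \<bullet> wpd 1 \<Phi> x) / 2"
proof (cases "wpd 1 \<Phi> x = 0")
  case False
  then have "wpd 1 \<Phi> x \<bullet> wpd 1 \<Phi> x > 0" by simp
  then show ?thesis by (simp add: conformal_factor_def norm_eq_sqrt_inner ln_sqrt)
qed (simp add: conformal_factor_def)

lemma inner_partials_derivative:
  "has_weak_partial disc j (\<lambda>x. wpd i \<Phi> x \<bullet> wpd k \<Phi> x)
     (\<lambda>x. wpd i \<Phi> x \<bullet> wpd j (wpd k \<Phi>) x + wpd k \<Phi> x \<bullet> wpd j (wpd i \<Phi>) x)"
proof -
  obtain M where M: "\<And>i. AE x in lebesgue_on disc. norm (wpd i \<Phi> x) \<le> M" by (rule bounded_partials) (rule that)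
  show ?thesis by (rule has_weak_partial_inner[OF second_weak_partial M second_weak_partial M open_ball])
qed

text \<open>\<open>|\<Phi>\<^sub>1|\<^sup>2\<close> takes almost all its values in a compact subinterval of the positive reals.\<close>

lemma chain_on_length:
  assumes G: "\<And>y. y > 0 \<Longrightarrow> (G has_real_derivative G' y) (at y)" "continuous_on {0<..} G'"
    and m: "G \<in> borel_measurable borel" "G' \<in> borel_measurable borel"
  shows "has_weak_partial disc j (\<lambda>x. G (wpd 1 \<Phi> x \<bullet> wpd 1 \<Phi> x))
     (\<lambda>x. G' (wpd 1 \<Phi> x \<bullet> wpd 1 \<Phi> x) * (2 * (wpd 1 \<Phi> x \<bullet> wpd j (wpd 1 \<Phi>) x)))"
proof -
  obtain C where C: "C > 0" "AE x in lebesgue_on disc. \<forall>i. 1 / C \<le> wpd i \<Phi> x \<bullet> wpd i \<Phi> x \<and> wpd i \<Phi> x \<bullet> wpd i \<Phi> x \<le> C"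
    by (rule metric_bounds) (rule that)
  have w: "has_weak_partial disc j (\<lambda>x. wpd 1 \<Phi> x \<bullet> wpd 1 \<Phi> x) (\<lambda>x. 2 * (wpd 1 \<Phi> x \<bullet> wpd j (wpd 1 \<Phi>) x))"
    using inner_partials_derivative[of j 1 1] by (simp only: mult_2)
  show ?thesis
  proof (rule has_weak_partial_chain[OF w _ _ open_ball])
    \<comment> \<open>the maximum makes the interval nonempty whatever the size of \<open>C\<close>\<close>
    show "AE x in lebesgue_on disc. wpd 1 \<Phi> x \<bullet> wpd 1 \<Phi> x \<in> {1 / C .. max C (1 / C)}"
      using C(2) by eventually_elim (auto simp: le_max_iff_disj)
    show "(G has_real_derivative G' y) (at y)" if "y \<in> {1 / C .. max C (1 / C)}" for y
    proof (rule G(1))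
      have "0 < 1 / C" using C(1) by simp
      also have "\<dots> \<le> y" using that by simp
      finally show "0 < y" .
    qed
    show "continuous_on {1 / C .. max C (1 / C)} G'"
    proof (rule continuous_on_subset[OF G(2)])
      have pos: "0 < 1 / C" using C(1) by simp
      show "{1 / C .. max C (1 / C)} \<subseteq> {0<..}"
        unfolding subset_iff atLeastAtMost_iff greaterThan_iff using less_le_trans[OF pos] by blast
    qed
  qed (use m in auto)
qed

lemma weak_partial_conformal_factor:
  "has_weak_partial disc j (conformal_factor \<Phi>)
     (\<lambda>x. (wpd 1 \<Phi> x \<bullet> wpd j (wpd 1 \<Phi>) x) / (wpd 1 \<Phi> x \<bullet> wpd 1 \<Phi> x))"
proof -
  have "has_weak_partial disc j (\<lambda>x. ln (wpd 1 \<Phi> x \<bullet> wpd 1 \<Phi> x) / 2)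
     (\<lambda>x. (inverse (wpd 1 \<Phi> x \<bullet> wpd 1 \<Phi> x) / 2) * (2 * (wpd 1 \<Phi> x \<bullet> wpd j (wpd 1 \<Phi>) x)))"
    by (rule chain_on_length[of "\<lambda>y. ln y / 2" "\<lambda>y. inverse y / 2"])
       (auto intro!: derivative_eq_intros continuous_intros simp: divide_simps)
  moreover have "(\<lambda>x. ln (wpd 1 \<Phi> x \<bullet> wpd 1 \<Phi> x) / 2) = conformal_factor \<Phi>"
    by (rule ext) (simp only: conformal_factor_eq)
  moreover have "(inverse s / 2) * (2 * h) = h / s" for s h :: real
    by (cases "s = 0") (simp_all add: field_simps)
  ultimately show ?thesis by (simp only:)
qed

text \<open>The coefficient \<open>c\<close> is the derivative of \<open>e\<^bsup>-\<lambda>\<^esup>\<close>. For \<open>i = 1\<close> its term is orthogonal to the second frame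
vector, so only the first term contributes to \<open>\<alpha>\<close>.\<close>

lemma weak_partial_frame:
  "\<exists>c. has_weak_partial disc j (frame \<Phi> i) (\<lambda>x. exp (- conformal_factor \<Phi> x) *\<^sub>R wpd j (wpd i \<Phi>) x + c x *\<^sub>R wpd i \<Phi> x)"
proof -
  obtain C where C: "C > 0" "AE x in lebesgue_on disc. \<forall>i. 1 / C \<le> wpd i \<Phi> x \<bullet> wpd i \<Phi> x \<and> wpd i \<Phi> x \<bullet> wpd i \<Phi> x \<le> C"
    by (rule metric_bounds) (rule that)
  obtain M where M: "\<And>i. AE x in lebesgue_on disc. norm (wpd i \<Phi> x) \<le> M" by (rule bounded_partials) (rule that)
  have "has_weak_partial disc j (\<lambda>x. exp (- (ln (wpd 1 \<Phi> x \<bullet> wpd 1 \<Phi> x) / 2)))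
     (\<lambda>x. (- (exp (- (ln (wpd 1 \<Phi> x \<bullet> wpd 1 \<Phi> x) / 2)) * (inverse (wpd 1 \<Phi> x \<bullet> wpd 1 \<Phi> x) / 2))) * (2 * (wpd 1 \<Phi> x \<bullet> wpd j (wpd 1 \<Phi>) x)))"
    (is "has_weak_partial disc j _ ?c")
    by (rule chain_on_length[of "\<lambda>y. exp (- (ln y / 2))" "\<lambda>y. - (exp (- (ln y / 2)) * (inverse y / 2))"])
       (auto intro!: derivative_eq_intros continuous_intros simp: divide_simps)
  then have w: "has_weak_partial disc j (\<lambda>x. exp (- conformal_factor \<Phi> x)) ?c"
    unfolding conformal_factor_eq .
  have "AE x in lebesgue_on disc. \<bar>exp (- conformal_factor \<Phi> x)\<bar> \<le> exp (- (ln (1 / C) / 2))"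
    using C(2)
  proof eventually_elim
    fix x assume "\<forall>i. 1 / C \<le> wpd i \<Phi> x \<bullet> wpd i \<Phi> x \<and> wpd i \<Phi> x \<bullet> wpd i \<Phi> x \<le> C"
    then have le: "1 / C \<le> wpd 1 \<Phi> x \<bullet> wpd 1 \<Phi> x" by blast
    moreover have "0 < 1 / C" using C(1) by simp
    ultimately have "ln (1 / C) \<le> ln (wpd 1 \<Phi> x \<bullet> wpd 1 \<Phi> x)" by (subst ln_le_cancel_iff) auto
    then show "\<bar>exp (- conformal_factor \<Phi> x)\<bar> \<le> exp (- (ln (1 / C) / 2))" by (simp add: conformal_factor_eq)
  qed
  from has_weak_partial_scaleR[OF w this second_weak_partial[of j i] M[of i] open_ball]
  show ?thesis unfolding frame_def[abs_def] by (intro exI[of _ ?c])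
qed

lemma AE_symmetric_second_derivatives: "AE x in lebesgue_on disc. wpd i (wpd j \<Phi>) x = wpd j (wpd i \<Phi>) x"
  by (rule weak_partial_commute[OF weak_partial_immersion weak_partial_immersion second_weak_partial second_weak_partial open_ball])

lemma AE_derivative_of_conformality:
  "AE x in lebesgue_on disc. wpd 1 \<Phi> x \<bullet> wpd j (wpd 2 \<Phi>) x + wpd 2 \<Phi> x \<bullet> wpd j (wpd 1 \<Phi>) x = 0"
  "AE x in lebesgue_on disc. wpd 1 \<Phi> x \<bullet> wpd j (wpd 1 \<Phi>) x = wpd 2 \<Phi> x \<bullet> wpd j (wpd 2 \<Phi>) x"
proof -
  have "AE x in lebesgue_on disc. wpd 1 \<Phi> x \<bullet> wpd 2 \<Phi> x = 0"
    using AE_conformal_frame by eventually_elim (simp add: conformal_frame.orth)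
  then have "has_weak_partial disc j (\<lambda>x. 0::real) (\<lambda>x. wpd 1 \<Phi> x \<bullet> wpd j (wpd 2 \<Phi>) x + wpd 2 \<Phi> x \<bullet> wpd j (wpd 1 \<Phi>) x)"
    by (intro has_weak_partial_cong_AE[OF inner_partials_derivative[of j 1 2] _ _ open_ball]) auto
  from weak_partial_unique[OF this has_weak_partial_const[OF open_ball] open_ball]
  show "AE x in lebesgue_on disc. wpd 1 \<Phi> x \<bullet> wpd j (wpd 2 \<Phi>) x + wpd 2 \<Phi> x \<bullet> wpd j (wpd 1 \<Phi>) x = 0" .
  have "AE x in lebesgue_on disc. wpd 2 \<Phi> x \<bullet> wpd 2 \<Phi> x = wpd 1 \<Phi> x \<bullet> wpd 1 \<Phi> x"
    using AE_conformal_frame by eventually_elim (rule conformal_frame.len(2))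
  then have "has_weak_partial disc j (\<lambda>x. wpd 1 \<Phi> x \<bullet> wpd 1 \<Phi> x) (\<lambda>x. wpd 2 \<Phi> x \<bullet> wpd j (wpd 2 \<Phi>) x + wpd 2 \<Phi> x \<bullet> wpd j (wpd 2 \<Phi>) x)"
    by (intro has_weak_partial_cong_AE[OF inner_partials_derivative[of j 2 2] _ _ open_ball]) auto
  from weak_partial_unique[OF inner_partials_derivative[of j 1 1] this open_ball]
  show "AE x in lebesgue_on disc. wpd 1 \<Phi> x \<bullet> wpd j (wpd 1 \<Phi>) x = wpd 2 \<Phi> x \<bullet> wpd j (wpd 2 \<Phi>) x"
    by eventually_elim linarith
qed

text \<open>Differentiate \<open>n \<bullet> n = 1\<close> and \<open>\<Phi>\<^sub>i \<bullet> n = 0\<close>.\<close>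

lemma AE_weingarten:
  "AE x in lebesgue_on disc. wpd j n x \<bullet> n x = 0"
  "AE x in lebesgue_on disc. second_form \<Phi> x j i = - (wpd j n x \<bullet> wpd i \<Phi> x)"
proof -
  obtain M where M: "\<And>i. AE x in lebesgue_on disc. norm (wpd i \<Phi> x) \<le> M" by (rule bounded_partials) (rule that)
  have bn: "AE x in lebesgue_on disc. norm (n x) \<le> 1" by (simp add: norm_normal_le)
  have "AE x in lebesgue_on disc. n x \<bullet> n x = 1"
    using AE_conformal_frame by eventually_elim (simp add: conformal_frame.n_unit)
  then have "has_weak_partial disc j (\<lambda>x. 1::real) (\<lambda>x. n x \<bullet> wpd j n x + n x \<bullet> wpd j n x)"
    by (intro has_weak_partial_cong_AE[OF has_weak_partial_inner[OF weak_partial_normal bn weak_partial_normal bn open_ball] _ _ open_ball]) auto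
  from weak_partial_unique[OF this has_weak_partial_const[OF open_ball] open_ball]
  show "AE x in lebesgue_on disc. wpd j n x \<bullet> n x = 0"
    by eventually_elim (simp add: inner_commute)
  have "wpd i \<Phi> x \<bullet> n x = 0" for x
    using exhaust_2[of i] by (auto simp: unit_normal_def dot_cross_self)
  then have "has_weak_partial disc j (\<lambda>x. 0::real) (\<lambda>x. wpd i \<Phi> x \<bullet> wpd j n x + n x \<bullet> wpd j (wpd i \<Phi>) x)"
    using has_weak_partial_inner[OF second_weak_partial M weak_partial_normal bn open_ball, of j i] by simp
  from weak_partial_unique[OF this has_weak_partial_const[OF open_ball] open_ball]
  show "AE x in lebesgue_on disc. second_form \<Phi> x j i = - (wpd j n x \<bullet> wpd i \<Phi> x)"
    by eventually_elim (simp add: second_form_def inner_commute)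
qed

text \<open>The equation \<open>\<alpha> = *d\<lambda>\<close>. By orthogonality \<open>e\<^bsup>2\<lambda>\<^esup> \<alpha>\<^sub>j\<close> is the product of \<open>\<Phi>\<^sub>2\<close> with \<open>\<partial>\<^sub>j\<Phi>\<^sub>1\<close>. For \<open>j = 1\<close>
the derivative of \<open>\<Phi>\<^sub>1 \<bullet> \<Phi>\<^sub>2 = 0\<close> moves \<open>\<partial>\<^sub>1\<close> to the other factor, for \<open>j = 2\<close> one uses \<open>|\<Phi>\<^sub>1| = |\<Phi>\<^sub>2|\<close>; in both
cases the symmetry of second derivatives completes the computation.\<close>

lemma AE_connection_form:
  "AE x in lebesgue_on disc. connection_form \<Phi> x 1 = - wpd 2 (conformal_factor \<Phi>) x"
  "AE x in lebesgue_on disc. connection_form \<Phi> x 2 = wpd 1 (conformal_factor \<Phi>) x"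
proof -
  have c: "AE x in lebesgue_on disc. connection_form \<Phi> x j = (wpd 2 \<Phi> x \<bullet> wpd j (wpd 1 \<Phi>) x) / (wpd 1 \<Phi> x \<bullet> wpd 1 \<Phi> x)" for j
  proof -
    obtain c where "has_weak_partial disc j (frame \<Phi> 1) (\<lambda>x. exp (- conformal_factor \<Phi> x) *\<^sub>R wpd j (wpd 1 \<Phi>) x + c x *\<^sub>R wpd 1 \<Phi> x)"
      using weak_partial_frame by blast
    from wpd_unique[OF this] AE_conformal_frame show ?thesis
    proof eventually_elim
      fix x assume e: "wpd j (frame \<Phi> 1) x = exp (- conformal_factor \<Phi> x) *\<^sub>R wpd j (wpd 1 \<Phi>) x + c x *\<^sub>R wpd 1 \<Phi> x"
        and cf: "conformal_frame (wpd 1 \<Phi> x) (wpd 2 \<Phi> x) (n x) (wpd 1 \<Phi> x \<bullet> wpd 1 \<Phi> x)"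
      have o: "wpd 2 \<Phi> x \<bullet> wpd 1 \<Phi> x = 0" using conformal_frame.orth[OF cf] by (simp add: inner_commute)
      have "connection_form \<Phi> x j = (exp (- conformal_factor \<Phi> x) * exp (- conformal_factor \<Phi> x)) * (wpd 2 \<Phi> x \<bullet> wpd j (wpd 1 \<Phi>) x)"
        by (simp add: connection_form_def frame_def[of _ 2] e inner_add_right o)
      also have "exp (- conformal_factor \<Phi> x) * exp (- conformal_factor \<Phi> x) = 1 / (wpd 1 \<Phi> x \<bullet> wpd 1 \<Phi> x)"
        using exp_conformal_factor[OF refl conformal_frame.s_pos[OF cf]] by (simp add: exp_add[symmetric])
      finally show "connection_form \<Phi> x j = (wpd 2 \<Phi> x \<bullet> wpd j (wpd 1 \<Phi>) x) / (wpd 1 \<Phi> x \<bullet> wpd 1 \<Phi> x)" by simp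
    qed
  qed
  note l = wpd_unique[OF weak_partial_conformal_factor]
  show "AE x in lebesgue_on disc. connection_form \<Phi> x 1 = - wpd 2 (conformal_factor \<Phi>) x"
    using c[of 1] l[of 2] AE_derivative_of_conformality(1)[of 1] AE_symmetric_second_derivatives[of 1 2]
  proof eventually_elim
    fix x
    assume c: "connection_form \<Phi> x 1 = (wpd 2 \<Phi> x \<bullet> wpd 1 (wpd 1 \<Phi>) x) / (wpd 1 \<Phi> x \<bullet> wpd 1 \<Phi> x)"
      and l: "wpd 2 (conformal_factor \<Phi>) x = (wpd 1 \<Phi> x \<bullet> wpd 2 (wpd 1 \<Phi>) x) / (wpd 1 \<Phi> x \<bullet> wpd 1 \<Phi> x)"
      and o: "wpd 1 \<Phi> x \<bullet> wpd 1 (wpd 2 \<Phi>) x + wpd 2 \<Phi> x \<bullet> wpd 1 (wpd 1 \<Phi>) x = 0"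
      and s: "wpd 1 (wpd 2 \<Phi>) x = wpd 2 (wpd 1 \<Phi>) x"
    have "wpd 2 \<Phi> x \<bullet> wpd 1 (wpd 1 \<Phi>) x = - (wpd 1 \<Phi> x \<bullet> wpd 2 (wpd 1 \<Phi>) x)"
      using o unfolding s by linarith
    then show "connection_form \<Phi> x 1 = - wpd 2 (conformal_factor \<Phi>) x" unfolding c l by simp
  qed
  show "AE x in lebesgue_on disc. connection_form \<Phi> x 2 = wpd 1 (conformal_factor \<Phi>) x"
    using c[of 2] l[of 1] AE_derivative_of_conformality(2)[of 1] AE_symmetric_second_derivatives[of 1 2]
    by eventually_elim simp
qed

text \<open>The potential is minus the Gauss map, regarded as a bivector field.\<close>

lemma is_potential_normal: "is_potential \<Phi> (\<lambda>x. - bivector (n x))"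
  unfolding is_potential_def
proof (intro conjI ballI allI)
  interpret bv: linear bivector by (rule linear_bivector)
  show "- bivector (n x) \<in> Lambda2" for x
    using bivector_in_Lambda2[of "- n x"] by (simp add: bv.neg)
  fix j
  have "bounded_linear (\<lambda>w. - bivector w)"
    using linear_bivector by (intro bounded_linear_minus) (simp add: linear_conv_bounded_linear)
  then have w: "has_weak_partial disc j (\<lambda>x. - bivector (n x)) (\<lambda>x. - bivector (wpd j n x))"
    by (rule has_weak_partial_linear[OF _ weak_partial_normal open_ball])
  have "AE x in lebesgue_on disc. \<forall>i. second_form \<Phi> x j i = - (wpd j n x \<bullet> wpd i \<Phi> x)"
    by (intro eventually_all_finite AE_weingarten(2))
  then have "AE x in lebesgue_on disc. - bivector (wpd j n x) = - contract (conformal_factor \<Phi> x) (second_form \<Phi> x)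
                (\<lambda>i. wedge (hodge (differential \<Phi> x) i) (n x)) j"
    using AE_weingarten(1)[of j] AE_conformal_frame
    by eventually_elim (rule potential_gradient_eq[symmetric], auto)
  then show "has_weak_partial disc j (\<lambda>x. - bivector (n x)) (\<lambda>x. - contract (conformal_factor \<Phi> x) (second_form \<Phi> x)
                (\<lambda>i. wedge (hodge (differential \<Phi> x) i) (n x)) j)"
    by (intro has_weak_partial_cong_AE[OF w _ _ open_ball]) auto
qed

lemma potential_unique:
  assumes "is_potential \<Phi> D" "is_potential \<Phi> D'"
  shows "\<exists>c. AE x in lebesgue_on disc. D' x = D x + c"
proof -
  have "has_weak_partial disc j (\<lambda>x. D' x + - D x) (\<lambda>x. 0)" for j
    using has_weak_partial_add[OF assms(2)[unfolded is_potential_def, THEN conjunct2, rule_format, of j]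
        has_weak_partial_linear[OF bounded_linear_minus[OF bounded_linear_ident] assms(1)[unfolded is_potential_def, THEN conjunct2, rule_format, of j] open_ball] open_ball]
    by simp
  from weak_gradient_zero_imp_constant[OF this open_ball convex_ball]
  obtain c where "AE x in lebesgue_on disc. D' x + - D x = c" by blast
  then have "AE x in lebesgue_on disc. D' x = D x + c" by eventually_elim (simp add: algebra_simps)
  then show ?thesis by blast
qed

lemma AE_dot_bracket:
  "AE x in lebesgue_on disc. dot_forms (conformal_factor \<Phi> x) (hodge (differential \<Phi> x)) (bracket \<Phi> x) = 0"
  using AE_conformal_frame by eventually_elim (rule dot_bracket_eq_0)

lemma AE_wedge_bracket:
  assumes "is_potential \<Phi> D"
  shows "AE x in lebesgue_on disc.
     wedge_forms (conformal_factor \<Phi> x) (hodge (differential \<Phi> x)) (bracket \<Phi> x) =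
     - pair_forms (conformal_factor \<Phi> x) (hodge (differential (conformal_factor \<Phi>) x)) (differential D x)"
proof -
  have "AE x in lebesgue_on disc. wpd j D x = - contract (conformal_factor \<Phi> x) (second_form \<Phi> x)
                (\<lambda>i. wedge (hodge (differential \<Phi> x) i) (n x)) j" for j
    by (rule wpd_unique) (use assms in \<open>simp add: is_potential_def\<close>)
  then have "AE x in lebesgue_on disc. \<forall>j. wpd j D x = - contract (conformal_factor \<Phi> x) (second_form \<Phi> x)
                (\<lambda>i. wedge (hodge (differential \<Phi> x) i) (n x)) j"
    by (intro eventually_all_finite)
  then show ?thesis
    using AE_conformal_frame AE_symmetric_second_derivatives[of 1 2] AE_connection_form
    by eventually_elim (rule wedge_bracket_eq, auto simp: second_form_def)
qed

end

theorem proposition4: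
  fixes \<Phi> :: "real^2 \<Rightarrow> real^3"
  assumes "\<Phi> \<in> weak_immersions"
    and "weakly_conformal \<Phi>"
  shows "((\<forall>i. weakly_differentiable disc (wpd i \<Phi>)) \<and>
          (\<forall>i. weakly_differentiable disc (frame \<Phi> i)) \<and>
          weakly_differentiable disc (conformal_factor \<Phi>)) \<and>
         (AE x in lebesgue_on disc.
            dot_forms (conformal_factor \<Phi> x) (hodge (differential \<Phi> x)) (bracket \<Phi> x) = 0) \<and>
         (\<exists>D. is_potential \<Phi> D) \<and>
         (\<forall>D D'. is_potential \<Phi> D \<longrightarrow> is_potential \<Phi> D' \<longrightarrow>
            (\<exists>c. AE x in lebesgue_on disc. D' x = D x + c)) \<and>
         (\<forall>D. is_potential \<Phi> D \<longrightarrow>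
            (AE x in lebesgue_on disc.
               wedge_forms (conformal_factor \<Phi> x) (hodge (differential \<Phi> x)) (bracket \<Phi> x) =
               - pair_forms (conformal_factor \<Phi> x)
                   (hodge (differential (conformal_factor \<Phi>) x)) (differential D x)))"
proof -
  interpret weak_conformal_immersion \<Phi> using assms by unfold_locales
  have "weakly_differentiable disc (wpd i \<Phi>)" "weakly_differentiable disc (frame \<Phi> i)"
    "weakly_differentiable disc (conformal_factor \<Phi>)" for i
    unfolding weakly_differentiable_def
    using second_weak_partial weak_partial_frame weak_partial_conformal_factor by blast+
  then show ?thesis
    using AE_dot_bracket is_potential_normal potential_unique AE_wedge_bracket by blast
qed

end
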